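(* Let $n\ge 3$. Then for all $f\in D^{1,2}(\mathbb{R}^n)$ the following equalities hold: $$\left(\frac{n-2}{2}\right)^2\left\|\frac{f}{|x|}\right\|_2^2=\|\partial_r f\|_2^2-\left\|\partial_r f+\frac{n-2}{2|x|}f\right\|_2^2=\|\partial_r f\|_2^2-\left\||x|^{-\frac{n-2}{2}}\,\partial_r\!\left(|x|^{\frac{n-2}{2}}f\right)\right\|_2^2 .$$ Moreover, the remainder term $\left\|\partial_r f+\frac{n-2}{2|x|}f\right\|_2^2$ (equivalently $\left\||x|^{-\frac{n-2}{2}}\partial_r(|x|^{\frac{n-2}{2}}f)\right\|_2^2$) vanishes if and only if $f$ takes the form $$f(x)=|x|^{-\frac{n-2}{2}}\varphi\!\left(\frac{x}{|x|}\right)$$ for some function $\varphi:S^{n-1}\to\mathbb{C}$. A function $f$ of this form makes $\left\|\frac{f}{|x|}\right\|_2$ infinite unless $\int_{S^{n-1}}|\varphi(\omega)|^2\,d\sigma(\omega)=0$; that is, unless this integral is zero, $$\frac{|f(x)|^2}{|x|^2}=\frac{\left|\varphi\left(\frac{x}{|x|}\right)\right|^2}{|x|^n}\notin L^1(\mathbb{R}^n).$$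
   Context: Functions are complex-valued and measurable, and identities between functions are understood almost everywhere. $\|\cdot\|_2$ is the standard norm of $L^2(\mathbb{R}^n)$. $D^{1,2}(\mathbb{R}^n)$ is the completion of $C_0^\infty(\mathbb{R}^n)$ (complex-valued) under the Dirichlet norm $\|\nabla\cdot\|_2$. $\partial_r$ is the radial derivative $\partial_r=\frac{x}{|x|}\cdot\nabla=\sum_{j=1}^n\frac{x_j}{|x|}\partial_j$. $S^{n-1}$ is the unit sphere in $\mathbb{R}^n$ endowed with the (surface) Lebesgue measure $\sigma$. *)

theory Defs
  imports "HOL-Analysis.Analysis"
begin

primrec Ck :: "nat \<Rightarrow> (real^'n \<Rightarrow> complex) \<Rightarrow> bool" where
  "Ck 0 u \<longleftrightarrow> continuous_on UNIV u"
| "Ck (Suc k) u \<longleftrightarrow> u differentiable_on UNIV \<and>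
     (\<forall>j. Ck k (\<lambda>x. frechet_derivative u (at x) (axis j 1)))"

definition smooth :: "(real^'n \<Rightarrow> complex) \<Rightarrow> bool" where
  "smooth u \<longleftrightarrow> (\<forall>k. Ck k u)"

definition test_functions :: "(real^'n) set \<Rightarrow> (real^'n \<Rightarrow> complex) set" where
  "test_functions \<Omega> =
     {u. smooth u \<and> compact (closure {x. u x \<noteq> 0}) \<and> closure {x. u x \<noteq> 0} \<subseteq> \<Omega>}"

definition grad :: "(real^'n \<Rightarrow> complex) \<Rightarrow> real^'n \<Rightarrow> complex^'n" where
  "grad u x = (\<chi> j. frechet_derivative u (at x) (axis j 1))"

text \<open>The norm takes the value \<open>\<infinity>\<close> on functions outside \<open>L\<^sup>2\<close>.\<close>

definition L2norm :: "(real^'n \<Rightarrow> 'b::real_normed_vector) \<Rightarrow> ennreal" where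
  "L2norm f = (let I = (\<integral>\<^sup>+x. ennreal ((norm (f x))\<^sup>2) \<partial>lebesgue)
               in if I = \<infinity> then \<infinity> else ennreal (sqrt (enn2real I)))"

text \<open>The completion of the test functions under the Dirichlet norm, realised as a space of
  functions: in dimension at least 3 a Dirichlet--Cauchy sequence of test functions
  converges in \<open>L\<^sup>1\<^sub>l\<^sub>o\<^sub>c\<close> (by the Sobolev inequality), its limit is
  determined by its class in the completion, and it determines that class. The element of the
  completion is identified with this limit.\<close>

definition D12 :: "(real^'n \<Rightarrow> complex) set" where
  "D12 = {f. f \<in> borel_measurable lebesgue \<and>
     (\<exists>u :: nat \<Rightarrow> real^'n \<Rightarrow> complex.
        (\<forall>k. u k \<in> test_functions UNIV) \<and>
        (\<forall>e>0. \<exists>N. \<forall>k\<ge>N. \<forall>m\<ge>N. L2norm (grad (\<lambda>x. u k x - u m x)) < ennreal e) \<and>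
        (\<forall>K. compact K \<longrightarrow>
           (\<lambda>k. \<integral>\<^sup>+x\<in>K. ennreal (norm (u k x - f x)) \<partial>lebesgue) \<longlonglongrightarrow> 0))}"

definition loc_integrable_on :: "(real^'n) set \<Rightarrow> (real^'n \<Rightarrow> complex) \<Rightarrow> bool" where
  "loc_integrable_on \<Omega> f \<longleftrightarrow> (\<forall>K. compact K \<and> K \<subseteq> \<Omega> \<longrightarrow> set_integrable lebesgue K f)"

definition is_weak_partial ::
    "(real^'n) set \<Rightarrow> 'n \<Rightarrow> (real^'n \<Rightarrow> complex) \<Rightarrow> (real^'n \<Rightarrow> complex) \<Rightarrow> bool" where
  "is_weak_partial \<Omega> j f g \<longleftrightarrow> loc_integrable_on \<Omega> f \<and> loc_integrable_on \<Omega> g \<and>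
     (\<forall>\<psi>\<in>test_functions \<Omega>.
        (LINT x|lebesgue. f x * grad \<psi> x $ j) = - (LINT x|lebesgue. g x * \<psi> x))"

text \<open>The vector field \<open>x / |x|\<close> is singular at the origin, so derivatives are taken
  on the punctured space. A function with a weak derivative on the whole space has, almost everywhere,
  the same weak derivative there.\<close>

definition weak_partial :: "'n \<Rightarrow> (real^'n \<Rightarrow> complex) \<Rightarrow> real^'n \<Rightarrow> complex" where
  "weak_partial j f = (SOME g. is_weak_partial (- {0}) j f g)"

definition weakly_differentiable :: "(real^'n \<Rightarrow> complex) \<Rightarrow> bool" where
  "weakly_differentiable f \<longleftrightarrow> (\<forall>j. \<exists>g. is_weak_partial (- {0}) j f g)"

definition radial_deriv :: "(real^'n \<Rightarrow> complex) \<Rightarrow> real^'n \<Rightarrow> complex" where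
  "radial_deriv f x = (\<Sum>j\<in>UNIV. complex_of_real (x $ j / norm x) * weak_partial j f x)"

text \<open>The surface measure of a Borel set \<open>A\<close> of the sphere is \<open>n\<close> times the volume of
  the cone \<open>{r \<omega> | 0 < r < 1, \<omega> \<in> A}\<close>; the completion makes all Lebesgue measurable
  functions on the sphere measurable.\<close>

definition surface_measure :: "(real^'n) measure" where
  "surface_measure = completion (scale_measure (of_nat CARD('n))
     (distr (restrict_space lborel (ball 0 1 - {0})) (restrict_space borel (sphere 0 1))
        (\<lambda>x. x /\<^sub>R norm x)))"

definition remainder1 :: "(real^'n \<Rightarrow> complex) \<Rightarrow> real^'n \<Rightarrow> complex" where
  "remainder1 f x = radial_deriv f x
     + complex_of_real ((real CARD('n) - 2) / (2 * norm x)) * f x"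

definition remainder2 :: "(real^'n \<Rightarrow> complex) \<Rightarrow> real^'n \<Rightarrow> complex" where
  "remainder2 f x = complex_of_real (norm x powr (- ((real CARD('n) - 2) / 2)))
     * radial_deriv
         (\<lambda>y. complex_of_real (norm y powr ((real CARD('n) - 2) / 2)) * f y) x"

definition has_angular_profile ::
    "(real^'n \<Rightarrow> complex) \<Rightarrow> (real^'n \<Rightarrow> complex) \<Rightarrow> bool" where
  "has_angular_profile f \<phi> \<longleftrightarrow> \<phi> \<in> borel_measurable surface_measure \<and>
     (AE x in lebesgue. f x =
        complex_of_real (norm x powr (- ((real CARD('n) - 2) / 2))) * \<phi> (x /\<^sub>R norm x))"

end

theory Submission imports Defs begin

text \<open>
  For a test function \<open>u\<close> put \<open>w = |u|\<^sup>2\<close> and \<open>c = (n - 2) / 2\<close>. Integrating the divergence of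
  \<open>w x / (|x|\<^sup>2 + \<epsilon>)\<close> to zero and absorbing the cross term by Young's inequality gives Hardy's
  inequality uniformly in \<open>\<epsilon>\<close>; it supplies the majorant for \<open>\<epsilon> \<rightarrow> 0\<close>, and in the limit
  \<open>\<integral> 2 Re (u\<^sup>* \<partial>\<^sub>r u) / |x| = - 2 c \<integral> w / |x|\<^sup>2\<close>, which is the identity after expanding the square in the
  remainder. By Hardy's inequality a Dirichlet--Cauchy sequence is also Cauchy in the weighted
  norm, so the identity passes to the completion.

  With \<open>h = |x|\<^sup>c f\<close> the remainder vanishes iff \<open>x \<cdot> \<nabla>h = 0\<close> weakly on the punctured space. For a
  test function \<open>\<psi>\<close> the derivative of \<open>t \<mapsto> \<integral> h(x) t\<^sup>n \<psi>(t x) dx = \<integral> h(x / t) \<psi>(x) dx\<close> is the pairing of \<open>x \<cdot> \<nabla>h\<close>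
  with a test function, so this means \<open>h(t x) = h(x)\<close> almost everywhere for each \<open>t > 0\<close>; Fubini's theorem
  then lets one average over rays to find the profile. Finally, the integral of a
  \<open>0\<close>-homogeneous nonnegative function against \<open>|x|\<^sup>-\<^sup>n\<close> over a ball does not depend on the
  radius, hence it is \<open>0\<close> or \<open>\<infinity>\<close>.
\<close>

section \<open>Test functions and the fundamental lemma of the calculus of variations\<close>

text \<open>The natural field is \<open>x / |x|^2\<close>: its divergence is
  \<open>(n - 2) / |x|^2 = 2 c / |x|^2\<close>, which is where c comes from. It is singular at 0,
  where a test function need not vanish, hence the regularisation by \<epsilon>. Since n \<ge> 3
  makes c positive, the divergence term is strong enough to absorb the cross term. Elements of the
  completion are L1_loc limits, whereas the estimates produce L2 limits of \<open>grad (u k)\<close>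
  and \<open>u k / |x|\<close>. These must be recognised as the weak gradient of f and as
  \<open>f / |x|\<close>, through almost everywhere convergent subsequences and integration by
  parts. The derivatives in the statement are picked by \<open>SOME\<close>, so they are determined
  only up to null sets and every identity about them holds almost everywhere. Likewise the null set
  in \<open>h (t x) = h x\<close> depends on t, and it takes Fubini's theorem to find rays on which
  h is constant for almost all t at once. That needs joint measurability, so h is first replaced by
  a Borel representative; profiles are treated likewise, because \<open>surface_measure\<close> is
  completed.\<close>

abbreviation partial :: "'n \<Rightarrow> (real^'n \<Rightarrow> complex) \<Rightarrow> real^'n \<Rightarrow> complex" where
  "partial j u x \<equiv> frechet_derivative u (at x) (axis j 1)"

abbreviation cnorm :: "'a::real_normed_vector \<Rightarrow> complex" where
  "cnorm x \<equiv> complex_of_real (norm x)"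

abbreviation npow :: "'a::real_normed_vector \<Rightarrow> real \<Rightarrow> complex" where
  "npow x a \<equiv> complex_of_real (norm x powr a)"

section \<open>Algebra of smooth functions\<close>

lemma Ck_SucD: "Ck (Suc k) u ==> Ck k u"
proof (induction k arbitrary: u)
  case 0 then show ?case by (simp add: differentiable_imp_continuous_on)
next
  case (Suc k) then show ?case by auto
qed

lemma Ck_const: "Ck k (\<lambda>x. c)"
  by (induction k arbitrary: c) (auto simp: frechet_derivative_const)

lemma Ck_add:
  fixes u v :: "real^'n \<Rightarrow> complex"
  shows "Ck k u ==> Ck k v ==> Ck k (\<lambda>x. u x + v x)"
proof (induction k arbitrary: u v)
  case 0 then show ?case by (auto intro: continuous_intros)
next
  case (Suc k)
  then have d: "u differentiable at x" "v differentiable at x" for x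
    by (auto simp: differentiable_on_def)
  have "frechet_derivative (\<lambda>x. u x + v x) (at x) w
      = frechet_derivative u (at x) w + frechet_derivative v (at x) w" for x w
    using frechet_derivative_at[OF has_derivative_add[OF d[unfolded frechet_derivative_works]]]
    by metis
  then show ?case using Suc by (auto intro: differentiable_on_add)
qed

lemma Ck_mult:
  fixes u v :: "real^'n \<Rightarrow> complex"
  shows "Ck k u ==> Ck k v ==> Ck k (\<lambda>x. u x * v x)"
proof (induction k arbitrary: u v)
  case 0 then show ?case by (auto intro: continuous_intros)
next
  case (Suc k)
  then have d: "u differentiable at x" "v differentiable at x" for x
    by (auto simp: differentiable_on_def)
  have "frechet_derivative (\<lambda>x. u x * v x) (at x) w
      = u x * frechet_derivative v (at x) w + frechet_derivative u (at x) w * v x" for x w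
    using frechet_derivative_at[OF has_derivative_mult[OF d[unfolded frechet_derivative_works]]]
    by metis
  \<comment> \<open>Each term of the product rule keeps one factor undifferentiated, so that
    factor's regularity has to be lowered by one.\<close>
  moreover have "Ck k u" "Ck k v" using Suc.prems Ck_SucD by blast+
  ultimately show ?case using Suc by (auto intro!: Ck_add simp: differentiable_on_def)
qed

lemma Ck_prod:
  fixes u :: "'i \<Rightarrow> real^'n \<Rightarrow> complex"
  assumes "finite I" "\<And>i. i \<in> I ==> Ck k (u i)"
  shows "Ck k (\<lambda>x. \<Prod>i\<in>I. u i x)"
  using assms by (induction I rule: finite_induct) (auto intro: Ck_const Ck_mult)

lemma smooth_differentiable: "smooth u ==> u differentiable at x"
  unfolding smooth_def by (metis Ck.simps(2) UNIV_I differentiable_on_def)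

lemma smooth_partial: "smooth u ==> smooth (\<lambda>x. partial j u x)"
  unfolding smooth_def by (metis Ck.simps(2))

lemma smooth_continuous: "smooth u ==> continuous_on UNIV u"
  unfolding smooth_def by (metis Ck.simps(1))

lemma smooth_has_derivative:
  "smooth u ==> (u has_derivative frechet_derivative u (at x)) (at x)"
  using smooth_differentiable frechet_derivative_works by blast

lemma smooth_mult: "smooth u ==> smooth v ==> smooth (\<lambda>x. u x * v x)"
  unfolding smooth_def by (simp add: Ck_mult)

lemma smooth_add: "smooth u ==> smooth v ==> smooth (\<lambda>x. u x + v x)"
  unfolding smooth_def by (simp add: Ck_add)

lemma smooth_const: "smooth (\<lambda>x. c)"
  unfolding smooth_def by (simp add: Ck_const)

lemma smooth_diff: "smooth u ==> smooth v ==> smooth (\<lambda>x. u x - v x)"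
  using smooth_add[of u "\<lambda>x. (-1) * v x"] smooth_mult[OF smooth_const[of "-1"]] by auto

lemma smooth_coord: "smooth (\<lambda>x::real^'n. complex_of_real (x $ i))"
  unfolding smooth_def
proof
  fix k
  have d: "((\<lambda>x::real^'n. complex_of_real (x $ i)) has_derivative (\<lambda>v. complex_of_real (v $ i))) (at x)" for x
    by (auto intro!: derivative_eq_intros bounded_linear.has_derivative[OF bounded_linear_vec_nth])
  show "Ck k (\<lambda>x::real^'n. complex_of_real (x $ i))"
  proof (cases k)
    case 0 then show ?thesis by (auto intro!: continuous_intros)
  next
    case (Suc l)
    have "frechet_derivative (\<lambda>x::real^'n. complex_of_real (x $ i)) (at x) = (\<lambda>v. complex_of_real (v $ i))" for x
      using frechet_derivative_at[OF d] by metis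
    then show ?thesis using d Suc by (auto simp: Ck_const differentiable_on_def differentiable_def)
  qed
qed

section \<open>Smooth bumps supported in boxes\<close>

definition flat :: "nat \<Rightarrow> real \<Rightarrow> real" where
  "flat k t = (if t > 0 then exp (- (1 / t)) / t ^ k else 0)"

text \<open>As \<open>flat k 0 = 0\<close>, this is the difference quotient at the origin. On the
  right, \<open>y = 1 / h\<close> turns it into \<open>y ^ (k + 1) / exp y\<close>; on the left it
  vanishes.\<close>

lemma flat_over_t_tendsto_0: "((\<lambda>h. flat k h / h) \<longlongrightarrow> 0) (at 0)"
proof -
  have "((\<lambda>y::real. y ^ Suc k / exp y) \<longlongrightarrow> 0) at_top" by (rule tendsto_power_div_exp_0)
  then have "((\<lambda>h::real. (inverse h) ^ Suc k / exp (inverse h)) \<longlongrightarrow> 0) (at_right 0)"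
    by (rule filterlim_compose[OF _ filterlim_inverse_at_top_right])
  then have "((\<lambda>h. flat k h / h) \<longlongrightarrow> 0) (at_right 0)"
    by (rule Lim_transform_eventually)
      (auto simp: eventually_at_filter flat_def exp_minus field_simps)
  moreover have "((\<lambda>h. flat k h / h) \<longlongrightarrow> 0) (at_left 0)"
    by (rule Lim_transform_eventually[of "\<lambda>_. 0"])
      (auto simp: eventually_at_filter flat_def)
  ultimately show ?thesis by (simp add: filterlim_split_at)
qed

text \<open>The powers of t in the denominator make the family closed under differentiation: each
  derivative combines two further members. So \<open>smooth_flat\<close> can treat all orders in one
  induction with k arbitrary.\<close>

lemma flat_has_derivative:
  "(flat k has_real_derivative (flat (k + 2) t - k * flat (k + 1) t)) (at t)"
proof -
  consider "t > 0" | "t < 0" | "t = 0" by linarith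
  then show ?thesis
  proof cases
    case 1
    have "((\<lambda>t. exp (- (1 / t)) / t ^ k) has_real_derivative
         (flat (k + 2) t - k * flat (k + 1) t)) (at t)"
    proof (cases k)
      case 0
      then show ?thesis using 1
        by (auto intro!: derivative_eq_intros simp: flat_def field_simps power2_eq_square)
    next
      case (Suc l)
      \<comment> \<open>Truncated subtraction makes \<open>t ^ l = t * t ^ (l - 1)\<close> fail at l
        = 0, so that case is kept apart.\<close>
      have p: "l = 0 \<or> t ^ l = t * t ^ (l - Suc 0)" by (cases l) auto
      show ?thesis using 1 Suc p
        by (auto intro!: derivative_eq_intros simp: flat_def field_simps power2_eq_square)
    qed
    then show ?thesis
      by (rule has_field_derivative_transform_within_open[of _ _ _ "{0<..}"])
        (use 1 in "auto simp: flat_def")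
  next
    case 2
    have "((\<lambda>t::real. 0::real) has_real_derivative 0) (at t)" by auto
    then have "(flat k has_real_derivative 0) (at t)"
      by (rule has_field_derivative_transform_within_open[of _ _ _ "{..<0}"])
        (use 2 in "auto simp: flat_def")
    then show ?thesis using 2 by (simp add: flat_def)
  next
    case 3
    then show ?thesis using flat_over_t_tendsto_0[of k]
      by (simp add: DERIV_def) (simp add: flat_def)
  qed
qed

lemma flat_nonzero_iff: "flat k t \<noteq> 0 \<longleftrightarrow> t > 0"
  by (auto simp: flat_def)

lemma smooth_flat: "smooth (\<lambda>x::real^'n. complex_of_real (flat k (\<alpha> * x $ i + \<beta>)))"
  unfolding smooth_def
proof
  fix m
  have d: "((\<lambda>x::real^'n. complex_of_real (flat k (\<alpha> * x $ i + \<beta>))) has_derivative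
     (\<lambda>v. complex_of_real ((flat (k + 2) (\<alpha> * x $ i + \<beta>) - k * flat (k + 1) (\<alpha> * x $ i + \<beta>)) * (\<alpha> * v $ i)))) (at x)" for x k
    by (intro bounded_linear.has_derivative[OF bounded_linear_of_real]
         has_derivative_compose[OF _ flat_has_derivative[unfolded has_field_derivative_def]])
       (auto intro!: derivative_eq_intros bounded_linear.has_derivative[OF bounded_linear_vec_nth])
  show "Ck m (\<lambda>x::real^'n. complex_of_real (flat k (\<alpha> * x $ i + \<beta>)))"
  proof (induction m arbitrary: k)
    case 0
    have "continuous_on UNIV (flat k)"
      by (meson flat_has_derivative DERIV_isCont continuous_at_imp_continuous_on)
    then show ?case
      by (auto intro!: continuous_intros continuous_on_compose2[of UNIV "flat k"])
  next
    case (Suc m)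
    have e: "partial j (\<lambda>x::real^'n. complex_of_real (flat k (\<alpha> * x $ i + \<beta>))) x
      = complex_of_real (\<alpha> * axis j 1 $ i) * complex_of_real (flat (k + 2) (\<alpha> * x $ i + \<beta>))
       + complex_of_real (- k * \<alpha> * axis j 1 $ i) * complex_of_real (flat (k + 1) (\<alpha> * x $ i + \<beta>))" for x j
      by (subst frechet_derivative_at[OF d, symmetric]) (simp add: algebra_simps)
    have "Ck m (\<lambda>x. partial j (\<lambda>x::real^'n. complex_of_real (flat k (\<alpha> * x $ i + \<beta>))) x)" for j
      unfolding e by (intro Ck_add Ck_mult Ck_const Suc.IH)
    then show ?case using d by (auto simp: differentiable_on_def differentiable_def)
  qed
qed

text \<open>Each factor is positive exactly on one side of a face, so the product lives on the open
  box for every m. Growing m does not move the support but steepens the edges, since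
  \<open>exp (- 1 / ((m + 1) s))\<close> tends to 1 for s > 0. The arguments are written as
  \<open>\<alpha> * x $ i + \<beta>\<close> to fit \<open>smooth_flat\<close>.\<close>

definition box_bump :: "nat \<Rightarrow> real^'n \<Rightarrow> real^'n \<Rightarrow> real^'n \<Rightarrow> complex" where
  "box_bump m a b x = (\<Prod>i\<in>UNIV. complex_of_real (flat 0 (real (Suc m) * x $ i + (- (real (Suc m) * a $ i))))
      * complex_of_real (flat 0 ((- real (Suc m)) * x $ i + real (Suc m) * b $ i)))"

lemma flat_le_1: "0 \<le> flat 0 t" "flat 0 t \<le> 1"
  by (auto simp: flat_def)

lemma box_bump_test:
  assumes "cbox a b \<subseteq> \<Omega>" shows "box_bump m a b \<in> test_functions \<Omega>"
proof -
  have s: "smooth (box_bump m a b)"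
    unfolding box_bump_def smooth_def
    by (intro allI Ck_prod Ck_mult smooth_flat[unfolded smooth_def, rule_format]) auto
  have sub: "{x. box_bump m a b x \<noteq> 0} \<subseteq> cbox a b"
  proof
    fix x assume "x \<in> {x. box_bump m a b x \<noteq> 0}"
    then have "flat 0 (real (Suc m) * x $ i + (- (real (Suc m) * a $ i))) \<noteq> 0 \<and> flat 0 ((- real (Suc m)) * x $ i + real (Suc m) * b $ i) \<noteq> 0" for i
      by (auto simp: box_bump_def)
    then have *: "real (Suc m) * (x $ i - a $ i) > 0 \<and> real (Suc m) * (b $ i - x $ i) > 0" for i
      by (simp add: flat_nonzero_iff algebra_simps)
    have "x $ i \<ge> a $ i \<and> b $ i \<ge> x $ i" for i
      using *[of i] by (auto simp: zero_less_mult_iff)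
    then show "x \<in> cbox a b" by (auto simp: mem_box_cart)
  qed
  then have "closure {x. box_bump m a b x \<noteq> 0} \<subseteq> cbox a b"
    by (intro closure_minimal closed_cbox)
  then show ?thesis using s assms unfolding test_functions_def
    by (auto simp: compact_eq_bounded_closed intro: bounded_subset bounded_cbox)
qed

lemma norm_box_bump: "cmod (box_bump m a b x) \<le> indicator (cbox a b) x"
proof (cases "x \<in> cbox a b")
  case True
  then show ?thesis unfolding box_bump_def
    by (auto simp: prod_norm[symmetric] norm_mult flat_le_1 intro!: prod_le_1 mult_le_one)
next
  case False
  then have "box_bump m a b x = 0"
    \<comment> \<open>Taking the box itself as \<Omega> turns the support statement into vanishing
      outside the box.\<close>
    using box_bump_test[of a b "cbox a b" m] closure_subset[of "{x. box_bump m a b x \<noteq> 0}"]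
    by (auto simp: test_functions_def)
  then show ?thesis by simp
qed

lemma box_bump_tendsto: "(\<lambda>m. box_bump m a b x) \<longlonglongrightarrow> indicator (box a b) x"
proof (cases "x \<in> box a b")
  case True
  then have ab: "a $ i < x $ i" "x $ i < b $ i" for i by (auto simp: mem_box_cart)
  have lim: "(\<lambda>m. flat 0 (real (Suc m) * s)) \<longlonglongrightarrow> 1" if "s > 0" for s
  proof -
    have "(\<lambda>m. exp (- (1 / (real (Suc m) * s)))) \<longlonglongrightarrow> exp (- 0)"
    proof (intro tendsto_intros)
      have "(\<lambda>m. inverse (real (Suc m)) * (1 / s)) \<longlonglongrightarrow> 0 * (1 / s)"
        by (intro tendsto_intros LIMSEQ_inverse_real_of_nat)
      then show "(\<lambda>m. 1 / (real (Suc m) * s)) \<longlonglongrightarrow> 0" by (simp add: field_simps)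
    qed
    then show ?thesis using that by (simp add: flat_def)
  qed
  have "(\<lambda>m. box_bump m a b x) \<longlonglongrightarrow> (\<Prod>i\<in>(UNIV::'a set). complex_of_real 1 * complex_of_real 1)"
    unfolding box_bump_def
  proof (intro tendsto_prod tendsto_mult tendsto_of_real)
    fix i
    show "(\<lambda>m. flat 0 (real (Suc m) * x $ i + (- (real (Suc m) * a $ i)))) \<longlonglongrightarrow> 1"
      using lim[of "x $ i - a $ i"] ab[of i] by (simp add: algebra_simps)
    show "(\<lambda>m. flat 0 ((- real (Suc m)) * x $ i + real (Suc m) * b $ i)) \<longlonglongrightarrow> 1"
      using lim[of "b $ i - x $ i"] ab[of i] by (simp add: algebra_simps)
  qed
  then show ?thesis using True by simp
next
  case False
  then obtain i where i: "x $ i \<le> a $ i \<or> b $ i \<le> x $ i" by (auto simp: mem_box_cart not_less)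
  have "box_bump m a b x = 0" for m
  proof -
    have "real (Suc m) * (x $ i - a $ i) \<le> 0 \<or> real (Suc m) * (b $ i - x $ i) \<le> 0"
      using i by (auto simp: mult_le_0_iff)
    then have "flat 0 (real (Suc m) * x $ i + (- (real (Suc m) * a $ i))) = 0 \<or> flat 0 ((- real (Suc m)) * x $ i + real (Suc m) * b $ i) = 0"
      by (auto simp: flat_def algebra_simps)
    then show ?thesis unfolding box_bump_def by (auto intro!: prod_zero)
  qed
  then show ?thesis using False by simp
qed

text \<open>Box bumps are test functions, so dominated convergence makes the integral of g over
  every closed box in \<Omega> vanish. Lebesgue's differentiation theorem then gives g = 0 almost
  everywhere, box by box, and countably many boxes exhaust \<Omega>.\<close>

lemma fundamental_lemma:
  fixes g :: "real^'n \<Rightarrow> complex"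
  assumes "open \<Omega>" and g: "loc_integrable_on \<Omega> g"
    and 0: "\<And>\<psi>. \<psi> \<in> test_functions \<Omega> ==> (LINT x|lebesgue. g x * \<psi> x) = 0"
  shows "AE x in lebesgue. x \<in> \<Omega> \<longrightarrow> g x = 0"
proof -
  have box0: "integral (cbox a b) g = 0" if ab: "cbox a b \<subseteq> \<Omega>" for a b
  proof -
    have int: "set_integrable lebesgue (cbox a b) g"
      using g ab unfolding loc_integrable_on_def by auto
    have m: "(\<lambda>x. indicator (cbox a b) x *\<^sub>R g x) \<in> borel_measurable lebesgue"
      using int unfolding set_integrable_def by auto
    have bm: "box_bump m a b \<in> borel_measurable lebesgue" for m
      using box_bump_test[of a b UNIV m] smooth_continuous[of "box_bump m a b"]
      by (auto simp: test_functions_def borel_measurable_continuous_onI intro!: measurable_completion)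
    \<comment> \<open>The indicator may be inserted because the bump vanishes off the box; it
      supplies an integrable majorant although g is only locally integrable.\<close>
    have e: "g x * box_bump m a b x = (indicator (cbox a b) x *\<^sub>R g x) * box_bump m a b x" for m x
      using norm_box_bump[of m a b x] by (auto simp: indicator_def split: if_splits)
    have "(\<lambda>m. LINT x|lebesgue. (indicator (cbox a b) x *\<^sub>R g x) * box_bump m a b x)
       \<longlonglongrightarrow> (LINT x|lebesgue. (indicator (cbox a b) x *\<^sub>R g x) * indicator (box a b) x)"
    proof (rule integral_dominated_convergence)
      show "integrable lebesgue (\<lambda>x. norm (indicator (cbox a b) x *\<^sub>R g x))"
        using int unfolding set_integrable_def by (rule integrable_norm)
      show "AE x in lebesgue. (\<lambda>m. (indicator (cbox a b) x *\<^sub>R g x) * box_bump m a b x)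
              \<longlonglongrightarrow> (indicator (cbox a b) x *\<^sub>R g x) * indicator (box a b) x"
        by (intro AE_I2 tendsto_intros box_bump_tendsto)
      show "AE x in lebesgue. norm (indicator (cbox a b) x *\<^sub>R g x * box_bump m a b x)
              \<le> norm (indicator (cbox a b) x *\<^sub>R g x)" for m
        unfolding norm_mult using norm_box_bump[of m a b]
        by (intro AE_I2 mult_left_le order_trans[OF norm_box_bump[of m a b]]) (auto simp: indicator_def)
    next
      show "(\<lambda>x. (indicator (cbox a b) x *\<^sub>R g x) * indicator (box a b) x) \<in> borel_measurable lebesgue"
        using m by (intro borel_measurable_times borel_measurable_indicator) auto
      show "(\<lambda>x. (indicator (cbox a b) x *\<^sub>R g x) * box_bump m a b x) \<in> borel_measurable lebesgue" for m
        using m bm by (intro borel_measurable_times) auto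
    qed
    then have "(LINT x|lebesgue. (indicator (cbox a b) x *\<^sub>R g x) * indicator (box a b) x) = 0"
      using 0[OF box_bump_test[OF ab], unfolded e] by (simp only: LIMSEQ_const_iff)
    also have "(\<lambda>x. (indicator (cbox a b) x *\<^sub>R g x) * indicator (box a b) x) = (\<lambda>x. indicator (box a b) x *\<^sub>R g x)"
      using box_subset_cbox[of a b] by (auto simp: indicator_def fun_eq_iff)
    finally have "set_lebesgue_integral lebesgue (box a b) g = 0"
      by (simp add: set_lebesgue_integral_def)
    moreover have "set_integrable lebesgue (box a b) g"
      by (rule set_integrable_subset[OF int]) (auto simp: box_subset_cbox)
    ultimately have "integral (box a b) g = 0"
      by (simp add: set_lebesgue_integral_eq_integral)
    then show ?thesis by (simp add: integral_open_interval)
  qed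
  have loc: "AE x in lebesgue. x \<in> box c d \<longrightarrow> g x = 0" if cd: "cbox c d \<subseteq> \<Omega>" for c d
  proof -
    \<comment> \<open>Cutting g off outside the box makes it integrable over all boxes, as the
      differentiation theorem asks.\<close>
    define f where "f x = (if x \<in> cbox c d then g x else 0)" for x
    have gi: "g absolutely_integrable_on cbox c d"
      using g cd unfolding loc_integrable_on_def by auto
    then have "f absolutely_integrable_on UNIV"
      unfolding f_def using absolutely_integrable_restrict_UNIV by blast
    then have "f integrable_on cbox a b" for a b
      by (meson absolutely_integrable_on_def integrable_on_subcbox subset_UNIV)
    \<comment> \<open>Off N, the averages over cubes with lower corner x and edge h tend to the
      value at x.\<close>
    then obtain N where N: "negligible N" and
      lim: "\<And>x e. x \<notin> N ==> 0 < e ==> \<exists>d>0. \<forall>h. 0 < h \<and> h < d \<longrightarrow> norm (integral (cbox x (x + h *\<^sub>R One)) f /\<^sub>R h ^ DIM(real^'n) - f x) < e"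
      using integrable_ccontinuous_explicit by blast
    have "f x = 0" if xN: "x \<notin> N" and xb: "x \<in> box c d" for x
    proof (rule ccontr)
      assume "f x \<noteq> 0"
      then obtain \<delta> where \<delta>: "\<delta> > 0" "\<And>h. 0 < h \<and> h < \<delta> ==> norm (integral (cbox x (x + h *\<^sub>R One)) f /\<^sub>R h ^ DIM(real^'n) - f x) < norm (f x)"
        using lim[OF xN, of "norm (f x)"] by auto
      obtain r where r: "r > 0" "ball x r \<subseteq> box c d"
        using xb open_box open_contains_ball by blast
      \<comment> \<open>The edge is short enough for the differentiation estimate and for the far
        corner \<open>x + h One\<close> to stay in the ball around x; adding 1 makes the denominator
        visibly positive.\<close>
      define h where "h = min (\<delta> / 2) (r / (2 * (norm (One::real^'n) + 1)))"
      have h: "0 < h" "h < \<delta>" using \<delta> r by (auto simp: h_def intro!: divide_pos_pos add_nonneg_pos)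
      have "norm (h *\<^sub>R (One::real^'n)) < r"
      proof -
        have "h * norm (One::real^'n) \<le> r / (2 * (norm (One::real^'n) + 1)) * norm (One::real^'n)"
          by (intro mult_right_mono) (auto simp: h_def)
        also have "\<dots> < r"
        proof -
          have pos: "t < 2 * (t + 1)" "0 < 2 * (t + 1)" if "0 \<le> t" for t :: real
            using that by auto
          have "norm (One::real^'n) < 2 * (norm (One::real^'n) + 1)"
            by (rule pos) (rule norm_ge_zero)
          then have "r * norm (One::real^'n) < r * (2 * (norm (One::real^'n) + 1))"
            using r by (intro mult_strict_left_mono) auto
          moreover have "0 < 2 * (norm (One::real^'n) + 1)"
            by (rule pos) (rule norm_ge_zero)
          ultimately show ?thesis by (simp add: pos_divide_less_eq del: distrib_left_numeral)
        qed
        finally show ?thesis using h by simp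
      qed
      then have "x + h *\<^sub>R One \<in> box c d" using r by (auto simp: subset_iff dist_norm)
      then have sub: "cbox x (x + h *\<^sub>R One) \<subseteq> cbox c d"
        using xb by (auto simp: mem_box) (meson less_imp_le order_trans)+
      have "integral (cbox x (x + h *\<^sub>R One)) f = integral (cbox x (x + h *\<^sub>R One)) g"
        by (rule integral_cong) (use sub in "auto simp: f_def")
      also have "\<dots> = 0" using box0 sub cd by blast
      finally show False using \<delta>(2)[of h] h by simp
    qed
    then have "\<And>x. x \<notin> N ==> x \<in> box c d \<longrightarrow> g x = 0"
      using box_subset_cbox[of c d] unfolding f_def by (metis subsetD)
    moreover have "AE x in lebesgue. x \<notin> N"
      using N by (simp add: negligible_iff_null_sets AE_not_in)
    ultimately show ?thesis by (auto elim: eventually_mono)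
  qed
  from open_countable_Union_open_cbox[OF \<open>open \<Omega>\<close>]
  obtain \<D> where D: "countable \<D>" "\<D> \<subseteq> Pow \<Omega>" "\<And>X. X \<in> \<D> ==> \<exists>a b. X = cbox a b" "\<Union>\<D> = \<Omega>"
    by metis
  show ?thesis
  proof -
    have "AE x in lebesgue. \<forall>X\<in>\<D>. x \<in> X \<longrightarrow> g x = 0"
    proof (subst AE_ball_countable[OF D(1)], safe)
      fix X assume "X \<in> \<D>"
      then obtain a b where X: "X = cbox a b" "cbox a b \<subseteq> \<Omega>" using D by blast
      \<comment> \<open>\<open>loc\<close> speaks of open boxes and the cover consists of closed
        ones; the faces are null.\<close>
      have "AE x in lebesgue. x \<notin> cbox a b - box a b"
        by (intro AE_not_in) (simp add: negligible_iff_null_sets[symmetric] negligible_frontier_interval)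
      then show "AE x in lebesgue. x \<in> X \<longrightarrow> g x = 0"
        using loc[OF X(2)] by eventually_elim (auto simp: X)
    qed
    then show ?thesis by eventually_elim (use D(4) in auto)
  qed
qed

section \<open>Weak derivatives on the punctured space\<close>

lemma test_smooth: "\<psi> \<in> test_functions \<Omega> ==> smooth \<psi>"
  by (simp add: test_functions_def)

lemma test_compact_support:
  "\<psi> \<in> test_functions \<Omega> ==> compact (closure {x. \<psi> x \<noteq> 0})"
  "\<psi> \<in> test_functions \<Omega> ==> closure {x. \<psi> x \<noteq> 0} \<subseteq> \<Omega>"
  by (auto simp: test_functions_def)

lemma in_closure_support: "\<psi> x \<noteq> 0 ==> x \<in> closure {x. \<psi> x \<noteq> 0}"
  using closure_subset[of "{x. \<psi> x \<noteq> 0}"] by blast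

lemma frechet_derivative_off_closure_support:
  assumes "x \<notin> closure {x. \<psi> x \<noteq> 0}"
  shows "frechet_derivative \<psi> (at x) = (\<lambda>_. 0)"
proof -
  have "((\<lambda>_. 0) has_derivative (\<lambda>_. 0)) (at x)" by simp
  then have "(\<psi> has_derivative (\<lambda>_. 0)) (at x)"
  proof (rule has_derivative_transform_within_open)
    show "open (- closure {x. \<psi> x \<noteq> 0})" by (intro open_Compl closed_closure)
    show "x \<in> - closure {x. \<psi> x \<noteq> 0}" using assms by blast
    show "\<And>y. y \<in> - closure {x. \<psi> x \<noteq> 0} ==> 0 = \<psi> y" by (metis in_closure_support ComplD)
  qed
  then show ?thesis using frechet_derivative_at by metis
qed

lemma test_supportI:
  assumes "\<psi> \<in> test_functions \<Omega>" "smooth \<eta>" "\<And>x. \<eta> x \<noteq> 0 ==> x \<in> closure {x. \<psi> x \<noteq> 0}"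
  shows "\<eta> \<in> test_functions \<Omega>"
proof -
  have "closure {x. \<eta> x \<noteq> 0} \<subseteq> closure {x. \<psi> x \<noteq> 0}"
    using assms(3) by (intro closure_minimal) auto
  moreover have "compact (closure {x. \<eta> x \<noteq> 0})"
    using calculation test_compact_support[OF assms(1)]
    by (meson closed_closure bounded_subset compact_eq_bounded_closed)
  ultimately show ?thesis using assms(1,2) by (auto simp: test_functions_def)
qed

lemma test_partial:
  assumes "\<psi> \<in> test_functions \<Omega>"
  shows "(\<lambda>x. partial j \<psi> x) \<in> test_functions \<Omega>"
  by (rule test_supportI[OF assms smooth_partial[OF test_smooth[OF assms]]])
    (metis frechet_derivative_off_closure_support)

lemma test_mult:
  assumes "\<psi> \<in> test_functions \<Omega>" "smooth \<eta>"
  shows "(\<lambda>x. \<eta> x * \<psi> x) \<in> test_functions \<Omega>"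
  by (rule test_supportI[OF assms(1) smooth_mult[OF assms(2) test_smooth[OF assms(1)]]])
    (metis in_closure_support mult_zero_right)

lemma test_diff:
  assumes "u \<in> test_functions UNIV" "v \<in> test_functions UNIV"
  shows "(\<lambda>x. u x - v x) \<in> test_functions UNIV"
proof -
  let ?A = "closure {x. u x \<noteq> 0}" and ?B = "closure {x. v x \<noteq> 0}"
  have "closure {x. u x - v x \<noteq> 0} \<subseteq> ?A \<union> ?B"
  proof (intro closure_minimal subsetI)
    fix x assume "x \<in> {x. u x - v x \<noteq> 0}"
    then have "u x \<noteq> 0 \<or> v x \<noteq> 0" by auto
    then show "x \<in> ?A \<union> ?B" using in_closure_support[of u x] in_closure_support[of v x] by blast
  qed auto
  moreover have "compact (?A \<union> ?B)" using assms test_compact_support by (intro compact_Un) blast+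
  ultimately have "compact (closure {x. u x - v x \<noteq> 0})"
    by (meson closed_closure bounded_subset compact_eq_bounded_closed)
  then show ?thesis using assms smooth_diff by (auto simp: test_functions_def)
qed

lemma frechet_derivative_expand:
  fixes u :: "real^'n \<Rightarrow> complex"
  assumes "u differentiable at x"
  shows "frechet_derivative u (at x) v = (\<Sum>j\<in>UNIV. complex_of_real (v $ j) * partial j u x)"
proof -
  have lin: "linear (frechet_derivative u (at x))" using assms by (rule linear_frechet_derivative)
  have "v = (\<Sum>j\<in>UNIV. v $ j *\<^sub>R axis j 1)" using basis_expansion[of v] by (simp add: scalar_mult_eq_scaleR)
  then have "frechet_derivative u (at x) v = frechet_derivative u (at x) (\<Sum>j\<in>UNIV. v $ j *\<^sub>R axis j 1)" by simp
  also have "\<dots> = (\<Sum>j\<in>UNIV. v $ j *\<^sub>R partial j u x)"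
    by (simp add: linear_sum[OF lin] linear_cmul[OF lin])
  finally show ?thesis by (simp add: scaleR_conv_of_real)
qed

text \<open>The support is closed and misses 0. This is what makes products with powers of the norm
  smooth, for every real exponent.\<close>

lemma test_zero_near_0:
  assumes "\<psi> \<in> test_functions (- {0::real^'n})"
  shows "\<forall>\<^sub>F x in nhds 0. \<psi> x = 0"
proof -
  have "open (- closure {x. \<psi> x \<noteq> 0})" "0 \<in> - closure {x. \<psi> x \<noteq> 0}"
    using test_compact_support(2)[OF assms] by auto
  then show ?thesis unfolding eventually_nhds using in_closure_support[of \<psi>] by (metis ComplD)
qed

text \<open>Near 0 both sides vanish with \<psi>; elsewhere this is the product rule. The derivative
  of the power is written with exponent \<open>a - 2\<close> and the factor
  \<open>x \<bullet> v\<close> because the partial derivatives then again consist of powers times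
  test functions.\<close>

lemma test_powr_has_derivative:
  fixes \<psi> :: "real^'n \<Rightarrow> complex"
  assumes "\<psi> \<in> test_functions (- {0})"
  shows "((\<lambda>x. npow x a * \<psi> x) has_derivative
    (\<lambda>v. npow x a * frechet_derivative \<psi> (at x) v
       + complex_of_real (a * norm x powr (a - 2) * (x \<bullet> v)) * \<psi> x)) (at x)"
proof (cases "x = 0")
  case True
  have z: "\<forall>\<^sub>F y in nhds 0. complex_of_real (norm y powr a) * \<psi> y = 0"
    using test_zero_near_0[OF assms] by eventually_elim simp
  then obtain S where S: "open S" "0 \<in> S" "\<And>y. y \<in> S ==> complex_of_real (norm y powr a) * \<psi> y = 0"
    unfolding eventually_nhds by auto
  have "((\<lambda>_. 0) has_derivative (\<lambda>_. 0)) (at (0::real^'n))" by simp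
  then have "((\<lambda>x. npow x a * \<psi> x) has_derivative (\<lambda>_. 0)) (at 0)"
    by (rule has_derivative_transform_within_open[of _ _ _ _ S]) (use S in auto)
  moreover have "\<psi> 0 = 0" using eventually_nhds_x_imp_x[OF test_zero_near_0[OF assms]] .
  ultimately show ?thesis using True by simp
next
  case False
  have n: "((\<lambda>x. norm x powr a) has_derivative (\<lambda>v. a * norm x powr (a - 2) * (x \<bullet> v))) (at x)"
  proof -
    have "(norm has_derivative (\<lambda>v. (x /\<^sub>R norm x) \<bullet> v)) (at x)"
    proof -
      have "(\<lambda>v. (x /\<^sub>R norm x) \<bullet> v) = (\<lambda>v. v \<bullet> sgn x)" by (simp add: fun_eq_iff sgn_div_norm inner_commute)
      then show ?thesis using has_derivative_norm[OF False] by simp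
    qed
    moreover have "((\<lambda>t. t powr a) has_derivative (\<lambda>s. s * (a * norm x powr (a - 1)))) (at (norm x))"
      using has_real_derivative_powr[of "norm x" a] False
      by (simp add: has_field_derivative_def mult_commute_abs)
    ultimately have "((\<lambda>x. norm x powr a) has_derivative (\<lambda>v. (x /\<^sub>R norm x) \<bullet> v * (a * norm x powr (a - 1)))) (at x)"
      by (rule has_derivative_compose)
    moreover have "(x /\<^sub>R norm x) \<bullet> v * (a * norm x powr (a - 1)) = a * norm x powr (a - 2) * (x \<bullet> v)" for v
    proof -
      have "norm x powr (a - 1) = norm x powr (a - 2) * norm x"
        using False powr_add[of "norm x" "a - 2" 1] by simp
      then show ?thesis using False by (simp add: field_simps)
    qed
    ultimately show ?thesis by (simp only:)
  qed
  have "\<psi> differentiable at x" using assms by (simp add: smooth_differentiable test_smooth)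
  then have d: "(\<psi> has_derivative frechet_derivative \<psi> (at x)) (at x)"
    by (simp add: frechet_derivative_works)
  show ?thesis
    using has_derivative_mult[OF bounded_linear.has_derivative[OF bounded_linear_of_real n] d]
    by (simp add: algebra_simps)
qed

text \<open>The partial derivatives are \<open>|x|^a \<partial>_j \<psi>\<close> plus
  \<open>a |x|^(a - 2) x_j \<psi>\<close>, so the induction on the order goes through once exponent
  and test function are both generalised.\<close>

lemma test_powr:
  fixes \<psi> :: "real^'n \<Rightarrow> complex"
  assumes "\<psi> \<in> test_functions (- {0})"
  shows "(\<lambda>x. npow x a * \<psi> x) \<in> test_functions (- {0})"
proof (rule test_supportI[OF assms])
  show "smooth (\<lambda>x. npow x a * \<psi> x)"
    unfolding smooth_def
  proof
    fix k show "Ck k (\<lambda>x. npow x a * \<psi> x)" using assms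
    proof (induction k arbitrary: a \<psi>)
      case 0
      then show ?case using test_powr_has_derivative[OF 0, of a]
        by (simp only: Ck.simps) (meson has_derivative_continuous continuous_at_imp_continuous_on)
    next
      case (Suc k)
      note d = test_powr_has_derivative[OF Suc.prems, of a]
      have e: "partial j (\<lambda>x. npow x a * \<psi> x) x
        = npow x a * partial j \<psi> x
         + complex_of_real a * (complex_of_real (norm x powr (a - 2)) * (complex_of_real (x $ j) * \<psi> x))" for x j
        by (subst frechet_derivative_at[OF d, symmetric]) (simp add: inner_axis)
      have "Ck k (\<lambda>x. partial j (\<lambda>x. npow x a * \<psi> x) x)" for j
        unfolding e
        by (intro Ck_add Ck_mult[OF Ck_const] Suc.IH test_partial[OF Suc.prems] test_mult[OF Suc.prems smooth_coord])
      then show ?case using d by (auto simp: differentiable_on_def differentiable_def)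
    qed
  qed
qed (metis in_closure_support mult_zero_right)

section \<open>Local integrability\<close>

lemma set_integrable_mult_continuous:
  fixes f b :: "real^'n \<Rightarrow> complex"
  assumes "set_integrable lebesgue K f" "compact K" "continuous_on K b"
  shows "set_integrable lebesgue K (\<lambda>x. b x * f x)"
proof -
  have "bounded (b ` K)" using assms by (intro compact_imp_bounded compact_continuous_image)
  then obtain C where C: "\<And>x. x \<in> K ==> norm (b x) \<le> C" unfolding bounded_iff by auto
  have Kb: "K \<in> sets borel" using assms(2) by (simp add: borel_compact)
  have bm: "(\<lambda>x. indicator K x *\<^sub>R b x) \<in> borel_measurable lebesgue"
    using borel_measurable_continuous_on_indicator[OF Kb assms(3)] by (simp add: measurable_completion)
  have fm: "(\<lambda>x. indicator K x *\<^sub>R f x) \<in> borel_measurable lebesgue"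
    using assms(1) unfolding set_integrable_def by auto
  have e: "indicator K x *\<^sub>R (b x * f x) = (indicator K x *\<^sub>R b x) * (indicator K x *\<^sub>R f x)" for x
    by (auto simp: indicator_def)
  show ?thesis unfolding set_integrable_def
  proof (rule Bochner_Integration.integrable_bound)
    show "integrable lebesgue (\<lambda>x. C *\<^sub>R (indicator K x *\<^sub>R f x))"
      using assms(1) unfolding set_integrable_def by (intro integrable_scaleR_right) auto
    show "(\<lambda>x. indicator K x *\<^sub>R (b x * f x)) \<in> borel_measurable lebesgue"
      unfolding e using bm fm by (rule borel_measurable_times)
    show "AE x in lebesgue. norm (indicator K x *\<^sub>R (b x * f x)) \<le> norm (C *\<^sub>R (indicator K x *\<^sub>R f x))"
      using C by (intro AE_I2) (auto simp: indicator_def norm_mult intro!: mult_right_mono order_trans[OF C abs_ge_self])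
  qed
qed

lemma loc_integrable_mult_continuous:
  assumes "loc_integrable_on \<Omega> f" "continuous_on \<Omega> b"
  shows "loc_integrable_on \<Omega> (\<lambda>x. b x * f x)"
  using assms continuous_on_subset unfolding loc_integrable_on_def
  by (auto intro!: set_integrable_mult_continuous)

lemma loc_integrable_add:
  "loc_integrable_on \<Omega> f ==> loc_integrable_on \<Omega> g ==> loc_integrable_on \<Omega> (\<lambda>x. f x + g x)"
  unfolding loc_integrable_on_def by (auto intro: set_integral_add)

lemma loc_integrable_diff:
  "loc_integrable_on \<Omega> f ==> loc_integrable_on \<Omega> g ==> loc_integrable_on \<Omega> (\<lambda>x. f x - g x)"
  unfolding loc_integrable_on_def by (auto intro: set_integral_diff)

lemma loc_integrable_sum:
  assumes "finite I" "\<And>i. i \<in> I ==> loc_integrable_on \<Omega> (f i)"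
  shows "loc_integrable_on \<Omega> (\<lambda>x. \<Sum>i\<in>I. f i x)"
  unfolding loc_integrable_on_def set_integrable_def scaleR_sum_right
proof (intro allI impI Bochner_Integration.integrable_sum)
  fix K i assume "compact K \<and> K \<subseteq> \<Omega>" "i \<in> I"
  then show "integrable lebesgue (\<lambda>x. indicator K x *\<^sub>R f i x)"
    using assms(2) unfolding loc_integrable_on_def set_integrable_def by blast
qed

lemma integrable_mult_test:
  fixes f :: "real^'n \<Rightarrow> complex"
  assumes "loc_integrable_on \<Omega> f" "\<psi> \<in> test_functions \<Omega>"
  shows "integrable lebesgue (\<lambda>x. f x * \<psi> x)"
proof -
  let ?K = "closure {x. \<psi> x \<noteq> 0}"
  have "set_integrable lebesgue ?K (\<lambda>x. \<psi> x * f x)"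
    using assms test_compact_support[OF assms(2)] smooth_continuous[OF test_smooth[OF assms(2)]]
    by (intro set_integrable_mult_continuous) (auto simp: loc_integrable_on_def intro: continuous_on_subset)
  moreover have "indicator ?K x *\<^sub>R (\<psi> x * f x) = f x * \<psi> x" for x
    using in_closure_support[of \<psi> x] by (cases "\<psi> x = 0") (simp_all only: indicator_simps, simp_all)
  ultimately show ?thesis unfolding set_integrable_def by simp
qed

lemma weak_partial_unique:
  assumes "open \<Omega>" "is_weak_partial \<Omega> j f g" "is_weak_partial \<Omega> j f g'"
  shows "AE x in lebesgue. x \<in> \<Omega> \<longrightarrow> g x = g' x"
proof -
  have l: "loc_integrable_on \<Omega> g" "loc_integrable_on \<Omega> g'" using assms by (auto simp: is_weak_partial_def)
  have "AE x in lebesgue. x \<in> \<Omega> \<longrightarrow> g x - g' x = 0"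
  proof (rule fundamental_lemma[OF assms(1) loc_integrable_diff[OF l]])
    fix \<psi> assume "\<psi> \<in> test_functions \<Omega>"
    then show "(LINT x|lebesgue. (g x - g' x) * \<psi> x) = 0"
      using assms(2,3) integrable_mult_test[OF l(1)] integrable_mult_test[OF l(2)]
      by (auto simp: is_weak_partial_def left_diff_distrib)
  qed
  then show ?thesis by simp
qed

lemma AE_nonzero: "AE x in lebesgue. (x::real^'n) \<noteq> 0"
  using AE_not_in[of "{0}" lebesgue] by (simp add: negligible_iff_null_sets[symmetric])

text \<open>\<open>weak_partial\<close> is a choice, accessible only through uniqueness up to null
  sets: any weak derivative that has been exhibited computes it almost everywhere.\<close>

lemma weak_partialI:
  assumes "is_weak_partial (- {0}) j f g"
  shows "is_weak_partial (- {0}) j f (weak_partial j f)"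
    "AE x in lebesgue. weak_partial j f x = g x"
proof -
  show 1: "is_weak_partial (- {0}) j f (weak_partial j f)"
    unfolding weak_partial_def using assms by (rule someI[of "is_weak_partial (- {0}) j f"])
  show "AE x in lebesgue. weak_partial j f x = g x"
    using weak_partial_unique[OF open_delete[OF open_UNIV, of 0, folded Compl_eq_Diff_UNIV] 1 assms] AE_nonzero
    by eventually_elim simp
qed

lemma continuous_on_powr_norm:
  "continuous_on (- {0}) (\<lambda>x::real^'n. npow x a)"
  by (intro continuous_intros) auto

text \<open>The weak identity for f is tested against \<open>|x|^a \<psi>\<close>, which is
  admissible by \<open>test_powr\<close>. The product rule then falls on the test function, and its
  second term moves to the right-hand side.\<close>

lemma weak_partial_powr_mult:
  fixes f g :: "real^'n \<Rightarrow> complex"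
  assumes "is_weak_partial (- {0}) j f g"
  shows "is_weak_partial (- {0}) j (\<lambda>x. npow x a * f x)
    (\<lambda>x. npow x a * g x + complex_of_real (a * norm x powr (a - 2) * x $ j) * f x)"
proof -
  have l: "loc_integrable_on (- {0}) f" "loc_integrable_on (- {0}) g"
    and w: "\<And>\<psi>. \<psi> \<in> test_functions (- {0}) ==> (LINT x|lebesgue. f x * partial j \<psi> x) = - (LINT x|lebesgue. g x * \<psi> x)"
    using assms by (auto simp: is_weak_partial_def grad_def)
  have c: "continuous_on (- {0}) (\<lambda>x::real^'n. complex_of_real (a * norm x powr (a - 2) * x $ j))"
    by (intro continuous_intros) auto
  note L = loc_integrable_mult_continuous[OF l(1) continuous_on_powr_norm, of a]
    loc_integrable_mult_continuous[OF l(2) continuous_on_powr_norm, of a]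
    loc_integrable_mult_continuous[OF l(1) c]
  show ?thesis unfolding is_weak_partial_def
  proof (intro conjI ballI L loc_integrable_add)
    fix \<psi> :: "real^'n \<Rightarrow> complex" assume \<psi>: "\<psi> \<in> test_functions (- {0})"
    let ?\<eta> = "\<lambda>x. npow x a * \<psi> x"
    have \<eta>: "?\<eta> \<in> test_functions (- {0})" by (rule test_powr[OF \<psi>])
    have e: "partial j ?\<eta> x
        = npow x a * partial j \<psi> x
         + complex_of_real (a * norm x powr (a - 2) * x $ j) * \<psi> x" for x
      by (subst frechet_derivative_at[OF test_powr_has_derivative[OF \<psi>], symmetric]) (simp add: inner_axis)
    have i1: "integrable lebesgue (\<lambda>x. (npow x a * f x) * partial j \<psi> x)"
      by (rule integrable_mult_test[OF L(1) test_partial[OF \<psi>]])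
    note i2 = integrable_mult_test[OF L(2) \<psi>] and i3 = integrable_mult_test[OF L(3) \<psi>]
    have "(LINT x|lebesgue. f x * partial j ?\<eta> x) =
       (LINT x|lebesgue. (npow x a * f x) * partial j \<psi> x
          + (complex_of_real (a * norm x powr (a - 2) * x $ j) * f x) * \<psi> x)"
      unfolding e by (simp add: algebra_simps)
    also have "\<dots> = (LINT x|lebesgue. (npow x a * f x) * partial j \<psi> x)
          + (LINT x|lebesgue. (complex_of_real (a * norm x powr (a - 2) * x $ j) * f x) * \<psi> x)"
      by (rule Bochner_Integration.integral_add[OF i1 i3])
    finally have "(LINT x|lebesgue. (npow x a * f x) * partial j \<psi> x)
      = - ((LINT x|lebesgue. (npow x a * g x) * \<psi> x)
          + (LINT x|lebesgue. (complex_of_real (a * norm x powr (a - 2) * x $ j) * f x) * \<psi> x))"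
      using w[OF \<eta>] by (simp add: algebra_simps)
    also have "\<dots> = - (LINT x|lebesgue. (npow x a * g x) * \<psi> x
          + (complex_of_real (a * norm x powr (a - 2) * x $ j) * f x) * \<psi> x)"
      by (subst Bochner_Integration.integral_add[OF i2 i3]) simp
    finally show "(LINT x|lebesgue. npow x a * f x * grad \<psi> x $ j) =
         - (LINT x|lebesgue. (npow x a * g x +
               complex_of_real (a * norm x powr (a - 2) * x $ j) * f x) * \<psi> x)"
      by (simp add: grad_def distrib_right)
  qed
qed

text \<open>The operator \<open>x \<cdot> \<nabla>\<close>, generator of the dilations. Its
  coefficients are polynomials, so it moves onto test functions without the weights that the unit
  field \<open>x / |x|\<close> would bring in.\<close>

definition euler :: "(real^'n \<Rightarrow> complex) \<Rightarrow> real^'n \<Rightarrow> complex" where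
  "euler f x = (\<Sum>j\<in>UNIV. complex_of_real (x $ j) * weak_partial j f x)"

lemma radial_deriv_euler: "radial_deriv f x = euler f x / cnorm x"
  by (simp add: radial_deriv_def euler_def sum_divide_distrib)

lemma weakly_differentiable_weak_partial:
  "weakly_differentiable f ==> is_weak_partial (- {0}) j f (weak_partial j f)"
  unfolding weakly_differentiable_def using weak_partialI(1) by blast

lemma weakly_differentiable_loc_integrable:
  "weakly_differentiable f ==> loc_integrable_on (- {0}) f"
  "weakly_differentiable f ==> loc_integrable_on (- {0}) (weak_partial j f)"
  using weakly_differentiable_weak_partial[of f] by (auto simp: is_weak_partial_def)

lemma weakly_differentiable_powr_mult:
  "weakly_differentiable f ==> weakly_differentiable (\<lambda>x. npow x a * f x)"
  unfolding weakly_differentiable_def using weak_partial_powr_mult by blast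

lemma euler_loc_integrable:
  "weakly_differentiable f ==> loc_integrable_on (- {0}) (euler f)"
  unfolding euler_def
  by (intro loc_integrable_sum loc_integrable_mult_continuous weakly_differentiable_loc_integrable continuous_intros) auto

text \<open>\<open>|x|^a\<close> is homogeneous of degree a, hence an eigenfunction of the Euler
  operator with eigenvalue a.\<close>

lemma euler_powr_mult:
  fixes f :: "real^'n \<Rightarrow> complex"
  assumes "weakly_differentiable f"
  shows "AE x in lebesgue. euler (\<lambda>x. npow x a * f x) x
     = npow x a * (euler f x + complex_of_real a * f x)"
proof -
  have "AE x in lebesgue. \<forall>j. weak_partial j (\<lambda>x. npow x a * f x) x
    = npow x a * weak_partial j f x + complex_of_real (a * norm x powr (a - 2) * x $ j) * f x"
    by (subst AE_all_countable)
      (intro allI weak_partialI(2) weak_partial_powr_mult weakly_differentiable_weak_partial assms)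
  then show ?thesis using AE_nonzero
  proof eventually_elim
    case (elim x)
    have sq: "(\<Sum>j\<in>UNIV. x $ j * x $ j) = (norm x)^2" by (simp add: power2_norm_eq_inner inner_vec_def)
    have p: "norm x powr (a - 2) * (norm x)^2 = norm x powr a"
      using elim powr_add[of "norm x" "a - 2" 2] by simp
    have "euler (\<lambda>x. npow x a * f x) x =
       npow x a * euler f x + complex_of_real (a * norm x powr (a - 2) * (\<Sum>j\<in>UNIV. x $ j * x $ j)) * f x"
      unfolding euler_def using elim
      by (simp add: sum_distrib_left sum_distrib_right sum.distrib algebra_simps)
    also have "a * norm x powr (a - 2) * (\<Sum>j\<in>UNIV. x $ j * x $ j) = a * norm x powr a"
      unfolding sq by (simp add: p[symmetric])
    finally show ?case by (simp add: algebra_simps)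
  qed
qed

text \<open>For a = c the term \<open>a f\<close> of \<open>euler_powr_mult\<close>, divided by |x|,
  is the potential term of \<open>remainder1\<close>, and the two powers cancel off the
  origin.\<close>

lemma remainder2_eq_remainder1:
  fixes f :: "real^'n \<Rightarrow> complex"
  assumes "weakly_differentiable f"
  shows "AE x in lebesgue. remainder2 f x = remainder1 f x"
  using euler_powr_mult[OF assms, of "(real CARD('n) - 2) / 2"] AE_nonzero
proof eventually_elim
  case (elim x)
  have "complex_of_real (norm x powr (- ((real CARD('n) - 2) / 2))) * complex_of_real (norm x powr ((real CARD('n) - 2) / 2)) = 1"
    using elim by (simp flip: of_real_mult powr_add)
  then show ?case unfolding remainder2_def remainder1_def radial_deriv_euler elim(1)
    using elim(2) by (simp add: divide_simps)
qed

text \<open>The factor next to f is the divergence of \<open>x \<psi>\<close>: the weak derivatives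
  are tested against \<open>x_j \<psi>\<close> and summed over j.\<close>

lemma integral_euler:
  fixes f :: "real^'n \<Rightarrow> complex"
  assumes f: "weakly_differentiable f" and \<psi>: "\<psi> \<in> test_functions (- {0})"
  shows "(LINT x|lebesgue. f x * (of_nat CARD('n) * \<psi> x + frechet_derivative \<psi> (at x) x))
    = - (LINT x|lebesgue. euler f x * \<psi> x)"
proof -
  have t: "(\<lambda>x. complex_of_real (x $ j) * \<psi> x) \<in> test_functions (- {0})" for j
    by (rule test_mult[OF \<psi> smooth_coord])
  have d: "((\<lambda>x. complex_of_real (x $ j) * \<psi> x) has_derivative
     (\<lambda>v. complex_of_real (x $ j) * frechet_derivative \<psi> (at x) v + complex_of_real (v $ j) * \<psi> x)) (at x)" for x j
    by (intro has_derivative_mult smooth_has_derivative test_smooth[OF \<psi>] bounded_linear.has_derivative[OF bounded_linear_of_real]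
       bounded_linear.has_derivative[OF bounded_linear_vec_nth] has_derivative_ident)
  have e: "partial j (\<lambda>x. complex_of_real (x $ j) * \<psi> x) x =
     complex_of_real (x $ j) * partial j \<psi> x + \<psi> x" for x j
    by (subst frechet_derivative_at[OF d, symmetric]) simp
  have s: "(of_nat CARD('n) * \<psi> x + frechet_derivative \<psi> (at x) x) = (\<Sum>j\<in>UNIV. partial j (\<lambda>x. complex_of_real (x $ j) * \<psi> x) x)" for x
    unfolding e by (subst frechet_derivative_expand[OF smooth_differentiable[OF test_smooth[OF \<psi>]]]) (simp add: sum.distrib)
  have i1: "integrable lebesgue (\<lambda>x. f x * partial j (\<lambda>x. complex_of_real (x $ j) * \<psi> x) x)" for j
    by (rule integrable_mult_test[OF weakly_differentiable_loc_integrable(1)[OF f] test_partial[OF t]])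
  have i2: "integrable lebesgue (\<lambda>x. weak_partial j f x * (complex_of_real (x $ j) * \<psi> x))" for j
    by (rule integrable_mult_test[OF weakly_differentiable_loc_integrable(2)[OF f] t])
  have "(LINT x|lebesgue. f x * (of_nat CARD('n) * \<psi> x + frechet_derivative \<psi> (at x) x))
     = (\<Sum>j\<in>UNIV. LINT x|lebesgue. f x * partial j (\<lambda>x. complex_of_real (x $ j) * \<psi> x) x)"
    unfolding s sum_distrib_left using i1 by (intro Bochner_Integration.integral_sum) auto
  also have "\<dots> = (\<Sum>j\<in>UNIV. - (LINT x|lebesgue. weak_partial j f x * (complex_of_real (x $ j) * \<psi> x)))"
    using weakly_differentiable_weak_partial[OF f] t by (intro sum.cong) (auto simp: is_weak_partial_def grad_def)
  also have "\<dots> = - (LINT x|lebesgue. (\<Sum>j\<in>UNIV. weak_partial j f x * (complex_of_real (x $ j) * \<psi> x)))"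
    using i2 by (simp add: Bochner_Integration.integral_sum sum_negf)
  also have "(\<lambda>x. \<Sum>j\<in>UNIV. weak_partial j f x * (complex_of_real (x $ j) * \<psi> x)) = (\<lambda>x. euler f x * \<psi> x)"
    by (simp add: euler_def sum_distrib_left sum_distrib_right mult_ac)
  finally show ?thesis .
qed

text \<open>Local integrability controls f only on compact sets avoiding 0. Closed shells exhaust
  the punctured space, so off the origin f is the pointwise limit of its measurable restrictions to
  them.\<close>

lemma loc_integrable_measurable:
  fixes f :: "real^'n \<Rightarrow> complex"
  assumes "loc_integrable_on (- {0}) f"
  shows "f \<in> borel_measurable lebesgue"
proof -
  define K where "K m = cball (0::real^'n) (real (Suc m)) - ball 0 (1 / real (Suc m))" for m
  have K: "compact (K m)" "K m \<subseteq> - {0}" for m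
  proof -
    show "compact (K m)" unfolding K_def by (intro compact_diff compact_cball open_ball)
    have "0 \<in> ball (0::real^'n) (1 / real (Suc m))" by simp
    then show "K m \<subseteq> - {0}" unfolding K_def by blast
  qed
  have m: "(\<lambda>x. indicator (K m) x *\<^sub>R f x) \<in> borel_measurable lebesgue" for m
    using assms[unfolded loc_integrable_on_def set_integrable_def, rule_format, of "K m"] K[of m]
    by (intro borel_measurable_integrable) blast
  have lim: "(\<lambda>m. indicator (K m) x *\<^sub>R f x) \<longlonglongrightarrow> f x" if "x \<noteq> 0" for x
  proof -
    have "\<forall>\<^sub>F m in sequentially. norm x \<le> real (Suc m)"
      using filterlim_at_top[THEN iffD1, OF filterlim_real_sequentially, rule_format, of "norm x"]
      by eventually_elim auto
    moreover have "\<forall>\<^sub>F m in sequentially. 1 / real (Suc m) < norm x"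
      using order_tendstoD(2)[OF LIMSEQ_inverse_real_of_nat, of "norm x"] that
      by (simp add: inverse_eq_divide)
    ultimately have "\<forall>\<^sub>F m in sequentially. indicator (K m) x *\<^sub>R f x = f x"
      by eventually_elim (auto simp: K_def)
    then show ?thesis by (rule tendsto_eventually)
  qed
  have K0: "indicator (K m) 0 = (0::real)" for m
    using K(2)[of m] by (auto simp: indicator_def)
  have "(\<lambda>x. if x = 0 then 0 else f x) \<in> borel_measurable lebesgue"
    by (rule borel_measurable_LIMSEQ_metric[where f="\<lambda>m x. indicator (K m) x *\<^sub>R f x"])
      (use m lim K0 in auto)
  \<comment> \<open>The limit says nothing about the value at the origin; changing one point keeps
    measurability.\<close>
  then have "(\<lambda>x. if x \<in> {0} then f 0 else (if x = 0 then 0 else f x)) \<in> borel_measurable lebesgue"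
    by (intro measurable_If_set) auto
  also have "(\<lambda>x. if x \<in> {0} then f 0 else (if x = 0 then 0 else f x)) = f" by auto
  finally show ?thesis .
qed

section \<open>Hardy's identity for test functions\<close>

text \<open>The remainder quotient Q at t tends to 0 pointwise. The mean value inequality bounds the
  increment of \<rho> by B times its length, hence Q by 2 B, and dominated convergence
  applies.\<close>

lemma has_vector_derivative_lebesgue_integral:
  fixes \<rho> :: "real \<Rightarrow> 'a \<Rightarrow> 'b::{banach,second_countable_topology}"
  assumes t: "t \<in> {a<..<b}"
    and int: "\<And>s. s \<in> {a<..<b} ==> integrable M (\<rho> s)"
    and d: "\<And>s x. s \<in> {a<..<b} ==> ((\<lambda>s. \<rho> s x) has_vector_derivative \<rho>' s x) (at s)"
    and m: "\<rho>' t \<in> borel_measurable M"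
    and B: "integrable M B" "\<And>s x. s \<in> {a<..<b} ==> norm (\<rho>' s x) \<le> B x"
  shows "((\<lambda>s. LINT x|M. \<rho> s x) has_vector_derivative (LINT x|M. \<rho>' t x)) (at t)"
proof -
  have i': "integrable M (\<rho>' t)"
    by (rule Bochner_Integration.integrable_bound[OF B(1) m])
      (use B(2)[OF t] in "auto intro: order_trans[OF _ abs_ge_self]")
  define Q where "Q y x = ((\<rho> y x - \<rho> t x) - (y - t) *\<^sub>R \<rho>' t x) /\<^sub>R norm (y - t)" for y x
  have bound: "norm (Q y x) \<le> 2 * B x" if y: "y \<in> {a<..<b}" for y x
  proof -
    have "norm (\<rho> y x - \<rho> t x) \<le> B x * norm (y - t)"
    proof (rule differentiable_bound[of "{a<..<b}" "\<lambda>s. \<rho> s x" "\<lambda>s h. h *\<^sub>R \<rho>' s x"])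
      show "onorm (\<lambda>h. h *\<^sub>R \<rho>' s x) \<le> B x" if "s \<in> {a<..<b}" for s
        using B(2)[OF that, of x] by (intro onorm_le) (simp add: mult.commute[of _ "norm (\<rho>' s x)"] mult_right_mono)
      show "((\<lambda>s. \<rho> s x) has_derivative (\<lambda>h. h *\<^sub>R \<rho>' s x)) (at s within {a<..<b})" if "s \<in> {a<..<b}" for s
        using d[OF that, of x] unfolding has_vector_derivative_def by (rule has_derivative_at_withinI)
    qed (use t y in auto)
    moreover have "norm ((y - t) *\<^sub>R \<rho>' t x) \<le> B x * norm (y - t)"
      using B(2)[OF t, of x] by (simp add: mult.commute[of _ "norm (\<rho>' t x)"] mult_right_mono)
    ultimately have "norm ((\<rho> y x - \<rho> t x) - (y - t) *\<^sub>R \<rho>' t x) \<le> 2 * B x * norm (y - t)"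
      by (intro order_trans[OF norm_triangle_ineq4]) auto
    moreover have "0 \<le> B x" using B(2)[OF t, of x] norm_ge_zero order_trans by blast
    ultimately have "norm ((\<rho> y x - \<rho> t x) - (y - t) *\<^sub>R \<rho>' t x) * inverse (norm (y - t)) \<le> 2 * B x"
      by (cases "y = t") (simp_all only: divide_inverse[symmetric] pos_divide_le_eq zero_less_norm_iff
        right_minus_eq not_False_eq_True, simp)
    then show ?thesis unfolding Q_def norm_scaleR by (simp only: abs_inverse abs_norm_cancel mult.commute)
  qed
  have lim: "((\<lambda>y. Q y x) \<longlongrightarrow> 0) (at t within {a<..<b})" for x
    using has_derivative_at_withinI[OF d[OF t, of x, unfolded has_vector_derivative_def], of "{a<..<b}"]
    unfolding Q_def has_derivative_at_within by auto
  have intQ: "integrable M (Q y)" if "y \<in> {a<..<b}" for y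
    unfolding Q_def using int[OF that] int[OF t] i' by auto
  have "((\<lambda>y. LINT x|M. Q y x) \<longlongrightarrow> (LINT x|M. 0)) (at t within {a<..<b})"
    unfolding tendsto_at_iff_sequentially comp_def
  proof (intro allI impI)
    fix X assume X: "\<forall>i. X i \<in> {a<..<b} - {t}" "X \<longlonglongrightarrow> t"
    show "(\<lambda>i. LINT x|M. Q (X i) x) \<longlonglongrightarrow> (LINT x|M. 0)"
    proof (rule integral_dominated_convergence)
      show "integrable M (\<lambda>x. 2 * B x)" using B(1) by simp
      show "AE x in M. (\<lambda>i. Q (X i) x) \<longlonglongrightarrow> 0"
        using lim X unfolding tendsto_at_iff_sequentially comp_def by blast
      show "AE x in M. norm (Q (X i) x) \<le> 2 * B x" for i
        using X(1) by (intro AE_I2 bound) blast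
      show "Q (X i) \<in> borel_measurable M" for i
        using X(1) by (intro borel_measurable_integrable intQ) blast
    qed auto
  qed
  then have L: "((\<lambda>y. LINT x|M. Q y x) \<longlongrightarrow> 0) (at t within {a<..<b})" by simp
  have e: "(LINT x|M. Q y x) = (((LINT x|M. \<rho> y x) - (LINT x|M. \<rho> t x)) - (y - t) *\<^sub>R (LINT x|M. \<rho>' t x)) /\<^sub>R norm (y - t)"
    if "y \<in> {a<..<b}" for y
    unfolding Q_def using int[OF that] int[OF t] i' by simp
  have ev: "\<forall>\<^sub>F y in at t within {a<..<b}. (LINT x|M. Q y x)
      = (((LINT x|M. \<rho> y x) - (LINT x|M. \<rho> t x)) - (y - t) *\<^sub>R (LINT x|M. \<rho>' t x)) /\<^sub>R norm (y - t)"
    unfolding eventually_at_filter using e by (intro always_eventually) blast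
  have "((\<lambda>y. (((LINT x|M. \<rho> y x) - (LINT x|M. \<rho> t x)) - (y - t) *\<^sub>R (LINT x|M. \<rho>' t x)) /\<^sub>R norm (y - t)) \<longlongrightarrow> 0) (at t within {a<..<b})"
    by (intro Lim_transform_eventually[OF L ev])
  then have "((\<lambda>s. LINT x|M. \<rho> s x) has_vector_derivative (LINT x|M. \<rho>' t x)) (at t within {a<..<b})"
    unfolding has_vector_derivative_def has_derivative_at_within by (simp add: bounded_linear_scaleR_left)
  then show ?thesis using t by (simp add: has_vector_derivative_def at_within_open[of t "{a<..<b}"])
qed

lemma integrable_continuous_compact_support:
  fixes f :: "'a::euclidean_space \<Rightarrow> 'b::{banach,second_countable_topology}"
  assumes "continuous_on UNIV f" "\<And>x. norm x > R ==> f x = 0"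
  shows "integrable lborel f"
proof -
  have "integrable lborel (\<lambda>x. indicator (cball 0 R) x *\<^sub>R f x)"
    using assms(1) by (intro borel_integrable_compact) (auto intro: continuous_on_subset)
  moreover have "indicator (cball 0 R) x *\<^sub>R f x = f x" for x
    using assms(2)[of x] by (cases "norm x \<le> R") auto
  ultimately show ?thesis by simp
qed

text \<open>By translation invariance the integral of \<open>H (s v + x)\<close> does not depend on
  s, while differentiating at s = 0 under the integral gives the integral of \<open>H' x v\<close>.
  This takes the place of the fundamental theorem of calculus on lines.\<close>

lemma integral_derivative_eq_0:
  fixes H :: "'a::euclidean_space \<Rightarrow> 'b::{banach,second_countable_topology}"
  assumes d: "\<And>x. (H has_derivative H' x) (at x)"
    and c: "continuous_on UNIV (\<lambda>x. H' x v)"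
    and supp: "\<And>x. norm x > R ==> H x = 0"
  shows "integrable lborel (\<lambda>x. H' x v)" "(LINT x|lborel. H' x v) = 0"
proof -
  have supp': "H' x v = 0" if "norm x > R" for x
  proof -
    have "((\<lambda>_. 0) has_derivative (\<lambda>_. 0)) (at x)" by simp
    then have "(H has_derivative (\<lambda>_. 0)) (at x)"
    proof (rule has_derivative_transform_within_open)
      show "open {x::'a. R < norm x}" by (intro open_Collect_less continuous_intros)
    qed (use that supp in auto)
    then show ?thesis using has_derivative_unique[OF d] by metis
  qed
  show i: "integrable lborel (\<lambda>x. H' x v)"
    using c supp' by (rule integrable_continuous_compact_support)
  have cH: "continuous_on UNIV H"
    using d by (meson has_derivative_continuous continuous_at_imp_continuous_on)
  have iH: "integrable lborel H" using cH supp by (rule integrable_continuous_compact_support)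
  have Hb: "H \<in> borel_measurable borel" using cH by (rule borel_measurable_continuous_onI)
  have tr: "integrable lborel (\<lambda>x. H (s *\<^sub>R v + x))" "(LINT x|lborel. H (s *\<^sub>R v + x)) = (LINT x|lborel. H x)" for s
  proof -
    have "integrable (distr lborel borel ((+) (s *\<^sub>R v))) H" using iH by (simp add: lborel_distr_plus)
    then show "integrable lborel (\<lambda>x. H (s *\<^sub>R v + x))" using Hb by (subst (asm) integrable_distr_eq) auto
    have "(LINT x|lborel. H x) = (LINT x|distr lborel borel ((+) (s *\<^sub>R v)). H x)" by (simp add: lborel_distr_plus)
    also have "\<dots> = (LINT x|lborel. H (s *\<^sub>R v + x))" using Hb by (subst integral_distr) auto
    finally show "(LINT x|lborel. H (s *\<^sub>R v + x)) = (LINT x|lborel. H x)" ..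
  qed
  have "compact ((\<lambda>x. H' x v) ` cball 0 R)"
    using c by (intro compact_continuous_image) (auto intro: continuous_on_subset)
  then obtain C where C: "\<And>x. x \<in> cball 0 R ==> norm (H' x v) \<le> C"
    using compact_imp_bounded bounded_iff by (metis imageI)
  \<comment> \<open>For |s| < 1 all shifted supports lie in the ball of radius
    \<open>R + norm v\<close>. The absolute value of C covers a negative R, for which the original
    ball is empty and C arbitrary.\<close>
  have "((\<lambda>s. LINT x|lborel. H (s *\<^sub>R v + x)) has_vector_derivative (LINT x|lborel. H' (0 *\<^sub>R v + x) v)) (at 0)"
  proof (rule has_vector_derivative_lebesgue_integral[where a="-1" and b=1 and B="\<lambda>x. indicator (cball 0 (R + norm v)) x *\<^sub>R \<bar>C\<bar>"])
    fix s :: real and x :: 'a assume s: "s \<in> {-1<..<1}"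
    have "((\<lambda>s. s *\<^sub>R v + x) has_vector_derivative v) (at s)"
      by (auto intro!: derivative_eq_intros)
    then have "((\<lambda>s. H (s *\<^sub>R v + x)) has_derivative (\<lambda>h. H' (s *\<^sub>R v + x) (h *\<^sub>R v))) (at s)"
      unfolding has_vector_derivative_def by (rule has_derivative_compose[OF _ d])
    then show "((\<lambda>s. H (s *\<^sub>R v + x)) has_vector_derivative H' (s *\<^sub>R v + x) v) (at s)"
      unfolding has_vector_derivative_def using linear_cmul[OF has_derivative_linear[OF d[of "s *\<^sub>R v + x"]]] by simp
    show "norm (H' (s *\<^sub>R v + x) v) \<le> indicator (cball 0 (R + norm v)) x *\<^sub>R \<bar>C\<bar>"
    proof (cases "norm (s *\<^sub>R v + x) > R")
      case False
      have "norm x \<le> norm (s *\<^sub>R v + x) + norm (s *\<^sub>R v)"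
        using norm_triangle_ineq4[of "s *\<^sub>R v + x" "s *\<^sub>R v"] by simp
      moreover have "norm (s *\<^sub>R v) \<le> norm v" using s by (auto simp: mult_left_le_one_le)
      ultimately have "norm x \<le> R + norm v" using False by linarith
      moreover have "norm (H' (s *\<^sub>R v + x) v) \<le> \<bar>C\<bar>" using False C[of "s *\<^sub>R v + x"] by auto
      ultimately show ?thesis by simp
    qed (simp add: supp')
  next
    show "integrable lborel (\<lambda>x. indicator (cball 0 (R + norm v)) (x::'a) *\<^sub>R \<bar>C\<bar>)"
      by (intro borel_integrable_compact) auto
    show "(\<lambda>x. H' (0 *\<^sub>R v + x) v) \<in> borel_measurable lborel" using i by simp
  qed (use tr in auto)
  then have "((\<lambda>s::real. LINT x|lborel. H x) has_vector_derivative (LINT x|lborel. H' x v)) (at 0)"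
    unfolding tr(2) by simp
  moreover have "((\<lambda>s::real. LINT x|lborel. H x) has_vector_derivative 0) (at 0)" by simp
  ultimately show "(LINT x|lborel. H' x v) = 0" by (metis vector_derivative_unique_at)
qed

lemma test_bounded_support:
  fixes \<psi> :: "real^'n \<Rightarrow> complex"
  assumes "\<psi> \<in> test_functions \<Omega>"
  obtains R where "\<And>x. norm x > R ==> \<psi> x = 0"
    "\<And>x v. norm x > R ==> frechet_derivative \<psi> (at x) v = 0"
proof -
  obtain R where "\<And>x. x \<in> closure {x. \<psi> x \<noteq> 0} ==> norm x \<le> R"
    using compact_imp_bounded[OF test_compact_support(1)[OF assms]] bounded_iff by metis
  then show thesis
    using that[of R] in_closure_support[of \<psi>] frechet_derivative_off_closure_support[of _ \<psi>]
    by (metis not_less)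
qed

lemma test_borel: "\<psi> \<in> test_functions \<Omega> ==> \<psi> \<in> borel_measurable borel"
  by (simp add: borel_measurable_continuous_onI smooth_continuous test_smooth)

lemma test_integration_by_parts:
  fixes u \<psi> :: "real^'n \<Rightarrow> complex"
  assumes u: "smooth u" and \<psi>: "\<psi> \<in> test_functions \<Omega>"
  shows "(LINT x|lebesgue. u x * partial j \<psi> x)
    = - (LINT x|lebesgue. partial j u x * \<psi> x)"
proof -
  obtain R where R: "\<And>x. norm x > R ==> \<psi> x = 0" "\<And>x v. norm x > R ==> frechet_derivative \<psi> (at x) v = 0"
    using test_bounded_support[OF \<psi>] by metis
  note s = test_smooth[OF \<psi>]
  have c: "continuous_on UNIV (\<lambda>x. u x * partial j \<psi> x)"
    "continuous_on UNIV (\<lambda>x. partial j u x * \<psi> x)"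
    by (intro continuous_on_mult smooth_continuous smooth_partial u s)+
  have i: "integrable lborel (\<lambda>x. u x * partial j \<psi> x)"
    "integrable lborel (\<lambda>x. partial j u x * \<psi> x)"
    by (rule integrable_continuous_compact_support[OF c(1), of R], simp add: R)
      (rule integrable_continuous_compact_support[OF c(2), of R], simp add: R)
  have "(LINT x|lborel. u x * partial j \<psi> x
      + partial j u x * \<psi> x) = 0"
  proof (rule integral_derivative_eq_0(2)[where R=R])
    show "((\<lambda>x. u x * \<psi> x) has_derivative (\<lambda>v. u x * frechet_derivative \<psi> (at x) v
      + frechet_derivative u (at x) v * \<psi> x)) (at x)" for x
      by (intro has_derivative_mult smooth_has_derivative u s)
  qed (use c in "auto intro: continuous_on_add simp: R")
  then have "(LINT x|lborel. u x * partial j \<psi> x)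
    = - (LINT x|lborel. partial j u x * \<psi> x)"
    using i by (simp add: eq_neg_iff_add_eq_0)
  moreover have "(LINT x|lebesgue. u x * partial j \<psi> x) = (LINT x|lborel. u x * partial j \<psi> x)"
    "(LINT x|lebesgue. partial j u x * \<psi> x) = (LINT x|lborel. partial j u x * \<psi> x)"
    using i by (auto intro: integral_completion)
  ultimately show ?thesis by simp
qed

text \<open>The classical counterpart of \<open>radial_deriv\<close> for smooth u; at the origin
  division by zero gives the value 0.\<close>

definition radial :: "(real^'n \<Rightarrow> complex) \<Rightarrow> real^'n \<Rightarrow> complex" where
  "radial u x = (\<Sum>j\<in>UNIV. complex_of_real (x $ j / norm x) * partial j u x)"

lemma radial_eq:
  fixes u :: "real^'n \<Rightarrow> complex"
  assumes "u differentiable at x"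
  shows "frechet_derivative u (at x) x = cnorm x * radial u x"
  unfolding radial_def frechet_derivative_expand[OF assms, of x]
  by (cases "x = 0") (auto simp: sum_distrib_left)

text \<open>Cauchy-Schwarz with a unit vector, or with 0 at the origin. Applied to differences of
  gradients, it carries convergence of gradients over to radial derivatives.\<close>

lemma norm_sum_direction_le:
  fixes z :: "complex^'n"
  shows "cmod (\<Sum>j\<in>UNIV. complex_of_real (x $ j / norm x) * z $ j) \<le> norm z"
proof (cases "x = 0")
  case False
  have "cmod (\<Sum>j\<in>UNIV. complex_of_real (x $ j / norm x) * z $ j) \<le> (\<Sum>j\<in>UNIV. \<bar>x $ j / norm x\<bar> * cmod (z $ j))"
    by (rule order_trans[OF norm_sum]) (simp add: norm_mult norm_divide)
  also have "\<dots> \<le> L2_set (\<lambda>j. x $ j / norm x) UNIV * L2_set (\<lambda>j. cmod (z $ j)) UNIV"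
    using L2_set_mult_ineq[of "\<lambda>j. x $ j / norm x" "\<lambda>j. cmod (z $ j)" UNIV] by simp
  also have "L2_set (\<lambda>j. x $ j / norm x) UNIV = 1"
  proof -
    have "L2_set (\<lambda>j. x $ j / norm x) UNIV = norm (x /\<^sub>R norm x)"
      by (simp add: norm_vec_def L2_set_def divide_inverse power_mult_distrib mult.commute)
    then show ?thesis using False by simp
  qed
  finally show ?thesis by (simp add: norm_vec_def)
qed auto

lemma smooth_power2_norm_has_derivative:
  assumes "smooth u"
  shows "((\<lambda>x. (cmod (u x))^2) has_derivative (\<lambda>v. 2 * (u x \<bullet> frechet_derivative u (at x) v))) (at x)"
  using has_derivative_inner[OF smooth_has_derivative[OF assms, of x] smooth_has_derivative[OF assms, of x]]
  by (simp add: power2_norm_eq_inner inner_commute)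

lemma radial_square_integrable:
  fixes u :: "real^'n \<Rightarrow> complex"
  assumes "u \<in> test_functions UNIV"
  shows "radial u \<in> borel_measurable borel" "integrable lborel (\<lambda>x. (cmod (radial u x))^2)"
    "integrable lborel (\<lambda>x. (norm (grad u x))^2)" "grad u \<in> borel_measurable borel"
proof -
  obtain R where R: "\<And>x. norm x > R ==> u x = 0" "\<And>x v. norm x > R ==> frechet_derivative u (at x) v = 0"
    using test_bounded_support[OF assms] by metis
  have c: "continuous_on UNIV (\<lambda>x. partial j u x)" for j
    by (intro smooth_continuous smooth_partial test_smooth[OF assms])
  have b: "(\<lambda>x. partial j u x) \<in> borel_measurable borel" for j
    using c by (rule borel_measurable_continuous_onI)
  have n: "(\<lambda>x::real^'n. complex_of_real (x $ j / norm x)) \<in> borel_measurable borel" for j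
  proof -
    have [measurable]: "(\<lambda>x::real^'n. x $ j) \<in> borel_measurable borel"
      by (intro borel_measurable_continuous_onI continuous_intros)
    show ?thesis by measurable
  qed
  show m: "radial u \<in> borel_measurable borel"
    unfolding radial_def by (intro borel_measurable_sum borel_measurable_times b n)
  have cg: "continuous_on UNIV (grad u)"
    unfolding grad_def by (intro continuous_intros c)
  then show "grad u \<in> borel_measurable borel" by (rule borel_measurable_continuous_onI)
  show i: "integrable lborel (\<lambda>x. (norm (grad u x))^2)"
  proof (rule integrable_continuous_compact_support)
    show "(norm (grad u x))^2 = 0" if "norm x > R" for x
      using R(2)[OF that] by (simp add: grad_def vec_eq_iff zero_vec_def[symmetric])
  qed (intro continuous_intros cg)
  show "integrable lborel (\<lambda>x. (cmod (radial u x))^2)"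
  proof (rule Bochner_Integration.integrable_bound[OF i])
    show "AE x in lborel. norm ((cmod (radial u x))^2) \<le> norm ((norm (grad u x))^2)"
      using norm_sum_direction_le[of _ "grad u _"]
      by (intro AE_I2) (auto simp: radial_def grad_def intro!: power_mono)
  qed (use m in auto)
qed

text \<open>The integrand is the divergence of \<open>|u|^2 a x\<close>, integrated one coordinate
  at a time. The gradient of a is \<open>- 2 a^2 x\<close>, which makes the divergence of
  \<open>a x\<close> equal to \<open>n a - 2 |x|^2 a^2\<close>. The inner product of complex numbers
  is the real one, so \<open>u x \<bullet> radial u x\<close> is the real part of the conjugate of u
  times its radial derivative.\<close>

lemma integral_regularized_divergence:
  fixes u :: "real^'n \<Rightarrow> complex" and \<epsilon> :: real
  defines "a \<equiv> \<lambda>x::real^'n. 1 / ((norm x)^2 + \<epsilon>)"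
  assumes u: "u \<in> test_functions UNIV" and \<epsilon>: "\<epsilon> > 0"
  shows "(LINT x|lborel. a x * (2 * norm x * (u x \<bullet> radial u x))
      + (cmod (u x))^2 * (real CARD('n) * a x - 2 * (norm x)^2 * (a x)^2)) = 0"
    "integrable lborel (\<lambda>x. a x * (2 * norm x * (u x \<bullet> radial u x))
      + (cmod (u x))^2 * (real CARD('n) * a x - 2 * (norm x)^2 * (a x)^2))"
proof -
  note s = test_smooth[OF u]
  obtain R where R: "\<And>x. norm x > R ==> u x = 0" using test_bounded_support[OF u] by metis
  have pos: "(norm x)^2 + \<epsilon> \<noteq> 0" for x :: "real^'n"
    using \<epsilon> by (metis add_nonneg_pos less_irrefl zero_le_power2)
  have da: "(a has_derivative (\<lambda>v. - 2 * (x \<bullet> v) * (a x)^2)) (at x)" for x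
  proof -
    have "((\<lambda>x. inner x x + \<epsilon>) has_derivative (\<lambda>v. 2 * (x \<bullet> v))) (at x)"
      by (auto intro!: derivative_eq_intros simp: inner_commute)
    moreover have "((\<lambda>t. 1 / t) has_derivative (\<lambda>h. - h * (a x)^2)) (at (inner x x + \<epsilon>))"
    proof -
      have ax: "a x = 1 / (inner x x + \<epsilon>)" by (simp add: a_def power2_norm_eq_inner)
      have px: "inner x x + \<epsilon> \<noteq> 0" using pos[of x] by (simp only: power2_norm_eq_inner not_False_eq_True)
      show ?thesis unfolding ax using px
        by (auto intro!: derivative_eq_intros simp: field_simps power2_eq_square)
    qed
    ultimately have "((\<lambda>x. 1 / (inner x x + \<epsilon>)) has_derivative (\<lambda>v. - (2 * (x \<bullet> v)) * (a x)^2)) (at x)"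
      by (rule has_derivative_compose)
    then show ?thesis by (simp add: a_def[abs_def] power2_norm_eq_inner)
  qed
  \<comment> \<open>The full derivative of \<open>|u|^2 x_j a\<close>; only its value in direction j
    enters the divergence.\<close>
  define H' where "H' j x v = (cmod (u x))^2 * (x $ j * (- 2 * (x \<bullet> v) * (a x)^2) + v $ j * a x)
      + 2 * (u x \<bullet> frechet_derivative u (at x) v) * (x $ j * a x)" for j x v
  have dH: "((\<lambda>x. (cmod (u x))^2 * (x $ j * a x)) has_derivative H' j x) (at x)" for j x
    unfolding H'_def
    by (intro has_derivative_mult smooth_power2_norm_has_derivative s da
        bounded_linear.has_derivative[OF bounded_linear_vec_nth] has_derivative_ident)
  have ca: "continuous_on UNIV a"
    unfolding a_def using pos by (intro continuous_intros) auto
  have cH: "continuous_on UNIV (\<lambda>x. H' j x (axis j 1))" for j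
    unfolding H'_def by (intro continuous_intros ca smooth_continuous s smooth_partial)
  note z = integral_derivative_eq_0[OF dH cH, of R]
  have i: "integrable lborel (\<lambda>x. H' j x (axis j 1))" and 0: "(LINT x|lborel. H' j x (axis j 1)) = 0" for j
    by (rule z, simp add: R)+
  have e: "(\<Sum>j\<in>UNIV. H' j x (axis j 1)) = a x * (2 * norm x * (u x \<bullet> radial u x))
      + (cmod (u x))^2 * (real CARD('n) * a x - 2 * (norm x)^2 * (a x)^2)" for x
  proof -
    have sq: "(\<Sum>j\<in>UNIV. x $ j * x $ j) = (norm x)^2" by (simp add: power2_norm_eq_inner inner_vec_def)
    have "norm x * (u x \<bullet> radial u x) = u x \<bullet> frechet_derivative u (at x) x"
      unfolding radial_eq[OF smooth_differentiable[OF s]]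
      by (simp flip: scaleR_conv_of_real)
    also have "\<dots> = (\<Sum>j\<in>UNIV. x $ j * (u x \<bullet> partial j u x))"
      unfolding frechet_derivative_expand[OF smooth_differentiable[OF s], of x x] inner_sum_right
      by (simp flip: scaleR_conv_of_real)
    finally have r: "norm x * (u x \<bullet> radial u x) = (\<Sum>j\<in>UNIV. x $ j * (u x \<bullet> partial j u x))" .
    have "(\<Sum>j\<in>UNIV. H' j x (axis j 1)) = (\<Sum>j\<in>UNIV. (cmod (u x))^2 * a x
       - (2 * (cmod (u x))^2 * (a x)^2) * (x $ j * x $ j)
       + (2 * a x) * (x $ j * (u x \<bullet> partial j u x)))"
      unfolding H'_def by (intro sum.cong) (auto simp: inner_axis algebra_simps)
    also have "\<dots> = real CARD('n) * ((cmod (u x))^2 * a x) - (2 * (cmod (u x))^2 * (a x)^2) * (norm x)^2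
       + (2 * a x) * (norm x * (u x \<bullet> radial u x))"
      unfolding sum.distrib sum_subtractf sum_distrib_left[symmetric] sq r by simp
    finally show ?thesis by (simp add: algebra_simps)
  qed
  show "integrable lborel (\<lambda>x. a x * (2 * norm x * (u x \<bullet> radial u x))
      + (cmod (u x))^2 * (real CARD('n) * a x - 2 * (norm x)^2 * (a x)^2))"
    unfolding e[symmetric] using i by auto
  show "(LINT x|lborel. a x * (2 * norm x * (u x \<bullet> radial u x))
      + (cmod (u x))^2 * (real CARD('n) * a x - 2 * (norm x)^2 * (a x)^2)) = 0"
    unfolding e[symmetric] using i 0 by simp
qed

lemma hardy_identity_test:
  fixes u :: "real^'n \<Rightarrow> complex"
  defines "c \<equiv> (real CARD('n) - 2) / 2"
  assumes n: "CARD('n) \<ge> 3" and u: "u \<in> test_functions UNIV"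
  shows "integrable lborel (\<lambda>x. (cmod (u x))^2 / (norm x)^2)"
    "integrable lborel (\<lambda>x. (cmod (radial u x + complex_of_real (c / norm x) * u x))^2)"
    "c^2 * (LINT x|lborel. (cmod (u x))^2 / (norm x)^2)
      = (LINT x|lborel. (cmod (radial u x))^2)
        - (LINT x|lborel. (cmod (radial u x + complex_of_real (c / norm x) * u x))^2)"
proof -
  let ?q = "\<lambda>x. (cmod (radial u x))^2" and ?w = "\<lambda>x. (cmod (u x))^2 / (norm x)^2"
  let ?R = "\<lambda>x. (cmod (radial u x + complex_of_real (c / norm x) * u x))^2"
  have c: "c > 0" "real CARD('n) = 2 * c + 2" using n by (auto simp: c_def field_simps)
  note s = test_smooth[OF u] and rd = radial_square_integrable[OF u]
  obtain R where R: "\<And>x. norm x > R ==> u x = 0" using test_bounded_support[OF u] by metis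
  have um: "u \<in> borel_measurable borel" by (rule test_borel[OF u])
  define \<epsilon> where "\<epsilon> k = inverse (real (Suc k))" for k
  define a where "a k x = 1 / ((norm x)^2 + \<epsilon> k)" for k and x :: "real^'n"
  have \<epsilon>: "\<epsilon> k > 0" for k by (simp add: \<epsilon>_def)
  have pos: "(norm x)^2 + \<epsilon> k > 0" for x :: "real^'n" and k
    using \<epsilon> by (simp add: add_nonneg_pos)
  have a0: "a k x > 0" "(norm x)^2 * a k x \<le> 1" for k x
    using pos[where k=k and x=x] \<epsilon>[of k] by (auto simp: a_def field_simps)
  define D where "D k x = a k x * (2 * norm x * (u x \<bullet> radial u x))
      + (cmod (u x))^2 * (real CARD('n) * a k x - 2 * (norm x)^2 * (a k x)^2)" for k x
  have D: "(LINT x|lborel. D k x) = 0" "integrable lborel (D k)" for k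
    using integral_regularized_divergence[OF u \<epsilon>[of k]] unfolding D_def a_def by auto
  have ac: "continuous_on UNIV (a k)" for k
    unfolding a_def using pos[of _ k] by (intro continuous_intros) (metis less_irrefl)
  have iwa: "integrable lborel (\<lambda>x. (cmod (u x))^2 * a k x)" for k
    by (rule integrable_continuous_compact_support[of _ R])
      (auto intro!: continuous_intros ac smooth_continuous s simp: R)
  have lim_a: "(\<lambda>k. a k x) \<longlonglongrightarrow> 1 / (norm x)^2" if "x \<noteq> 0" for x
  proof -
    have "(\<lambda>k. a k x) \<longlonglongrightarrow> 1 / ((norm x)^2 + 0)"
      unfolding a_def \<epsilon>_def using that by (intro tendsto_intros LIMSEQ_inverse_real_of_nat) auto
    then show ?thesis by simp
  qed
  \<comment> \<open>The divergence part contributes at least \<open>2 c |u|^2 a\<close>, because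
    \<open>n = 2 c + 2\<close> and \<open>|x|^2 a \<le> 1\<close>. Young's inequality spends half of
    it on the cross term, at the price \<open>|\<partial>_r u|^2 / c\<close>.\<close>
  have bound1: "c * ((cmod (u x))^2 * a k x) - ?q x / c \<le> D k x" for k x
  proof -
    define p where "p = cmod (u x)" define q where "q = cmod (radial u x)" define r where "r = norm x"
    define A where "A = a k x"
    have A: "A > 0" "r^2 * A \<le> 1" using a0[where k=k and x=x] by (auto simp: A_def r_def)
    have "\<bar>u x \<bullet> radial u x\<bar> \<le> p * q" unfolding p_def q_def by (rule Cauchy_Schwarz_ineq2)
    then have "- (p * q) \<le> u x \<bullet> radial u x" by linarith
    moreover have "0 \<le> A * (2 * r)" using A by (simp add: r_def)
    ultimately have "A * (2 * r) * (- (p * q)) \<le> A * (2 * r) * (u x \<bullet> radial u x)"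
      by (rule mult_left_mono)
    then have 1: "A * (2 * r * (u x \<bullet> radial u x)) \<ge> - (2 * (A * r * p) * q)" by (simp add: algebra_simps)
    have "0 \<le> (c * (A * r * p) - q)^2 / c" using c by simp
    also have "\<dots> = c * (A * r * p)^2 - 2 * (A * r * p) * q + q^2 / c"
      using c by (simp add: field_simps power2_eq_square)
    finally have 2: "2 * (A * r * p) * q \<le> c * (A * r * p)^2 + q^2 / c" by simp
    have "(A * r * p)^2 = (r^2 * A) * (A * p^2)" by (simp add: power2_eq_square)
    also have "\<dots> \<le> 1 * (A * p^2)" using A by (intro mult_right_mono) auto
    finally have 3: "c * (A * r * p)^2 \<le> c * (p^2 * A)" using c by (simp add: mult.commute)
    have "r^2 * A^2 = (r^2 * A) * A" by (simp add: power2_eq_square)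
    also have "\<dots> \<le> 1 * A" using A by (intro mult_right_mono) auto
    finally have "p^2 * (2 * c * A) \<le> p^2 * (real CARD('n) * A - 2 * r^2 * A^2)"
      unfolding c(2) by (intro mult_left_mono) (auto simp: algebra_simps)
    with 1 2 3 show ?thesis unfolding D_def p_def[symmetric] q_def[symmetric] r_def[symmetric] A_def[symmetric]
      by (simp add: algebra_simps)
  qed
  \<comment> \<open>\<open>D k\<close> integrates to 0, so integrating \<open>bound1\<close> gives
    Hardy's inequality with a constant free of k.\<close>
  have hardy: "(LINT x|lborel. (cmod (u x))^2 * a k x) \<le> (LINT x|lborel. ?q x) / c^2" for k
  proof -
    have "(LINT x|lborel. c * ((cmod (u x))^2 * a k x) - ?q x / c) \<le> (LINT x|lborel. D k x)"
      using iwa[of k] rd(2) D(2)[of k] bound1 by (intro integral_mono) auto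
    then have "c * (LINT x|lborel. (cmod (u x))^2 * a k x) \<le> (LINT x|lborel. ?q x) / c"
      using iwa[of k] rd(2) D(1)[of k] by simp
    then show ?thesis using c by (simp add: field_simps power2_eq_square)
  qed
  have nz: "AE x in lborel. (x::real^'n) \<noteq> 0" by (rule AE_lborel_singleton)
  have wm: "(\<lambda>x. ?w x) \<in> borel_measurable lborel" using um by simp
  show iw: "integrable lborel (\<lambda>x. ?w x)"
  proof (rule integrableI_bounded[OF wm])
    \<comment> \<open>Fatou's lemma: off the origin the weights \<open>a k\<close> tend to
      \<open>1 / |x|^2\<close>.\<close>
    have "(\<integral>\<^sup>+ x. ennreal (norm (?w x)) \<partial>lborel)
       \<le> (\<integral>\<^sup>+ x. liminf (\<lambda>k. ennreal ((cmod (u x))^2 * a k x)) \<partial>lborel)"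
    proof (rule nn_integral_mono_AE)
      show "AE x in lborel. ennreal (norm (?w x)) \<le> liminf (\<lambda>k. ennreal ((cmod (u x))^2 * a k x))"
        using nz
      proof eventually_elim
        case (elim x)
        have "(\<lambda>k. ennreal ((cmod (u x))^2 * a k x)) \<longlonglongrightarrow> ennreal ((cmod (u x))^2 * (1 / (norm x)^2))"
          by (intro tendsto_ennrealI tendsto_intros lim_a elim)
        from lim_imp_Liminf[OF sequentially_bot this] show ?case by simp
      qed
    qed
    also have "\<dots> \<le> liminf (\<lambda>k. \<integral>\<^sup>+ x. ennreal ((cmod (u x))^2 * a k x) \<partial>lborel)"
      using iwa by (intro nn_integral_liminf) auto
    also have "\<dots> \<le> ennreal ((LINT x|lborel. ?q x) / c^2)"
    proof (rule order_trans[OF Liminf_mono])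
      show "\<forall>\<^sub>F k in sequentially. (\<integral>\<^sup>+ x. ennreal ((cmod (u x))^2 * a k x) \<partial>lborel) \<le> ennreal ((LINT x|lborel. ?q x) / c^2)"
        using hardy iwa a0(1) by (auto simp: nn_integral_eq_integral less_imp_le intro!: ennreal_leI always_eventually)
    qed (simp add: Liminf_const)
    finally show "(\<integral>\<^sup>+ x. ennreal (norm (?w x)) \<partial>lborel) < \<infinity>"
      by (rule le_less_trans) simp
  qed
  \<comment> \<open>The pointwise limit of \<open>D k\<close>; the divergence part becomes
    \<open>(n - 2) / |x|^2 = 2 c / |x|^2\<close>.\<close>
  define L where "L x = 2 * (u x \<bullet> radial u x) / norm x + 2 * c * (?w x)" for x
  have Lm: "L \<in> borel_measurable lborel"
    unfolding L_def using um rd(1) by (intro borel_measurable_add borel_measurable_divide borel_measurable_times borel_measurable_inner) auto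
  \<comment> \<open>The cross term costs \<open>|u|^2 / |x|^2 + |\<partial>_r u|^2\<close> by the
    inequality between the means, the other term \<open>(n + 2) |u|^2 / |x|^2\<close>, and
    \<open>n + 2 + 1 = 2 c + 5\<close>.\<close>
  define B where "B x = ?q x + (2 * c + 5) * (?w x)" for x
  have iB: "integrable lborel B" unfolding B_def
    by (intro Bochner_Integration.integrable_add integrable_mult_right rd(2) iw)
  have DL: "AE x in lborel. (\<lambda>k. D k x) \<longlonglongrightarrow> L x"
    using nz
  proof eventually_elim
    case (elim x)
    have "(\<lambda>k. D k x) \<longlonglongrightarrow> 1 / (norm x)^2 * (2 * norm x * (u x \<bullet> radial u x))
      + (cmod (u x))^2 * (real CARD('n) * (1 / (norm x)^2) - 2 * (norm x)^2 * (1 / (norm x)^2)^2)" (is "_ \<longlonglongrightarrow> ?E")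
      unfolding D_def by (intro tendsto_intros lim_a elim)
    also have "?E = L x"
      unfolding L_def c(2) using elim by (simp add: field_simps power2_eq_square)
    finally show ?case .
  qed
  have DB: "AE x in lborel. norm (D k x) \<le> B x" for k
    using nz
  proof eventually_elim
    case (elim x)
    define p where "p = cmod (u x)" define q where "q = cmod (radial u x)" define r where "r = norm x"
    define A where "A = a k x"
    have r: "r > 0" using elim by (simp add: r_def)
    have A: "A > 0" "r^2 * A \<le> 1" using a0[where k=k and x=x] by (auto simp: A_def r_def)
    have A': "A \<le> 1 / r^2" using A r by (simp add: field_simps)
    have cs: "\<bar>u x \<bullet> radial u x\<bar> \<le> p * q" unfolding p_def q_def by (rule Cauchy_Schwarz_ineq2)
    have "\<bar>A * (2 * r * (u x \<bullet> radial u x))\<bar> = A * (2 * r) * \<bar>u x \<bullet> radial u x\<bar>"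
      using A r by (simp add: abs_mult)
    also have "\<dots> \<le> (1 / r^2) * (2 * r) * (p * q)"
      using A A' r cs by (intro mult_mono) (auto simp: p_def q_def)
    also have "\<dots> = 2 * (p / r) * q" using r by (simp add: field_simps power2_eq_square)
    also have "\<dots> \<le> (p / r)^2 + q^2" by (rule sum_squares_bound)
    finally have 1: "\<bar>A * (2 * r * (u x \<bullet> radial u x))\<bar> \<le> p^2 / r^2 + q^2" by (simp add: power_divide)
    have "r^2 * A^2 = (r^2 * A) * A" by (simp add: power2_eq_square)
    also have "\<dots> \<le> 1 * A" using A by (intro mult_right_mono) auto
    finally have AA: "r^2 * A^2 \<le> A" by simp
    \<comment> \<open>Naming the products leaves a comparison that is linear in the named
      quantities.\<close>
    define \<kappa> where "\<kappa> = c * A"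
    have \<kappa>: "\<kappa> > 0" "real CARD('n) * A = 2 * \<kappa> + 2 * A" "(2 * c + 4) * A = 2 * \<kappa> + 4 * A"
      using A c by (auto simp: \<kappa>_def algebra_simps)
    define Y where "Y = r^2 * A^2"
    have Y: "0 \<le> Y" "Y \<le> A" "2 * r^2 * A^2 = 2 * Y" using AA by (auto simp: Y_def)
    have "\<bar>2 * \<kappa> + 2 * A - 2 * Y\<bar> \<le> 2 * \<kappa> + 4 * A" using Y(1,2) \<kappa>(1) A(1) by (intro abs_leI) auto
    then have "\<bar>real CARD('n) * A - 2 * r^2 * A^2\<bar> \<le> (2 * c + 4) * A" by (simp only: \<kappa> Y(3))
    also have "\<dots> \<le> (2 * c + 4) * (1 / r^2)" using A' c by (intro mult_left_mono) auto
    finally have "p^2 * \<bar>CARD('n) * A - 2 * r^2 * A^2\<bar> \<le> p^2 * ((2 * c + 4) * (1 / r^2))"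
      by (intro mult_left_mono) auto
    then have 2: "\<bar>p^2 * (real CARD('n) * A - 2 * r^2 * A^2)\<bar> \<le> (2 * c + 4) * (p^2 / r^2)"
      by (simp add: abs_mult mult_ac)
    have "norm (D k x) \<le> \<bar>A * (2 * r * (u x \<bullet> radial u x))\<bar> + \<bar>p^2 * (real CARD('n) * A - 2 * r^2 * A^2)\<bar>"
      unfolding D_def p_def r_def A_def by (simp add: abs_triangle_ineq)
    also have "\<dots> \<le> (p^2 / r^2 + q^2) + (2 * c + 4) * (p^2 / r^2)" using 1 2 by (rule add_mono)
    also have "\<dots> = B x"
    proof -
      have "(X + q^2) + (2 * c + 4) * X = q^2 + (2 * c + 5) * X" for X by (simp add: algebra_simps)
      then show ?thesis unfolding B_def p_def q_def r_def .
    qed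
    finally show ?case .
  qed
  have Dm: "D k \<in> borel_measurable lborel" for k using D(2) by blast
  have "(\<lambda>k. LINT x|lborel. D k x) \<longlonglongrightarrow> (LINT x|lborel. L x)"
    by (rule integral_dominated_convergence[OF Lm Dm iB DL DB])
  then have L0: "(LINT x|lborel. L x) = 0" unfolding D(1) by (simp add: LIMSEQ_const_iff)
  have iL: "integrable lborel L"
    by (rule integrable_dominated_convergence[OF Lm Dm iB DL DB])
  \<comment> \<open>The cross term of the square is \<open>c L - 2 c^2 |u|^2 / |x|^2\<close>; adding
    the last square leaves a single negative multiple, and L has integral 0.\<close>
  have pt: "AE x in lborel. ?R x
    = ?q x + c * L x - c^2 * (?w x)"
    using nz
  proof eventually_elim
    case (elim x)
    have "?R x
      = ?q x + 2 * (radial u x \<bullet> ((c / norm x) *\<^sub>R u x)) + (cmod ((c / norm x) *\<^sub>R u x))^2"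
      unfolding scaleR_conv_of_real[symmetric] power2_norm_eq_inner
      by (simp add: inner_add_left inner_add_right inner_commute)
    then show ?case using elim
      by (simp add: L_def inner_commute power_mult_distrib power_divide field_simps power2_eq_square)
  qed
  have m2: "(\<lambda>x. ?R x) \<in> borel_measurable lborel"
    using um rd(1) by auto
  have ir: "integrable lborel (\<lambda>x. ?q x + c * L x - c^2 * (?w x))"
    by (intro Bochner_Integration.integrable_add Bochner_Integration.integrable_diff integrable_mult_right rd(2) iL iw)
  show "integrable lborel (\<lambda>x. ?R x)"
    using integrable_cong_AE[OF m2 _ pt] ir by auto
  have "(LINT x|lborel. ?R x)
     = (LINT x|lborel. ?q x + c * L x - c^2 * (?w x))"
    by (rule integral_cong_AE[OF m2 _ pt]) (use ir in auto)
  also have "\<dots> = (LINT x|lborel. ?q x) - c^2 * (LINT x|lborel. ?w x)"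
  proof -
    have "(LINT x|lborel. ?q x + c * L x - c^2 * W x)
      = (LINT x|lborel. ?q x) - c^2 * (LINT x|lborel. W x)" if "integrable lborel W" for W
      using rd(2) iL that L0 by simp
    from this[OF iw] show ?thesis .
  qed
  finally show "c^2 * (LINT x|lborel. ?w x)
      = (LINT x|lborel. ?q x)
        - (LINT x|lborel. ?R x)"
    by simp
qed

section \<open>Square integrable limits\<close>

abbreviation nn_sq :: "'a measure \<Rightarrow> ('a \<Rightarrow> 'b::real_normed_vector) \<Rightarrow> ennreal" where
  "nn_sq M F \<equiv> (\<integral>\<^sup>+x. ennreal ((norm (F x))\<^sup>2) \<partial>M)"

text \<open>Formulated with extended integrals so that it makes sense before the limit is known to
  be square integrable; e bounds the squared distance.\<close>

definition L2_tendsto :: "'a measure \<Rightarrow> (nat \<Rightarrow> 'a \<Rightarrow> 'b::real_normed_vector) \<Rightarrow> ('a \<Rightarrow> 'b) \<Rightarrow> bool" where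
  "L2_tendsto M F G \<longleftrightarrow> (\<forall>e>0. \<exists>N. \<forall>k\<ge>N. (nn_sq M (\<lambda>x. F k x - G x)) \<le> ennreal e)"

text \<open>Riesz-Fischer. The almost everywhere convergent subsequence is part of the conclusion
  because \<open>D12_representation\<close> identifies two limits along it.\<close>

lemma L2_complete:
  fixes F :: "nat \<Rightarrow> 'a \<Rightarrow> 'b::{banach,second_countable_topology}"
  assumes m: "\<And>k. F k \<in> borel_measurable M"
    and cauchy: "\<And>e. e > 0 ==> \<exists>N. \<forall>k\<ge>N. \<forall>l\<ge>N. (nn_sq M (\<lambda>x. F k x - F l x)) < ennreal e"
  obtains G r where "G \<in> borel_measurable M" "strict_mono r"
    "AE x in M. (\<lambda>i. F (r i) x) \<longlonglongrightarrow> G x" "L2_tendsto M F G"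
proof -
  \<comment> \<open>The rate \<open>4^-i\<close> for squared distances leaves a summable
    \<open>2^-i\<close> after weighting with \<open>2^i\<close>; the weights later give summability
    of the distances themselves.\<close>
  have "\<forall>i. \<exists>N. \<forall>k\<ge>N. \<forall>l\<ge>N. (nn_sq M (\<lambda>x. F k x - F l x)) < ennreal ((1/4) ^ i)"
    using cauchy by simp
  then obtain N where N: "\<And>i k l. k \<ge> N i ==> l \<ge> N i ==> (nn_sq M (\<lambda>x. F k x - F l x)) < ennreal ((1/4) ^ i)"
    by metis
  \<comment> \<open>Partial sums of \<open>Suc (N j)\<close> increase strictly and dominate each
    \<open>N i\<close>.\<close>
  define r where "r i = (\<Sum>j\<le>i. Suc (N j))" for i
  have r: "strict_mono r" "\<And>i. N i \<le> r i"
  proof -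
    show "strict_mono r" by (simp add: strict_mono_Suc_iff r_def)
    have "Suc (N i) \<le> r i" for i unfolding r_def by (rule member_le_sum) auto
    then show "\<And>i. N i \<le> r i" by (meson Suc_leD)
  qed
  define d where "d i x = norm (F (r (Suc i)) x - F (r i) x)" for i x
  have dm: "d i \<in> borel_measurable M" for i unfolding d_def using m by measurable
  have d: "(\<integral>\<^sup>+x. ennreal (2 ^ i * (d i x)^2) \<partial>M) \<le> ennreal ((1/2) ^ i)" for i
  proof -
    have "N i \<le> r (Suc i)" using r strict_mono_less_eq[OF r(1), of i "Suc i"] by (meson le_SucI order_refl order_trans)
    then have "(\<integral>\<^sup>+x. ennreal ((d i x)^2) \<partial>M) \<le> ennreal ((1/4) ^ i)"
      unfolding d_def using r(2) by (intro less_imp_le[OF N]) auto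
    then have "ennreal (2 ^ i) * (\<integral>\<^sup>+x. ennreal ((d i x)^2) \<partial>M) \<le> ennreal (2 ^ i) * ennreal ((1/4) ^ i)"
      by (rule mult_left_mono) simp
    also have "ennreal (2 ^ i) * ennreal ((1/4) ^ i) = ennreal ((1/2) ^ i)"
      by (simp add: ennreal_mult[symmetric] power_mult_distrib[symmetric])
    also have "ennreal (2 ^ i) * (\<integral>\<^sup>+x. ennreal ((d i x)^2) \<partial>M) = (\<integral>\<^sup>+x. ennreal (2 ^ i * (d i x)^2) \<partial>M)"
      using dm by (subst nn_integral_cmult[symmetric]) (auto simp: ennreal_mult')
    finally show ?thesis .
  qed
  have "(\<integral>\<^sup>+x. (\<Sum>i. ennreal (2 ^ i * (d i x)^2)) \<partial>M) = (\<Sum>i. \<integral>\<^sup>+x. ennreal (2 ^ i * (d i x)^2) \<partial>M)"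
    using dm by (intro nn_integral_suminf) auto
  also have "\<dots> \<le> (\<Sum>i. ennreal ((1/2) ^ i))" by (intro suminf_le d) auto
  also have "\<dots> = ennreal (\<Sum>i. (1/2) ^ i)" by (intro suminf_ennreal2) (auto simp: summable_geometric)
  finally have "(\<integral>\<^sup>+x. (\<Sum>i. ennreal (2 ^ i * (d i x)^2)) \<partial>M) \<noteq> \<infinity>" by (auto simp: top_unique)
  then have "AE x in M. (\<Sum>i. ennreal (2 ^ i * (d i x)^2)) \<noteq> \<infinity>"
    using dm by (intro nn_integral_noteq_infinite) auto
  then have conv: "AE x in M. convergent (\<lambda>i. F (r i) x)"
  proof eventually_elim
    case (elim x)
    then have s: "summable (\<lambda>i. 2 ^ i * (d i x)^2)" by (intro summable_suminf_not_top) auto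
    have "summable (\<lambda>i. 2 ^ i * (d i x)^2 + (1/2) ^ i)"
      by (intro summable_add s) (simp add: summable_geometric)
    then have "summable (\<lambda>i. norm (F (r (Suc i)) x - F (r i) x))"
    proof (rule summable_comparison_test'[where N=0])
      fix i
      \<comment> \<open>AM-GM: \<open>2 d \<le> 2^i d^2 + 2^-i\<close>\<close>
      have "0 \<le> 2 ^ i * (d i x - (1/2) ^ i)^2" by simp
      also have "\<dots> = 2 ^ i * (d i x)^2 + (1/2) ^ i - 2 * d i x"
      proof -
        have "(2::real) ^ i * (1/2) ^ i = 1" by (simp add: power_mult_distrib[symmetric])
        then have "2 ^ i * (d i x - h)^2 = 2 ^ i * (d i x)^2 + h - 2 * d i x" if "h = (1/2) ^ i" for h
          using that by (simp add: power2_diff algebra_simps) (simp add: power2_eq_square mult.assoc[symmetric])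
        then show ?thesis by simp
      qed
      finally show "norm (norm (F (r (Suc i)) x - F (r i) x)) \<le> 2 ^ i * (d i x)^2 + (1/2) ^ i"
        unfolding d_def using norm_ge_zero[of "F (r (Suc i)) x - F (r i) x"] by (simp only: real_norm_def abs_norm_cancel)
    qed
    then have "summable (\<lambda>i. F (r (Suc i)) x - F (r i) x)" by (rule summable_norm_cancel)
    then have "convergent (\<lambda>n. \<Sum>i<n. F (r (Suc i)) x - F (r i) x)" by (simp add: summable_iff_convergent)
    then have "convergent (\<lambda>n. F (r n) x - F (r 0) x)" by (simp only: sum_lessThan_telescope[of "\<lambda>i. F (r i) x"])
    then show ?case
      using convergent_add[of "\<lambda>n. F (r n) x - F (r 0) x" "\<lambda>_. F (r 0) x"] by (simp add: convergent_const)
  qed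
  define G where "G x = lim (\<lambda>i. F (r i) x)" for x
  have G: "G \<in> borel_measurable M" unfolding G_def using m by (intro borel_measurable_lim_metric)
  have lim: "AE x in M. (\<lambda>i. F (r i) x) \<longlonglongrightarrow> G x"
    using conv by eventually_elim (simp add: G_def convergent_LIMSEQ_iff)
  have "L2_tendsto M F G" unfolding L2_tendsto_def
  proof (intro allI impI)
    fix e :: real assume "e > 0"
    from cauchy[OF this] obtain N0 where N0: "\<And>k l. k \<ge> N0 ==> l \<ge> N0 ==> (nn_sq M (\<lambda>x. F k x - F l x)) < ennreal e"
      by blast
    have "(nn_sq M (\<lambda>x. F k x - G x)) \<le> ennreal e" if k: "k \<ge> N0" for k
    proof -
      \<comment> \<open>Fatou's lemma along the subsequence transfers the Cauchy bound to the
        limit.\<close>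
      have "(nn_sq M (\<lambda>x. F k x - G x)) \<le> (\<integral>\<^sup>+x. liminf (\<lambda>i. ennreal ((norm (F k x - F (r i) x))^2)) \<partial>M)"
      proof (rule nn_integral_mono_AE)
        show "AE x in M. ennreal ((norm (F k x - G x))^2) \<le> liminf (\<lambda>i. ennreal ((norm (F k x - F (r i) x))^2))"
          using lim
        proof eventually_elim
          case (elim x)
          then have "(\<lambda>i. ennreal ((norm (F k x - F (r i) x))^2)) \<longlonglongrightarrow> ennreal ((norm (F k x - G x))^2)"
            by (intro tendsto_ennrealI tendsto_intros)
          from lim_imp_Liminf[OF sequentially_bot this] show ?case by simp
        qed
      qed
      also have "\<dots> \<le> liminf (\<lambda>i. \<integral>\<^sup>+x. ennreal ((norm (F k x - F (r i) x))^2) \<partial>M)"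
        using m by (intro nn_integral_liminf) measurable
      also have "\<dots> \<le> ennreal e"
      proof (rule order_trans[OF Liminf_mono])
        show "\<forall>\<^sub>F i in sequentially. (nn_sq M (\<lambda>x. F k x - F (r i) x)) \<le> ennreal e"
          using eventually_ge_at_top[of N0]
        proof eventually_elim
          case (elim i)
          then have "N0 \<le> r i" using seq_suble[OF r(1), of i] by linarith
          then show ?case using N0[OF k] by (simp add: less_imp_le)
        qed
      qed (simp add: Liminf_const)
      finally show ?thesis .
    qed
    then show "\<exists>N. \<forall>k\<ge>N. (nn_sq M (\<lambda>x. F k x - G x)) \<le> ennreal e" by blast
  qed
  then show thesis using that G r(1) lim by blast
qed

text \<open>The squared triangle inequality with a free weight: s = 1 serves for integrability,
  small s for convergence of norms. It does the work of Minkowski's inequality.\<close>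

lemma norm_power2_Young:
  fixes a b :: "'b::real_normed_vector"
  assumes "s > 0"
  shows "(norm a)^2 \<le> (1 + s) * (norm b)^2 + (1 + 1 / s) * (norm (a - b))^2"
proof -
  have "norm a \<le> norm b + norm (a - b)" using norm_triangle_ineq[of b "a - b"] by simp
  then have "(norm a)^2 \<le> (norm b + norm (a - b))^2" by (simp add: power_mono)
  moreover have "0 \<le> (s * norm b - norm (a - b))^2 / s" using assms by simp
  then have "2 * norm b * norm (a - b) \<le> s * (norm b)^2 + (norm (a - b))^2 / s"
    using assms by (simp add: power2_diff field_simps power2_eq_square)
  ultimately show ?thesis by (simp add: power2_sum algebra_simps)
qed

lemma square_integrable_diff:
  fixes f g :: "'a \<Rightarrow> 'b::{banach,second_countable_topology}"
  assumes m: "f \<in> borel_measurable M" "g \<in> borel_measurable M"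
    and i: "integrable M (\<lambda>x. (norm (f x))^2)" "integrable M (\<lambda>x. (norm (g x))^2)"
  shows "integrable M (\<lambda>x. (norm (f x - g x))^2)"
proof (rule Bochner_Integration.integrable_bound)
  show "integrable M (\<lambda>x. 2 * (norm (f x))^2 + 2 * (norm (g x))^2)" using i by auto
  show "AE x in M. norm ((norm (f x - g x))^2) \<le> norm (2 * (norm (f x))^2 + 2 * (norm (g x))^2)"
  proof (intro AE_I2)
    fix x
    show "norm ((norm (f x - g x))^2) \<le> norm (2 * (norm (f x))^2 + 2 * (norm (g x))^2)"
      using norm_power2_Young[of 1 "f x - g x" "f x"] by simp
  qed
qed (use m in measurable)

lemma L2_tendsto_integral:
  fixes F :: "nat \<Rightarrow> 'a \<Rightarrow> 'b::{banach,second_countable_topology}"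
  assumes L: "L2_tendsto M F G"
    and m: "\<And>k. F k \<in> borel_measurable M" "G \<in> borel_measurable M"
    and i: "\<And>k. integrable M (\<lambda>x. (norm (F k x))^2)"
  shows "integrable M (\<lambda>x. (norm (G x))^2)"
    "(\<lambda>k. LINT x|M. (norm (F k x - G x))^2) \<longlonglongrightarrow> 0"
    "(\<lambda>k. LINT x|M. (norm (F k x))^2) \<longlonglongrightarrow> (LINT x|M. (norm (G x))^2)"
proof -
  obtain k0 where k0: "(nn_sq M (\<lambda>x. F k0 x - G x)) \<le> ennreal 1"
    using L unfolding L2_tendsto_def by (meson order_refl zero_less_one)
  have i0: "integrable M (\<lambda>x. (norm (F k0 x - G x))^2)"
    using m k0 by (intro integrableI_bounded) (auto intro: le_less_trans[OF k0])
  show iG: "integrable M (\<lambda>x. (norm (G x))^2)"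
    using square_integrable_diff[OF m(1)[of k0] _ i[of k0] i0] m by simp
  define A where "A = (LINT x|M. (norm (G x))^2)"
  define a where "a k = (LINT x|M. (norm (F k x))^2)" for k
  define d where "d k = (LINT x|M. (norm (F k x - G x))^2)" for k
  have id: "integrable M (\<lambda>x. (norm (F k x - G x))^2)" for k
    by (rule square_integrable_diff[OF m(1) m(2) i iG])
  have d0: "d k \<ge> 0" for k unfolding d_def by simp
  have dn: "(nn_sq M (\<lambda>x. F k x - G x)) = ennreal (d k)" for k
    unfolding d_def using id by (intro nn_integral_eq_integral) auto
  show "d \<longlonglongrightarrow> 0"
  proof (rule LIMSEQ_I)
    fix e :: real assume "e > 0"
    then obtain N where "\<forall>k\<ge>N. ennreal (d k) \<le> ennreal (e / 2)"
      using L unfolding L2_tendsto_def dn by (meson half_gt_zero)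
    then have "\<forall>k\<ge>N. d k \<le> e / 2" using \<open>e > 0\<close> by (simp add: ennreal_le_iff)
    then have "\<forall>k\<ge>N. norm (d k - 0) < e" using d0 \<open>e > 0\<close> by (auto intro: le_less_trans)
    then show "\<exists>N. \<forall>k\<ge>N. norm (d k - 0) < e" by blast
  qed
  \<comment> \<open>Both s and \<open>d / s\<close> must tend to 0. The square root achieves this,
    and the second summand keeps s positive where d vanishes.\<close>
  define s where "s k = sqrt (d k) + inverse (real (Suc k))" for k
  have s: "s k > 0" "d k \<le> (s k)^2" for k
  proof -
    show "s k > 0" unfolding s_def using d0[of k] by (simp add: add_nonneg_pos)
    have "d k = (sqrt (d k))^2" using d0 by simp
    also have "\<dots> \<le> (s k)^2" unfolding s_def using d0[of k] by (intro power_mono) auto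
    finally show "d k \<le> (s k)^2" .
  qed
  have s0: "s \<longlonglongrightarrow> 0"
  proof -
    have "(\<lambda>k. sqrt (d k) + inverse (real (Suc k))) \<longlonglongrightarrow> sqrt 0 + 0"
      by (intro tendsto_intros \<open>d \<longlonglongrightarrow> 0\<close> LIMSEQ_inverse_real_of_nat)
    then show ?thesis unfolding s_def by simp
  qed
  have e: "(1 + 1 / s k) * d k \<le> d k + s k" for k
  proof -
    have "d k / s k \<le> s k" using s[of k] by (simp add: field_simps power2_eq_square)
    then show ?thesis by (simp add: algebra_simps)
  qed
  have up: "a k \<le> (1 + s k) * A + (d k + s k)" for k
  proof -
    have "a k \<le> (LINT x|M. (1 + s k) * (norm (G x))^2 + (1 + 1 / s k) * (norm (F k x - G x))^2)"
      unfolding a_def using i iG id norm_power2_Young[OF s(1)] by (intro integral_mono) auto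
    also have "\<dots> = (1 + s k) * A + (1 + 1 / s k) * d k" unfolding A_def d_def using iG id by simp
    finally show ?thesis using e[of k] by linarith
  qed
  have low: "(A - (d k + s k)) / (1 + s k) \<le> a k" for k
  proof -
    have "A \<le> (LINT x|M. (1 + s k) * (norm (F k x))^2 + (1 + 1 / s k) * (norm (F k x - G x))^2)"
      unfolding A_def using i iG id norm_power2_Young[OF s(1), of "G _" k "F k _"] by (intro integral_mono) (auto simp: norm_minus_commute)
    also have "\<dots> = (1 + s k) * a k + (1 + 1 / s k) * d k" unfolding a_def d_def using i id by simp
    finally have "A - (d k + s k) \<le> (1 + s k) * a k" using e[of k] by linarith
    then show ?thesis using s(1)[of k] by (simp add: field_simps)
  qed
  show "a \<longlonglongrightarrow> A"
  proof (rule tendsto_sandwich)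
    show "\<forall>\<^sub>F k in sequentially. (A - (d k + s k)) / (1 + s k) \<le> a k" using low by simp
    show "\<forall>\<^sub>F k in sequentially. a k \<le> (1 + s k) * A + (d k + s k)" using up by simp
    have "(\<lambda>k. (A - (d k + s k)) / (1 + s k)) \<longlonglongrightarrow> (A - (0 + 0)) / (1 + 0)"
      by (intro tendsto_intros s0 \<open>d \<longlonglongrightarrow> 0\<close>) simp
    then show "(\<lambda>k. (A - (d k + s k)) / (1 + s k)) \<longlonglongrightarrow> A" by simp
    have "(\<lambda>k. (1 + s k) * A + (d k + s k)) \<longlonglongrightarrow> (1 + 0) * A + (0 + 0)"
      by (intro tendsto_intros s0 \<open>d \<longlonglongrightarrow> 0\<close>)
    then show "(\<lambda>k. (1 + s k) * A + (d k + s k)) \<longlonglongrightarrow> A" by simp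
  qed
qed

lemma L2_tendsto_dominated:
  assumes "L2_tendsto M F G" "\<And>k x. norm (F' k x - G' x) \<le> norm (F k x - G x)"
  shows "L2_tendsto M F' G'"
  unfolding L2_tendsto_def
proof (intro allI impI)
  fix e :: real assume "e > 0"
  then obtain N where N: "\<forall>k\<ge>N. (nn_sq M (\<lambda>x. F k x - G x)) \<le> ennreal e"
    using assms(1) unfolding L2_tendsto_def by blast
  have "(nn_sq M (\<lambda>x. F' k x - G' x)) \<le> (nn_sq M (\<lambda>x. F k x - G x))" for k
    using assms(2) by (intro nn_integral_mono ennreal_leI power_mono) auto
  then show "\<exists>N. \<forall>k\<ge>N. (nn_sq M (\<lambda>x. F' k x - G' x)) \<le> ennreal e"
    using N by (meson order_trans)
qed

lemma L2_tendsto_add_scaled: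
  fixes F F' :: "nat \<Rightarrow> 'a \<Rightarrow> 'b::{banach,second_countable_topology}" and c :: real
  assumes L: "L2_tendsto M F G" "L2_tendsto M F' G'"
    and m: "\<And>k. F k \<in> borel_measurable M" "G \<in> borel_measurable M" "\<And>k. F' k \<in> borel_measurable M" "G' \<in> borel_measurable M"
  shows "L2_tendsto M (\<lambda>k x. F k x + c *\<^sub>R F' k x) (\<lambda>x. G x + c *\<^sub>R G' x)"
  unfolding L2_tendsto_def
proof (intro allI impI)
  fix e :: real assume e: "e > 0"
  \<comment> \<open>The summand 1 permits division by C also when c = 0.\<close>
  define C where "C = 2 * c^2 + 1"
  have C: "C > 0" unfolding C_def by (simp add: add_nonneg_pos)
  obtain N1 where N1: "\<forall>k\<ge>N1. (nn_sq M (\<lambda>x. F k x - G x)) \<le> ennreal (e / 4)"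
    using L(1) e unfolding L2_tendsto_def by (meson divide_pos_pos zero_less_numeral)
  obtain N2 where N2: "\<forall>k\<ge>N2. (nn_sq M (\<lambda>x. F' k x - G' x)) \<le> ennreal (e / (2 * C))"
    using L(2) e C unfolding L2_tendsto_def by (meson divide_pos_pos mult_pos_pos zero_less_numeral)
  have "(nn_sq M (\<lambda>x. F k x + c *\<^sub>R F' k x - (G x + c *\<^sub>R G' x))) \<le> ennreal e" if "k \<ge> max N1 N2" for k
  proof -
    have "(norm (F k x + c *\<^sub>R F' k x - (G x + c *\<^sub>R G' x)))^2 \<le> 2 * (norm (F k x - G x))^2 + C * (norm (F' k x - G' x))^2" for x
    proof -
      have "(norm (F k x + c *\<^sub>R F' k x - (G x + c *\<^sub>R G' x)))^2 \<le> 2 * (norm (F k x - G x))^2 + 2 * (norm (c *\<^sub>R (F' k x - G' x)))^2"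
        using norm_power2_Young[of 1 "F k x + c *\<^sub>R F' k x - (G x + c *\<^sub>R G' x)" "F k x - G x"]
        by (simp add: algebra_simps)
      also have "2 * (norm (c *\<^sub>R (F' k x - G' x)))^2 = 2 * c^2 * (norm (F' k x - G' x))^2" by (simp add: power_mult_distrib)
      also have "\<dots> \<le> C * (norm (F' k x - G' x))^2" unfolding C_def by (intro mult_right_mono) auto
      finally show ?thesis by simp
    qed
    then have "(nn_sq M (\<lambda>x. F k x + c *\<^sub>R F' k x - (G x + c *\<^sub>R G' x)))
      \<le> (\<integral>\<^sup>+x. ennreal (2 * (norm (F k x - G x))^2 + C * (norm (F' k x - G' x))^2) \<partial>M)"
      by (intro nn_integral_mono ennreal_leI)
    also have "\<dots> = (\<integral>\<^sup>+x. ennreal 2 * ennreal ((norm (F k x - G x))^2) + ennreal C * ennreal ((norm (F' k x - G' x))^2) \<partial>M)"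
      using C by (intro nn_integral_cong) (simp add: ennreal_mult')
    also have "\<dots> = ennreal 2 * (nn_sq M (\<lambda>x. F k x - G x)) + ennreal C * (nn_sq M (\<lambda>x. F' k x - G' x))"
      using m by (subst nn_integral_add) (auto simp: nn_integral_cmult)
    also have "\<dots> \<le> ennreal 2 * ennreal (e / 4) + ennreal C * ennreal (e / (2 * C))"
      using N1 N2 that by (intro add_mono mult_left_mono) auto
    also have "ennreal 2 * ennreal (e / 4) = ennreal (e / 2)" using e by (subst ennreal_mult[symmetric]) auto
    also have "ennreal C * ennreal (e / (2 * C)) = ennreal (e / 2)" using e C by (subst ennreal_mult[symmetric]) auto
    also have "ennreal (e / 2) + ennreal (e / 2) = ennreal e" using e by (subst ennreal_plus[symmetric]) auto
    finally show ?thesis .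
  qed
  then show "\<exists>N. \<forall>k\<ge>N. (nn_sq M (\<lambda>x. F k x + c *\<^sub>R F' k x - (G x + c *\<^sub>R G' x))) \<le> ennreal e" by blast
qed

lemma square_integrable_mult:
  fixes f g :: "'a \<Rightarrow> complex"
  assumes "f \<in> borel_measurable M" "g \<in> borel_measurable M"
    "integrable M (\<lambda>x. (cmod (f x))^2)" "integrable M (\<lambda>x. (cmod (g x))^2)"
  shows "integrable M (\<lambda>x. f x * g x)"
proof (rule Bochner_Integration.integrable_bound)
  show "integrable M (\<lambda>x. (cmod (f x))^2 + (cmod (g x))^2)" using assms by auto
  have "cmod (f x * g x) \<le> (cmod (f x))^2 + (cmod (g x))^2" for x
  proof -
    have "2 * cmod (f x) * cmod (g x) \<le> (cmod (f x))^2 + (cmod (g x))^2" by (rule sum_squares_bound)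
    moreover have "0 \<le> cmod (f x) * cmod (g x)" by simp
    ultimately show ?thesis unfolding norm_mult by linarith
  qed
  then show "AE x in M. norm (f x * g x) \<le> norm ((cmod (f x))^2 + (cmod (g x))^2)"
    by (intro AE_I2) (simp add: order_trans[OF _ abs_ge_self])
qed (use assms in measurable)

text \<open>A weighted inequality between the means stands in for Cauchy-Schwarz: the difference of
  the pairings is at most \<open>d k / \<eta> + \<eta> P\<close>, and \<eta> is fixed before
  k.\<close>

lemma L2_tendsto_pairing:
  fixes F :: "nat \<Rightarrow> 'a \<Rightarrow> complex"
  assumes L: "L2_tendsto M F G"
    and m: "\<And>k. F k \<in> borel_measurable M" "G \<in> borel_measurable M" "\<psi> \<in> borel_measurable M"
    and i: "\<And>k. integrable M (\<lambda>x. (cmod (F k x))^2)" "integrable M (\<lambda>x. (cmod (\<psi> x))^2)"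
  shows "(\<lambda>k. LINT x|M. F k x * \<psi> x) \<longlonglongrightarrow> (LINT x|M. G x * \<psi> x)"
proof -
  note I = L2_tendsto_integral[OF L m(1,2) i(1)]
  define d where "d k = (LINT x|M. (norm (F k x - G x))^2)" for k
  define P where "P = (LINT x|M. (cmod (\<psi> x))^2)"
  have P: "P \<ge> 0" unfolding P_def by simp
  have d: "d \<longlonglongrightarrow> 0" using I(2) unfolding d_def .
  have bound: "cmod ((LINT x|M. F k x * \<psi> x) - (LINT x|M. G x * \<psi> x)) \<le> d k / \<eta> + \<eta> * P" if \<eta>: "\<eta> > 0" for \<eta> k
  proof -
    have id: "integrable M (\<lambda>x. (norm (F k x - G x))^2)" by (rule square_integrable_diff[OF m(1,2) i(1) I(1)])
    have "(LINT x|M. F k x * \<psi> x) - (LINT x|M. G x * \<psi> x) = (LINT x|M. (F k x - G x) * \<psi> x)"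
      using square_integrable_mult[OF m(1) m(3) i(1) i(2)] square_integrable_mult[OF m(2) m(3) I(1) i(2)]
      by (simp add: left_diff_distrib)
    also have "cmod \<dots> \<le> (LINT x|M. cmod ((F k x - G x) * \<psi> x))" by (rule integral_norm_bound)
    also have "\<dots> \<le> (LINT x|M. (norm (F k x - G x))^2 / \<eta> + \<eta> * (cmod (\<psi> x))^2)"
    proof (rule integral_mono)
      show "integrable M (\<lambda>x. cmod ((F k x - G x) * \<psi> x))"
        by (intro integrable_norm square_integrable_mult id i(2)) (use m in measurable)
      show "integrable M (\<lambda>x. (norm (F k x - G x))^2 / \<eta> + \<eta> * (cmod (\<psi> x))^2)" using id i(2) by auto
      show "cmod ((F k x - G x) * \<psi> x) \<le> (norm (F k x - G x))^2 / \<eta> + \<eta> * (cmod (\<psi> x))^2" for x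
      proof -
        define p where "p = cmod (F k x - G x)" define q where "q = cmod (\<psi> x)"
        have "0 \<le> (p - \<eta> * q)^2 / \<eta>" using \<eta> by simp
        also have "\<dots> = p^2 / \<eta> + \<eta> * q^2 - 2 * (p * q)" using \<eta> by (simp add: field_simps power2_eq_square)
        finally have "2 * (p * q) \<le> p^2 / \<eta> + \<eta> * q^2" by simp
        moreover have "0 \<le> p * q" by (simp add: p_def q_def)
        ultimately have "p * q \<le> p^2 / \<eta> + \<eta> * q^2" by linarith
        then show ?thesis by (simp add: norm_mult p_def q_def)
      qed
    qed
    also have "\<dots> = d k / \<eta> + \<eta> * P" unfolding d_def P_def using id i(2) by simp
    finally show ?thesis .
  qed
  show ?thesis
  proof (rule LIMSEQ_I)
    fix e :: real assume e: "e > 0"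
    \<comment> \<open>This makes \<open>\<eta> P\<close> at most \<open>e / 2\<close>, with P + 1
      allowing for P = 0; afterwards d has to fall below \<open>\<eta> e / 2\<close>.\<close>
    define \<eta> where "\<eta> = e / (2 * (P + 1))"
    have \<eta>: "\<eta> > 0" using e P by (simp add: \<eta>_def)
    have "\<eta> * P \<le> e / 2"
    proof -
      have "e * P \<le> e * (P + 1)" using e by simp
      then show ?thesis using P by (simp add: \<eta>_def field_simps)
    qed
    moreover obtain N where N: "\<forall>k\<ge>N. norm (d k - 0) < \<eta> * (e / 2)"
      using LIMSEQ_D[OF d, of "\<eta> * (e / 2)"] \<eta> e by auto
    have "d k / \<eta> < e / 2" if "k \<ge> N" for k
    proof -
      have "d k < \<eta> * (e / 2)" using N that by auto
      then show ?thesis using \<eta> by (simp add: field_simps)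
    qed
    ultimately have "\<forall>k\<ge>N. norm ((LINT x|M. F k x * \<psi> x) - (LINT x|M. G x * \<psi> x)) < e"
      using bound[OF \<eta>] by (smt (verit) field_sum_of_halves)
    then show "\<exists>N. \<forall>k\<ge>N. norm ((LINT x|M. F k x * \<psi> x) - (LINT x|M. G x * \<psi> x)) < e" by blast
  qed
qed

section \<open>Conversion between \<open>L2norm\<close> and integrals\<close>

lemma L2norm_integrable:
  fixes f :: "real^'n \<Rightarrow> 'b::{banach,second_countable_topology}"
  assumes "integrable lebesgue (\<lambda>x. (norm (f x))^2)"
  shows "L2norm f < \<infinity>" "(enn2real (L2norm f))^2 = (LINT x|lebesgue. (norm (f x))^2)"
proof -
  have e: "(nn_sq lebesgue (\<lambda>x. f x)) = ennreal (LINT x|lebesgue. (norm (f x))^2)"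
    using assms by (intro nn_integral_eq_integral) auto
  show "L2norm f < \<infinity>" "(enn2real (L2norm f))^2 = (LINT x|lebesgue. (norm (f x))^2)"
    unfolding L2norm_def e by auto
qed

lemma L2norm_less:
  assumes "L2norm f < ennreal e" "e > 0"
  shows "(nn_sq lebesgue (\<lambda>x. f x)) < ennreal (e^2)"
proof -
  define I where "I = (nn_sq lebesgue (\<lambda>x. f x))"
  have I: "I \<noteq> \<infinity>" "ennreal (sqrt (enn2real I)) < ennreal e"
    using assms(1) unfolding L2norm_def I_def[symmetric] Let_def by (auto split: if_splits)
  then have "sqrt (enn2real I) < e" using assms(2) by (simp add: ennreal_less_iff)
  then have "(sqrt (enn2real I))^2 < e^2" by (intro power_strict_mono) auto
  then have "enn2real I < e^2" by simp
  then have "ennreal (enn2real I) < ennreal (e^2)" by (simp add: ennreal_less_iff)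
  then show ?thesis using I(1) unfolding I_def[symmetric] by (simp add: less_top)
qed

section \<open>Passage to the completion\<close>

lemma frechet_derivative_diff:
  assumes "u differentiable at x" "v differentiable at x"
  shows "frechet_derivative (\<lambda>x. u x - v x) (at x) w = frechet_derivative u (at x) w - frechet_derivative v (at x) w"
  using frechet_derivative_at[OF has_derivative_diff[OF assms[unfolded frechet_derivative_works]]] by metis

lemma grad_diff:
  fixes u v :: "real^'n \<Rightarrow> complex"
  assumes "smooth u" "smooth v"
  shows "grad (\<lambda>x. u x - v x) x = grad u x - grad v x"
  using assms by (simp add: grad_def vec_eq_iff frechet_derivative_diff smooth_differentiable)

text \<open>The identity with its nonnegative remainder dropped, combined with
  \<open>|\<partial>_r u| \<le> |\<nabla>u|\<close>. Applied to differences of test functions, it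
  makes Dirichlet-Cauchy sequences Cauchy with weight \<open>1 / |x|\<close>.\<close>

lemma hardy_inequality_test:
  fixes u :: "real^'n \<Rightarrow> complex"
  assumes n: "CARD('n) \<ge> 3" and u: "u \<in> test_functions UNIV"
  shows "(nn_sq lebesgue (\<lambda>x. u x / cnorm x))
    \<le> ennreal (1 / ((real CARD('n) - 2) / 2)^2) * (nn_sq lebesgue (\<lambda>x. grad u x))"
proof -
  define c where "c = (real CARD('n) - 2) / 2"
  have c: "c > 0" using n by (simp add: c_def)
  note h = hardy_identity_test[OF n u, folded c_def] and r = radial_square_integrable[OF u]
  have "c^2 * (LINT x|lborel. (cmod (u x))^2 / (norm x)^2) \<le> (LINT x|lborel. (cmod (radial u x))^2)"
    unfolding h(3) by simp
  also have "\<dots> \<le> (LINT x|lborel. (norm (grad u x))^2)"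
    using norm_sum_direction_le[of _ "grad u _"]
    by (intro integral_mono r) (auto simp: radial_def grad_def intro!: power_mono)
  finally have "(LINT x|lborel. (cmod (u x))^2 / (norm x)^2) \<le> 1 / c^2 * (LINT x|lborel. (norm (grad u x))^2)"
    using c by (simp add: field_simps)
  then have "ennreal (LINT x|lborel. (cmod (u x))^2 / (norm x)^2) \<le> ennreal (1 / c^2) * ennreal (LINT x|lborel. (norm (grad u x))^2)"
    by (subst ennreal_mult[symmetric]) (auto intro: ennreal_leI)
  moreover have "(\<integral>\<^sup>+x. ennreal ((cmod (u x))^2 / (norm x)^2) \<partial>lborel) = ennreal (LINT x|lborel. (cmod (u x))^2 / (norm x)^2)"
    using h(1) by (intro nn_integral_eq_integral) auto
  moreover have "(nn_sq lborel (\<lambda>x. grad u x)) = ennreal (LINT x|lborel. (norm (grad u x))^2)"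
    using r(3) by (intro nn_integral_eq_integral) auto
  ultimately show ?thesis
    unfolding c_def[symmetric] by (simp add: nn_integral_completion norm_divide power_divide)
qed

text \<open>V is the L2 limit of \<open>u k / |x|\<close>, while f is only the L1_loc limit of
  \<open>u k\<close>. On each ball a common subsequence converges almost everywhere to both
  \<open>|x| V\<close> and f, and countably many balls suffice.\<close>

lemma D12_representation:
  fixes f :: "real^'n \<Rightarrow> complex"
  assumes n: "CARD('n) \<ge> 3" and f: "f \<in> D12"
  obtains u G V where "\<And>k. u k \<in> test_functions UNIV"
    "G \<in> borel_measurable lebesgue" "L2_tendsto lebesgue (\<lambda>k. grad (u k)) G"
    "V \<in> borel_measurable lebesgue" "L2_tendsto lebesgue (\<lambda>k x. u k x / cnorm x) V"
    "AE x in lebesgue. f x = cnorm x * V x"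
proof -
  obtain u where fm: "f \<in> borel_measurable lebesgue" and u: "\<And>k. u k \<in> test_functions UNIV"
    and cau: "\<And>e. e > 0 ==> \<exists>N. \<forall>k\<ge>N. \<forall>m\<ge>N. L2norm (grad (\<lambda>x. u k x - u m x)) < ennreal e"
    and loc: "\<And>K. compact K ==> (\<lambda>k. \<integral>\<^sup>+x\<in>K. ennreal (norm (u k x - f x)) \<partial>lebesgue) \<longlonglongrightarrow> 0"
    using f unfolding D12_def by auto
  have um: "u k \<in> borel_measurable lebesgue" for k using test_borel[OF u] by (simp add: measurable_completion)
  have gm: "grad (u k) \<in> borel_measurable lebesgue" for k
    using radial_square_integrable(4)[OF u] by (simp add: measurable_completion)
  have gd: "grad (\<lambda>x. u k x - u m x) x = grad (u k) x - grad (u m) x" for k m x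
    by (intro grad_diff test_smooth[OF u])
  have cau2: "\<exists>N. \<forall>k\<ge>N. \<forall>m\<ge>N. (nn_sq lebesgue (\<lambda>x. grad (u k) x - grad (u m) x)) < ennreal e" if e: "e > 0" for e
  proof -
    have "sqrt e > 0" using e by simp
    from cau[OF this] obtain N where N: "\<forall>k\<ge>N. \<forall>m\<ge>N. L2norm (grad (\<lambda>x. u k x - u m x)) < ennreal (sqrt e)" by blast
    have "(nn_sq lebesgue (\<lambda>x. grad (u k) x - grad (u m) x)) < ennreal e" if "k \<ge> N" "m \<ge> N" for k m
      using L2norm_less[of "grad (\<lambda>x. u k x - u m x)" "sqrt e"] N that e by (simp add: gd)
    then show ?thesis by blast
  qed
  obtain G where G: "G \<in> borel_measurable lebesgue" "L2_tendsto lebesgue (\<lambda>k. grad (u k)) G"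
    using L2_complete[of "\<lambda>k. grad (u k)" lebesgue, OF gm cau2] by metis
  define c where "c = (real CARD('n) - 2) / 2"
  have c: "c > 0" using n by (simp add: c_def)
  have xm: "(\<lambda>x::real^'n. cnorm x) \<in> borel_measurable lebesgue"
    by (intro measurable_completion) measurable
  have vm: "(\<lambda>x. u k x / cnorm x) \<in> borel_measurable lebesgue" for k
    using um[of k] xm by (rule borel_measurable_divide)
  have cau3: "\<exists>N. \<forall>k\<ge>N. \<forall>m\<ge>N. (nn_sq lebesgue (\<lambda>x. u k x / cnorm x - u m x / cnorm x)) < ennreal e" if e: "e > 0" for e
  proof -
    have ce: "c^2 * e > 0" using c e by simp
    obtain N where N: "\<forall>k\<ge>N. \<forall>m\<ge>N. (nn_sq lebesgue (\<lambda>x. grad (u k) x - grad (u m) x)) < ennreal (c^2 * e)"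
      using cau2[OF ce] by blast
    have "(nn_sq lebesgue (\<lambda>x. u k x / cnorm x - u m x / cnorm x)) < ennreal e" if "k \<ge> N" "m \<ge> N" for k m
    proof -
      have "(nn_sq lebesgue (\<lambda>x. u k x / cnorm x - u m x / cnorm x))
        \<le> ennreal (1 / c^2) * (nn_sq lebesgue (\<lambda>x. grad (u k) x - grad (u m) x))"
        using hardy_inequality_test[OF n test_diff[OF u u], of k m] unfolding gd c_def diff_divide_distrib .
      also have "\<dots> < ennreal (1 / c^2) * ennreal (c^2 * e)"
        using N that c by (intro ennreal_mult_strict_left_mono) auto
      also have "\<dots> = ennreal e" using c e by (subst ennreal_mult[symmetric]) auto
      finally show ?thesis .
    qed
    then show ?thesis by blast
  qed
  obtain V r where V: "V \<in> borel_measurable lebesgue" "strict_mono r"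
    "AE x in lebesgue. (\<lambda>i. u (r i) x / cnorm x) \<longlonglongrightarrow> V x"
    "L2_tendsto lebesgue (\<lambda>k x. u k x / cnorm x) V"
    by (rule L2_complete[of "\<lambda>k x. u k x / cnorm x" lebesgue, OF vm cau3])
  have ball: "AE x in lebesgue. x \<in> cball 0 (real R) \<longrightarrow> f x = cnorm x * V x" for R
  proof -
    let ?K = "cball (0::real^'n) (real R)"
    define D where "D k x = indicator ?K x *\<^sub>R (u k x - f x)" for k x
    have Dm: "D k \<in> borel_measurable lebesgue" for k
      unfolding D_def
      by (rule borel_measurable_scaleR[OF borel_measurable_indicator[OF fmeasurableD[OF lmeasurable_cball]] borel_measurable_diff[OF um fm]])
    have De: "(\<integral>\<^sup>+x. ennreal (norm (D k x)) \<partial>lebesgue) = (\<integral>\<^sup>+x\<in>?K. ennreal (norm (u k x - f x)) \<partial>lebesgue)" for k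
      by (intro nn_integral_cong) (auto simp: D_def indicator_def)
    have lim: "(\<lambda>k. \<integral>\<^sup>+x. ennreal (norm (D k x)) \<partial>lebesgue) \<longlonglongrightarrow> 0" unfolding De by (intro loc) simp
    then have "\<forall>\<^sub>F k in sequentially. (\<integral>\<^sup>+x. ennreal (norm (D k x)) \<partial>lebesgue) < 1"
      by (rule order_tendstoD) simp
    \<comment> \<open>f is not known to be locally integrable at this stage, so early differences
      might have infinite integral; the index is shifted past them.\<close>
    then obtain k0 where k0: "(\<integral>\<^sup>+x. ennreal (norm (D k x)) \<partial>lebesgue) < 1" if "k \<ge> k0" for k
      unfolding eventually_sequentially by blast
    have Di: "integrable lebesgue (D (r (k + k0)))" for k
    proof (rule integrableI_bounded[OF Dm])
      have "k0 \<le> r (k + k0)" using seq_suble[OF V(2), of "k + k0"] by linarith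
      from k0[OF this] show "(\<integral>\<^sup>+x. ennreal (norm (D (r (k + k0)) x)) \<partial>lebesgue) < \<infinity>"
        by (rule less_trans) simp
    qed
    have sm: "strict_mono (\<lambda>k. r (k + k0))" using V(2) by (simp add: strict_mono_def)
    have "(\<lambda>k. enn2real (\<integral>\<^sup>+x. ennreal (norm (D (r (k + k0)) x)) \<partial>lebesgue)) \<longlonglongrightarrow> enn2real 0"
      using LIMSEQ_subseq_LIMSEQ[OF lim sm] by (intro tendsto_enn2real) (auto simp: comp_def)
    then have "(\<lambda>k. LINT x|lebesgue. norm (D (r (k + k0)) x)) \<longlonglongrightarrow> 0"
      using Dm by (simp add: integral_eq_nn_integral)
    \<comment> \<open>Extracted from r, along which the quotients already converge almost
      everywhere.\<close>
    from tendsto_L1_AE_subseq[OF Di this] obtain s where s: "strict_mono s"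
      "AE x in lebesgue. (\<lambda>i. D (r (s i + k0)) x) \<longlonglongrightarrow> 0" by blast
    show ?thesis using s(2) V(3) AE_nonzero
    proof eventually_elim
      case (elim x)
      show ?case
      proof
        assume "x \<in> cball 0 (real R)"
        then have "(\<lambda>i. u (r (s i + k0)) x - f x) \<longlonglongrightarrow> 0" using elim(1) by (simp add: D_def)
        then have 1: "(\<lambda>i. u (r (s i + k0)) x) \<longlonglongrightarrow> f x" by (simp add: LIM_zero_iff)
        have "strict_mono (\<lambda>i. s i + k0)" using s(1) by (simp add: strict_mono_def)
        from LIMSEQ_subseq_LIMSEQ[OF elim(2) this]
        have "(\<lambda>i. cnorm x * (u (r (s i + k0)) x / cnorm x)) \<longlonglongrightarrow> cnorm x * V x"
          by (intro tendsto_intros) (simp add: comp_def)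
        then have "(\<lambda>i. u (r (s i + k0)) x) \<longlonglongrightarrow> cnorm x * V x" using elim(3) by simp
        with 1 show "f x = cnorm x * V x" by (rule LIMSEQ_unique)
      qed
    qed
  qed
  have "AE x in lebesgue. \<forall>R. x \<in> cball 0 (real R) \<longrightarrow> f x = cnorm x * V x"
    using ball by (simp only: AE_all_countable simp_thms)
  then have "AE x in lebesgue. f x = cnorm x * V x"
  proof eventually_elim
    case (elim x)
    obtain R where "norm x \<le> real R" using real_arch_simple by blast
    then show ?case using elim[rule_format, of R] by simp
  qed
  then show thesis by (rule that[OF u G V(1,4)])
qed

text \<open>The bound \<open>t \<le> 1 + t^2\<close> gives a majorant that is integrable over
  compact sets.\<close>

lemma square_integrable_loc_integrable:
  fixes g :: "real^'n \<Rightarrow> complex"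
  assumes "g \<in> borel_measurable lebesgue" "integrable lebesgue (\<lambda>x. (cmod (g x))^2)"
  shows "loc_integrable_on \<Omega> g"
  unfolding loc_integrable_on_def set_integrable_def
proof (intro allI impI)
  fix K assume K: "compact K \<and> K \<subseteq> \<Omega>"
  then have Ks: "K \<in> sets borel" by (simp add: borel_compact)
  show "integrable lebesgue (\<lambda>x. indicator K x *\<^sub>R g x)"
  proof (rule Bochner_Integration.integrable_bound)
    have "integrable lborel (\<lambda>x. indicator K x *\<^sub>R (1::real))"
      using K by (intro borel_integrable_compact) auto
    then have "integrable lebesgue (\<lambda>x. indicator K x *\<^sub>R (1::real))"
      by (intro integrable_completion[THEN iffD2]) auto
    then show "integrable lebesgue (\<lambda>x. indicator K x *\<^sub>R (1::real) + (cmod (g x))^2)"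
      using assms(2) by (rule Bochner_Integration.integrable_add)
    show "(\<lambda>x. indicator K x *\<^sub>R g x) \<in> borel_measurable lebesgue"
      using assms(1) Ks by (intro borel_measurable_scaleR borel_measurable_indicator) auto
    have "t \<le> 1 + t^2" for t :: real
    proof -
      have "2 * t \<le> 1 + t^2" using sum_squares_bound[of 1 t] by simp
      then show ?thesis using zero_le_power2[of t] by linarith
    qed
    then show "AE x in lebesgue. norm (indicator K x *\<^sub>R g x) \<le> norm (indicator K x *\<^sub>R (1::real) + (cmod (g x))^2)"
      by (intro AE_I2) (auto simp: indicator_def)
  qed
qed

text \<open>The version with weight |x| is for pairings written as
  \<open>(u / |x|) (|x| \<partial>_j \<psi>)\<close>, where the first factor converges in
  L2.\<close>

lemma test_square_integrable:
  fixes \<psi> :: "real^'n \<Rightarrow> complex"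
  assumes "\<psi> \<in> test_functions \<Omega>"
  shows "integrable lebesgue (\<lambda>x. (cmod (cnorm x * \<psi> x))^2)" "integrable lebesgue (\<lambda>x. (cmod (\<psi> x))^2)"
proof -
  obtain R where R: "\<And>x. norm x > R ==> \<psi> x = 0" using test_bounded_support[OF assms] by metis
  have c: "continuous_on UNIV \<psi>" by (rule smooth_continuous[OF test_smooth[OF assms]])
  have "integrable lborel (\<lambda>x. (cmod (cnorm x * \<psi> x))^2)"
    by (rule integrable_continuous_compact_support[of _ R])
      (auto intro!: continuous_intros c simp: R)
  then show "integrable lebesgue (\<lambda>x. (cmod (cnorm x * \<psi> x))^2)"
    by (intro integrable_completion[THEN iffD2]) auto
  have "integrable lborel (\<lambda>x. (cmod (\<psi> x))^2)"
    by (rule integrable_continuous_compact_support[of _ R])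
      (auto intro!: continuous_intros c simp: R)
  then show "integrable lebesgue (\<lambda>x. (cmod (\<psi> x))^2)"
    by (intro integrable_completion[THEN iffD2]) auto
qed

lemma D12_hardy:
  fixes f :: "real^'n \<Rightarrow> complex"
  defines "c \<equiv> (real CARD('n) - 2) / 2"
  assumes n: "CARD('n) \<ge> 3" and f: "f \<in> D12"
  shows "weakly_differentiable f"
    "integrable lebesgue (\<lambda>x. (cmod (f x / cnorm x))^2)"
    "integrable lebesgue (\<lambda>x. (cmod (radial_deriv f x))^2)"
    "integrable lebesgue (\<lambda>x. (cmod (remainder1 f x))^2)"
    "c^2 * (LINT x|lebesgue. (cmod (f x / cnorm x))^2)
      = (LINT x|lebesgue. (cmod (radial_deriv f x))^2) - (LINT x|lebesgue. (cmod (remainder1 f x))^2)"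
proof -
  obtain u G V where u: "\<And>k. u k \<in> test_functions UNIV"
    and G: "G \<in> borel_measurable lebesgue" "L2_tendsto lebesgue (\<lambda>k. grad (u k)) G"
    and V: "V \<in> borel_measurable lebesgue" "L2_tendsto lebesgue (\<lambda>k x. u k x / cnorm x) V"
    and fV: "AE x in lebesgue. f x = cnorm x * V x"
    by (rule D12_representation[OF n f], rule that)
  note s = test_smooth[OF u]
  have fm: "f \<in> borel_measurable lebesgue" using f by (simp add: D12_def)
  have gm: "grad (u k) \<in> borel_measurable lebesgue" for k
    using radial_square_integrable(4)[OF u] by (simp add: measurable_completion)
  have rm: "radial (u k) \<in> borel_measurable lebesgue" for k
    using radial_square_integrable(1)[OF u] by (simp add: measurable_completion)
  have um: "u k \<in> borel_measurable lebesgue" for k using test_borel[OF u] by (simp add: measurable_completion)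
  have xm: "(\<lambda>x::real^'n. cnorm x) \<in> borel_measurable lebesgue"
    by (intro measurable_completion) measurable
  have vm: "(\<lambda>x. u k x / cnorm x) \<in> borel_measurable lebesgue" for k
    using um[of k] xm by (rule borel_measurable_divide)
  have leb: "integrable lebesgue h" "(LINT x|lebesgue. h x) = (LINT x|lborel. h x)" if "integrable lborel h" for h :: "real^'n \<Rightarrow> real"
    using that by (auto simp: integrable_completion integral_completion)
  have gi: "integrable lebesgue (\<lambda>x. (norm (grad (u k) x))^2)" for k
    by (rule leb radial_square_integrable u)+
  have vsq: "(cmod (u k x / cnorm x))^2 = (cmod (u k x))^2 / (norm x)^2" for k x
    by (simp add: norm_divide power_divide)
  have vi: "integrable lebesgue (\<lambda>x. (cmod (u k x / cnorm x))^2)" for k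
    unfolding vsq by (rule leb hardy_identity_test n u)+
  note LG = L2_tendsto_integral[OF G(2) gm G(1) gi] and LV = L2_tendsto_integral[OF V(2) vm V(1) vi]
  have Gjm: "(\<lambda>x. G x $ j) \<in> borel_measurable lebesgue" for j
    using measurable_compose[OF G(1), of "\<lambda>z. z $ j" borel]
    by (simp add: borel_measurable_continuous_onI continuous_on_component)
  have Gjsq: "integrable lebesgue (\<lambda>x. (cmod (G x $ j))^2)" for j
  proof (rule Bochner_Integration.integrable_bound[OF LG(1)])
    show "AE x in lebesgue. norm ((cmod (G x $ j))^2) \<le> norm ((norm (G x))^2)"
      by (intro AE_I2) (simp add: power_mono Finite_Cartesian_Product.norm_nth_le)
  qed (use Gjm in measurable)
  have Gj: "L2_tendsto lebesgue (\<lambda>k x. grad (u k) x $ j) (\<lambda>x. G x $ j)" for j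
    by (rule L2_tendsto_dominated[OF G(2)]) (metis Finite_Cartesian_Product.norm_nth_le vector_minus_component)
  have gjm: "(\<lambda>x. grad (u k) x $ j) \<in> borel_measurable lebesgue" for k j
    using test_borel[OF test_partial[OF u]] by (simp add: measurable_completion grad_def)
  have gji: "integrable lebesgue (\<lambda>x. (cmod (grad (u k) x $ j))^2)" for k j
    using test_square_integrable(2)[OF test_partial[OF u]] by (simp add: grad_def)
  \<comment> \<open>V is square integrable, hence locally integrable, and |x| is continuous; f
    inherits this by almost everywhere equality.\<close>
  have lf: "loc_integrable_on (- {0}) f"
  proof -
    have "loc_integrable_on (- {0}) (\<lambda>x. cnorm x * V x)"
      by (intro loc_integrable_mult_continuous square_integrable_loc_integrable V(1) LV(1) continuous_intros)
    moreover have "set_integrable lebesgue K f" if "set_integrable lebesgue K (\<lambda>x. cnorm x * V x)" "compact K" for K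
    proof -
      have K: "K \<in> sets lebesgue" using that(2) by (simp add: borel_compact)
      have "(\<lambda>x. indicator K x *\<^sub>R f x) \<in> borel_measurable lebesgue"
        using fm K by (intro borel_measurable_scaleR borel_measurable_indicator)
      moreover have "AE x in lebesgue. indicator K x *\<^sub>R (cnorm x * V x) = indicator K x *\<^sub>R f x"
        using fV by eventually_elim simp
      ultimately show ?thesis
        using that(1) integrable_cong_AE_imp unfolding set_integrable_def by blast
    qed
    ultimately show ?thesis unfolding loc_integrable_on_def by blast
  qed
  \<comment> \<open>Integration by parts for \<open>u k\<close> passes to the limit with both sides
    read as L2 pairings: the gradients against \<psi>, and \<open>u k / |x|\<close> against
    \<open>|x| \<partial>_j \<psi>\<close>.\<close>
  have wp: "is_weak_partial (- {0}) j f (\<lambda>x. G x $ j)" for j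
    unfolding is_weak_partial_def
  proof (intro conjI ballI lf square_integrable_loc_integrable Gjm Gjsq)
    fix \<psi> :: "real^'n \<Rightarrow> complex" assume \<psi>: "\<psi> \<in> test_functions (- {0})"
    note \<psi>' = test_partial[OF \<psi>, of j]
    have m1: "\<psi> \<in> borel_measurable lebesgue" "(\<lambda>x. partial j \<psi> x) \<in> borel_measurable lebesgue"
      using test_borel[OF \<psi>] test_borel[OF \<psi>'] by (auto simp: measurable_completion)
    have m2: "(\<lambda>x. cnorm x * partial j \<psi> x) \<in> borel_measurable lebesgue"
      using xm m1(2) by (rule borel_measurable_times)
    have "(\<lambda>k. LINT x|lebesgue. grad (u k) x $ j * \<psi> x) \<longlonglongrightarrow> (LINT x|lebesgue. G x $ j * \<psi> x)"
      by (intro L2_tendsto_pairing Gj gjm Gjm m1 gji test_square_integrable(2)[OF \<psi>])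
    moreover have "(\<lambda>k. LINT x|lebesgue. u k x / cnorm x * (cnorm x * partial j \<psi> x))
       \<longlonglongrightarrow> (LINT x|lebesgue. V x * (cnorm x * partial j \<psi> x))"
      by (intro L2_tendsto_pairing V vm m2 vi test_square_integrable(1)[OF \<psi>'])
    moreover have "(LINT x|lebesgue. u k x / cnorm x * (cnorm x * partial j \<psi> x))
       = - (LINT x|lebesgue. grad (u k) x $ j * \<psi> x)" for k
    proof -
      have "(LINT x|lebesgue. u k x / cnorm x * (cnorm x * partial j \<psi> x))
        = (LINT x|lebesgue. u k x * partial j \<psi> x)"
      proof (rule integral_cong_AE)
        show "AE x in lebesgue. u k x / cnorm x * (cnorm x * partial j \<psi> x)
          = u k x * partial j \<psi> x"
          using AE_nonzero by eventually_elim simp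
      qed (intro borel_measurable_times vm m2 um m1)+
      then show ?thesis using test_integration_by_parts[OF s \<psi>] by (simp add: grad_def)
    qed
    ultimately have "(\<lambda>k. LINT x|lebesgue. grad (u k) x $ j * \<psi> x)
       \<longlonglongrightarrow> - (LINT x|lebesgue. V x * (cnorm x * partial j \<psi> x))"
      "(\<lambda>k. LINT x|lebesgue. grad (u k) x $ j * \<psi> x) \<longlonglongrightarrow> (LINT x|lebesgue. G x $ j * \<psi> x)"
      by (auto dest: tendsto_minus)
    then have "(LINT x|lebesgue. V x * (cnorm x * partial j \<psi> x)) = - (LINT x|lebesgue. G x $ j * \<psi> x)"
      using LIMSEQ_unique by fastforce
    moreover have "(LINT x|lebesgue. V x * (cnorm x * partial j \<psi> x))
        = (LINT x|lebesgue. f x * partial j \<psi> x)"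
    proof (rule integral_cong_AE)
      show "AE x in lebesgue. V x * (cnorm x * partial j \<psi> x) = f x * partial j \<psi> x"
        using fV by eventually_elim simp
    qed (intro borel_measurable_times V(1) m2 fm m1)+
    ultimately show "(LINT x|lebesgue. f x * grad \<psi> x $ j) = - (LINT x|lebesgue. G x $ j * \<psi> x)"
      by (simp add: grad_def)
  qed
  then show wd: "weakly_differentiable f" unfolding weakly_differentiable_def by blast
  \<comment> \<open>The radial component of the limit gradient; by
    \<open>norm_sum_direction_le\<close> it is the L2 limit of the classical radial
    derivatives.\<close>
  define D where "D x = (\<Sum>j\<in>UNIV. complex_of_real (x $ j / norm x) * G x $ j)" for x
  have DL: "L2_tendsto lebesgue (\<lambda>k. radial (u k)) D"
  proof (rule L2_tendsto_dominated[OF G(2)])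
    fix k x
    have "radial (u k) x - D x = (\<Sum>j\<in>UNIV. complex_of_real (x $ j / norm x) * (grad (u k) x - G x) $ j)"
      by (simp add: radial_def D_def grad_def sum_subtractf right_diff_distrib)
    then show "cmod (radial (u k) x - D x) \<le> norm (grad (u k) x - G x)"
      using norm_sum_direction_le[of x "grad (u k) x - G x"] by simp
  qed
  have Dm: "D \<in> borel_measurable lebesgue"
  proof -
    have [measurable]: "(\<lambda>x::real^'n. x $ j) \<in> borel_measurable borel" for j
      by (intro borel_measurable_continuous_onI continuous_intros)
    have "(\<lambda>x::real^'n. complex_of_real (x $ j / norm x)) \<in> borel_measurable lebesgue" for j
      by (intro measurable_completion) measurable
    then show ?thesis unfolding D_def using Gjm by (intro borel_measurable_sum borel_measurable_times)
  qed
  have ri: "integrable lebesgue (\<lambda>x. (cmod (radial (u k) x))^2)" for k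
    by (rule leb radial_square_integrable u)+
  note LD = L2_tendsto_integral[OF DL rm Dm ri]
  have RL: "L2_tendsto lebesgue (\<lambda>k x. radial (u k) x + c *\<^sub>R (u k x / cnorm x)) (\<lambda>x. D x + c *\<^sub>R V x)"
    by (rule L2_tendsto_add_scaled[OF DL V(2) rm Dm vm V(1)])
  have Rm: "(\<lambda>x. radial (u k) x + c *\<^sub>R (u k x / cnorm x)) \<in> borel_measurable lebesgue"
    "(\<lambda>x. D x + c *\<^sub>R V x) \<in> borel_measurable lebesgue" for k
    using rm[of k] vm[of k] Dm V(1) by (auto intro!: borel_measurable_add borel_measurable_scaleR)
  have re: "radial (u k) x + c *\<^sub>R (u k x / cnorm x) = radial (u k) x + complex_of_real (c / norm x) * u k x" for k x
    by (simp add: scaleR_conv_of_real)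
  have Ri: "integrable lebesgue (\<lambda>x. (cmod (radial (u k) x + c *\<^sub>R (u k x / cnorm x)))^2)" for k
    unfolding re by (rule leb(1), rule hardy_identity_test(2)[OF n u, folded c_def])
  note LR = L2_tendsto_integral[OF RL Rm Ri]
  have id: "c^2 * (LINT x|lebesgue. (cmod (u k x / cnorm x))^2)
      = (LINT x|lebesgue. (cmod (radial (u k) x))^2)
        - (LINT x|lebesgue. (cmod (radial (u k) x + c *\<^sub>R (u k x / cnorm x)))^2)" for k
    unfolding re vsq using hardy_identity_test[OF n u[of k]] radial_square_integrable(2)[OF u[of k]]
    by (simp add: leb(2) flip: c_def)
  have "(\<lambda>k. c^2 * (LINT x|lebesgue. (cmod (u k x / cnorm x))^2)) \<longlonglongrightarrow> c^2 * (LINT x|lebesgue. (cmod (V x))^2)"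
    by (intro tendsto_intros LV)
  moreover have "(\<lambda>k. c^2 * (LINT x|lebesgue. (cmod (u k x / cnorm x))^2)) \<longlonglongrightarrow>
     (LINT x|lebesgue. (cmod (D x))^2) - (LINT x|lebesgue. (cmod (D x + c *\<^sub>R V x))^2)"
    unfolding id by (intro tendsto_intros LD LR)
  ultimately have main: "c^2 * (LINT x|lebesgue. (cmod (V x))^2) = (LINT x|lebesgue. (cmod (D x))^2) - (LINT x|lebesgue. (cmod (D x + c *\<^sub>R V x))^2)"
    by (rule LIMSEQ_unique)
  have eV: "AE x in lebesgue. f x / cnorm x = V x"
    using fV AE_nonzero by eventually_elim simp
  have "AE x in lebesgue. \<forall>j. weak_partial j f x = G x $ j"
    by (subst AE_all_countable) (intro allI weak_partialI(2) wp)
  then have eD: "AE x in lebesgue. radial_deriv f x = D x"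
    by eventually_elim (simp add: radial_deriv_def D_def)
  have eR: "AE x in lebesgue. remainder1 f x = D x + c *\<^sub>R V x"
    using eD eV
  proof eventually_elim
    case (elim x)
    have "complex_of_real ((real CARD('n) - 2) / (2 * norm x)) * f x = c *\<^sub>R (f x / cnorm x)"
      by (simp add: c_def scaleR_conv_of_real)
    then show ?case by (simp only: remainder1_def elim)
  qed
  \<comment> \<open>Moves integrals from the concrete limits V, D and \<open>D + c V\<close> to
    \<open>f / |x|\<close>, \<open>radial_deriv f\<close> and \<open>remainder1 f\<close>, which
    agree with them only almost everywhere.\<close>
  have tr: "integrable lebesgue (\<lambda>x. (cmod (p x))^2)" "(LINT x|lebesgue. (cmod (p x))^2) = (LINT x|lebesgue. (cmod (q x))^2)"
    if "AE x in lebesgue. p x = q x" "p \<in> borel_measurable lebesgue" "q \<in> borel_measurable lebesgue"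
      "integrable lebesgue (\<lambda>x. (cmod (q x))^2)" for p q :: "real^'n \<Rightarrow> complex"
  proof -
    have e: "AE x in lebesgue. (cmod (p x))^2 = (cmod (q x))^2" using that(1) by eventually_elim simp
    have m: "(\<lambda>x. (cmod (p x))^2) \<in> borel_measurable lebesgue" "(\<lambda>x. (cmod (q x))^2) \<in> borel_measurable lebesgue"
      using that(2,3) by auto
    show "integrable lebesgue (\<lambda>x. (cmod (p x))^2)" using integrable_cong_AE[OF m e] that(4) by simp
    show "(LINT x|lebesgue. (cmod (p x))^2) = (LINT x|lebesgue. (cmod (q x))^2)"
      by (rule integral_cong_AE[OF m e])
  qed
  have mf: "(\<lambda>x. f x / cnorm x) \<in> borel_measurable lebesgue"
    using fm xm by (rule borel_measurable_divide)
  have mr: "radial_deriv f \<in> borel_measurable lebesgue"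
    unfolding radial_deriv_euler[abs_def]
    using loc_integrable_measurable[OF euler_loc_integrable[OF wd]] xm by (rule borel_measurable_divide)
  have mR: "remainder1 f \<in> borel_measurable lebesgue"
  proof -
    have "(\<lambda>x::real^'n. complex_of_real ((real CARD('n) - 2) / (2 * norm x))) \<in> borel_measurable lebesgue"
      by (intro measurable_completion) measurable
    then show ?thesis unfolding remainder1_def[abs_def] using mr fm
      by (intro borel_measurable_add borel_measurable_times)
  qed
  note t1 = tr[OF eV mf V(1) LV(1)] and t2 = tr[OF eD mr Dm LD(1)] and t3 = tr[OF eR mR Rm(2) LR(1)]
  show "integrable lebesgue (\<lambda>x. (cmod (f x / cnorm x))^2)" by (rule t1)
  show "integrable lebesgue (\<lambda>x. (cmod (radial_deriv f x))^2)" by (rule t2)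
  show "integrable lebesgue (\<lambda>x. (cmod (remainder1 f x))^2)" by (rule t3)
  show "c^2 * (LINT x|lebesgue. (cmod (f x / cnorm x))^2)
      = (LINT x|lebesgue. (cmod (radial_deriv f x))^2) - (LINT x|lebesgue. (cmod (remainder1 f x))^2)"
    using main t1(2) t2(2) t3(2) by simp
qed

section \<open>Dilations and the Euler operator\<close>

text \<open>Special case of the affine change of variables, with factor t on every basis vector. As
  an equality of measures it serves null sets, extended integrals and Bochner integrals
  alike.\<close>

lemma lebesgue_scale:
  assumes "t > 0"
  shows "(lebesgue :: 'a::euclidean_space measure)
    = density (distr lebesgue lebesgue ((*\<^sub>R) t)) (\<lambda>_. ennreal (t ^ DIM('a)))"
  using lebesgue_affine_euclidean[of "\<lambda>_. t" "0::'a"] assms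
  unfolding scaleR_scaleR[symmetric] scaleR_sum_right[symmetric] euclidean_representation
  by simp

lemma AE_lebesgue_scale:
  assumes "t > 0" "AE x in (lebesgue :: 'a::euclidean_space measure). P x"
  shows "AE x in lebesgue. P (t *\<^sub>R x)"
proof -
  have "AE x in density (distr lebesgue lebesgue ((*\<^sub>R) t)) (\<lambda>_. ennreal (t ^ DIM('a))). P x"
    using assms(2) unfolding lebesgue_scale[OF assms(1), symmetric] .
  then have "AE x in distr lebesgue lebesgue ((*\<^sub>R) t). P x"
    using assms(1) by (subst (asm) AE_density) auto
  then show ?thesis by (rule AE_distrD[OF lebesgue_measurable_scaling])
qed

lemma nn_integral_lebesgue_scale:
  fixes f :: "'a::euclidean_space \<Rightarrow> ennreal"
  assumes "t > 0" "f \<in> borel_measurable lebesgue"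
  shows "(\<integral>\<^sup>+x. f x \<partial>lebesgue) = ennreal (t ^ DIM('a)) * (\<integral>\<^sup>+x. f (t *\<^sub>R x) \<partial>lebesgue)"
proof -
  have "(\<integral>\<^sup>+x. f x \<partial>lebesgue) = (\<integral>\<^sup>+x. f x \<partial>density (distr lebesgue lebesgue ((*\<^sub>R) t)) (\<lambda>_. ennreal (t ^ DIM('a))))"
    unfolding lebesgue_scale[OF assms(1), symmetric] ..
  also have "\<dots> = ennreal (t ^ DIM('a)) * (\<integral>\<^sup>+x. f x \<partial>distr lebesgue lebesgue ((*\<^sub>R) t))"
    using assms(2) by (simp add: nn_integral_density nn_integral_cmult)
  also have "(\<integral>\<^sup>+x. f x \<partial>distr lebesgue lebesgue ((*\<^sub>R) t)) = (\<integral>\<^sup>+x. f (t *\<^sub>R x) \<partial>lebesgue)"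
    using assms(2) by (intro nn_integral_distr) auto
  finally show ?thesis .
qed

lemma integral_lebesgue_scale:
  fixes f :: "'a::euclidean_space \<Rightarrow> 'b::{banach,second_countable_topology}"
  assumes "t > 0" "f \<in> borel_measurable lebesgue"
  shows "(LINT x|lebesgue. f x) = (t ^ DIM('a)) *\<^sub>R (LINT x|lebesgue. f (t *\<^sub>R x))"
proof -
  have "(LINT x|lebesgue. f x) = (LINT x|density (distr lebesgue lebesgue ((*\<^sub>R) t)) (\<lambda>_. ennreal (t ^ DIM('a))). f x)"
    unfolding lebesgue_scale[OF assms(1), symmetric] ..
  also have "\<dots> = (LINT x|distr lebesgue lebesgue ((*\<^sub>R) t). (t ^ DIM('a)) *\<^sub>R f x)"
    using assms by (intro integral_density) auto
  also have "\<dots> = (t ^ DIM('a)) *\<^sub>R (LINT x|distr lebesgue lebesgue ((*\<^sub>R) t). f x)" by simp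
  also have "(LINT x|distr lebesgue lebesgue ((*\<^sub>R) t). f x) = (LINT x|lebesgue. f (t *\<^sub>R x))"
    using assms(2) by (intro integral_distr) auto
  finally show ?thesis .
qed

lemma integrable_lebesgue_scale:
  fixes f :: "'a::euclidean_space \<Rightarrow> 'b::{banach,second_countable_topology}"
  assumes "t > 0" "integrable lebesgue f"
  shows "integrable lebesgue (\<lambda>x. f (t *\<^sub>R x))"
proof -
  have m: "f \<in> borel_measurable lebesgue" using assms(2) by (rule borel_measurable_integrable)
  have "(\<integral>\<^sup>+x. ennreal (norm (f x)) \<partial>lebesgue) = ennreal (t ^ DIM('a)) * (\<integral>\<^sup>+x. ennreal (norm (f (t *\<^sub>R x))) \<partial>lebesgue)"
    using m by (intro nn_integral_lebesgue_scale[OF assms(1)]) measurable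
  moreover have "(\<integral>\<^sup>+x. ennreal (norm (f x)) \<partial>lebesgue) < \<infinity>" using assms(2) by (simp add: integrable_iff_bounded)
  ultimately have "(\<integral>\<^sup>+x. ennreal (norm (f (t *\<^sub>R x))) \<partial>lebesgue) < \<infinity>"
    using assms(1) by (auto simp: ennreal_mult_less_top)
  moreover have "(\<lambda>x. f (t *\<^sub>R x)) \<in> borel_measurable lebesgue"
    by (rule measurable_compose[OF lebesgue_measurable_scaling m])
  ultimately show ?thesis by (simp add: integrable_iff_bounded)
qed

lemma scaled_has_derivative:
  fixes \<psi> :: "real^'n \<Rightarrow> complex"
  assumes "\<psi> differentiable at (t *\<^sub>R x)"
  shows "((\<lambda>x. \<psi> (t *\<^sub>R x)) has_derivative (\<lambda>v. frechet_derivative \<psi> (at (t *\<^sub>R x)) (t *\<^sub>R v))) (at x)"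
  by (rule has_derivative_compose[where f="\<lambda>x. t *\<^sub>R x" and g=\<psi>])
    (use assms[unfolded frechet_derivative_works] in "auto intro!: derivative_eq_intros")

lemma frechet_derivative_scaled:
  fixes \<psi> :: "real^'n \<Rightarrow> complex"
  assumes "\<psi> differentiable at (t *\<^sub>R x)"
  shows "frechet_derivative (\<lambda>x. \<psi> (t *\<^sub>R x)) (at x) v = complex_of_real t * frechet_derivative \<psi> (at (t *\<^sub>R x)) v"
  by (subst frechet_derivative_at[OF scaled_has_derivative[OF assms], symmetric])
    (simp add: linear_cmul[OF linear_frechet_derivative[OF assms]] flip: scaleR_conv_of_real)

lemma Ck_scaled:
  fixes \<psi> :: "real^'n \<Rightarrow> complex"
  shows "Ck k \<psi> ==> Ck k (\<lambda>x. \<psi> (t *\<^sub>R x))"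
proof (induction k arbitrary: \<psi>)
  case 0
  then have "continuous_on UNIV \<psi>" by simp
  from continuous_on_compose2[OF this, of UNIV "\<lambda>x. t *\<^sub>R x"]
  show ?case by (simp add: continuous_on_scaleR)
next
  case (Suc k)
  then have d: "\<psi> differentiable at x" for x by (auto simp: differentiable_on_def)
  have "Ck k (\<lambda>x. complex_of_real t * partial j \<psi> (t *\<^sub>R x))" for j
    using Suc by (intro Ck_mult Ck_const Suc.IH[of "\<lambda>x. partial j \<psi> x"]) auto
  then have "\<forall>j. Ck k (\<lambda>x. partial j (\<lambda>x. \<psi> (t *\<^sub>R x)) x)"
    by (simp only: frechet_derivative_scaled[OF d] simp_thms)
  moreover have "(\<lambda>x. \<psi> (t *\<^sub>R x)) differentiable_on UNIV"
    using scaled_has_derivative[OF d] by (auto simp: differentiable_on_def differentiable_def)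
  ultimately show ?case by simp
qed

lemma test_scaled:
  fixes \<psi> :: "real^'n \<Rightarrow> complex"
  assumes \<psi>: "\<psi> \<in> test_functions (- {0})" and t: "t \<noteq> 0"
  shows "(\<lambda>x. \<psi> (t *\<^sub>R x)) \<in> test_functions (- {0})"
proof -
  let ?S = "closure {x. \<psi> x \<noteq> 0}" and ?T = "closure {x. \<psi> (t *\<^sub>R x) \<noteq> 0}"
  have c: "compact ((*\<^sub>R) (1 / t) ` ?S)"
    by (rule compact_scaling[OF test_compact_support(1)[OF \<psi>]])
  have "{x. \<psi> (t *\<^sub>R x) \<noteq> 0} \<subseteq> (*\<^sub>R) (1 / t) ` ?S"
  proof
    fix x assume "x \<in> {x. \<psi> (t *\<^sub>R x) \<noteq> 0}"
    then have "t *\<^sub>R x \<in> ?S" by (simp add: in_closure_support)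
    moreover have "x = (1 / t) *\<^sub>R (t *\<^sub>R x)" using t by simp
    ultimately show "x \<in> (*\<^sub>R) (1 / t) ` ?S" by (rule rev_image_eqI)
  qed
  then have sub: "?T \<subseteq> (*\<^sub>R) (1 / t) ` ?S" using compact_imp_closed[OF c] by (rule closure_minimal)
  then have "compact ?T" using c by (meson closed_closure bounded_subset compact_eq_bounded_closed)
  moreover have "0 \<notin> (*\<^sub>R) (1 / t) ` ?S" using test_compact_support(2)[OF \<psi>] t by auto
  then have "?T \<subseteq> - {0}" using sub by blast
  moreover have "smooth (\<lambda>x. \<psi> (t *\<^sub>R x))" using test_smooth[OF \<psi>] by (simp add: smooth_def Ck_scaled)
  ultimately show ?thesis by (simp add: test_functions_def)
qed

text \<open>The divergence of \<open>x \<psi>\<close>, that is, minus the formal adjoint of the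
  Euler operator.\<close>

definition euler_dual :: "(real^'n \<Rightarrow> complex) \<Rightarrow> real^'n \<Rightarrow> complex" where
  "euler_dual \<psi> x = of_nat CARD('n) * \<psi> x + frechet_derivative \<psi> (at x) x"

lemma continuous_euler_dual:
  fixes \<psi> :: "real^'n \<Rightarrow> complex"
  assumes "\<psi> \<in> test_functions \<Omega>"
  shows "continuous_on UNIV (euler_dual \<psi>)"
proof -
  have e: "frechet_derivative \<psi> (at x) x
      = (\<Sum>j\<in>UNIV. complex_of_real (x $ j) * partial j \<psi> x)" for x
    by (rule frechet_derivative_expand[OF smooth_differentiable[OF test_smooth[OF assms]]])
  have "euler_dual \<psi> = (\<lambda>x. of_nat CARD('n) * \<psi> x
      + (\<Sum>j\<in>UNIV. complex_of_real (x $ j) * partial j \<psi> x))"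
    unfolding euler_dual_def[abs_def] e ..
  moreover have "continuous_on UNIV \<psi>" "continuous_on UNIV (\<lambda>x. partial j \<psi> x)" for j
    by (intro smooth_continuous smooth_partial test_smooth[OF assms])+
  ultimately show ?thesis by (auto intro!: continuous_intros)
qed

text \<open>The factor \<open>t^n\<close> is the Jacobian, so that pairing with h transfers the
  dilation to h without a factor.\<close>

abbreviation dilate :: "(real^'n \<Rightarrow> complex) \<Rightarrow> real \<Rightarrow> real^'n \<Rightarrow> complex" where
  "dilate \<psi> t x \<equiv> complex_of_real (t ^ CARD('n)) * \<psi> (t *\<^sub>R x)"

text \<open>The t-derivative of \<open>dilate\<close>: one of the n factors t is spent on turning
  \<open>\<nabla>\<psi> (t x) \<cdot> x\<close> into
  \<open>\<nabla>\<psi> (t x) \<cdot> (t x)\<close>, hence the exponent n - 1.\<close>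

abbreviation dilate' :: "(real^'n \<Rightarrow> complex) \<Rightarrow> real \<Rightarrow> real^'n \<Rightarrow> complex" where
  "dilate' \<psi> t x \<equiv> complex_of_real (t ^ (CARD('n) - 1)) * euler_dual \<psi> (t *\<^sub>R x)"

text \<open>No derivative of h is involved, as the parameter acts on the test function. For s near t
  the supports of \<open>\<psi> (s x)\<close> stay in one closed shell away from 0, on which h is
  integrable; this gives the majorant.\<close>

lemma scaled_pairing_derivative:
  fixes h \<psi> :: "real^'n \<Rightarrow> complex"
  assumes h: "loc_integrable_on (- {0}) h" and \<psi>: "\<psi> \<in> test_functions (- {0})" and t: "t > 0"
  shows "((\<lambda>s. LINT x|lebesgue. h x * dilate \<psi> s x)
    has_vector_derivative (LINT x|lebesgue. h x * dilate' \<psi> t x)) (at t)"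
proof -
  let ?S = "closure {x. \<psi> x \<noteq> 0}"
  note S = test_compact_support[OF \<psi>]
  note d = smooth_differentiable[OF test_smooth[OF \<psi>]]
  obtain R where R: "\<And>y. y \<in> ?S ==> norm y \<le> R"
    using compact_imp_bounded[OF S(1)] bounded_iff by metis
  have "open (- ?S)" "0 \<in> - ?S" using S by auto
  then obtain r0 where r0: "r0 > 0" "ball 0 r0 \<subseteq> - ?S" using open_contains_ball by blast
  have r0': "r0 \<le> norm y" if "y \<in> ?S" for y using r0(2) that by (force simp: subset_iff not_less)
  have E0: "euler_dual \<psi> y = 0" if "y \<notin> ?S" for y
    using that in_closure_support[of \<psi> y] frechet_derivative_off_closure_support[OF that] by (auto simp: euler_dual_def)
  have cE: "continuous_on UNIV (euler_dual \<psi>)" by (rule continuous_euler_dual[OF \<psi>])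
  have "bounded (euler_dual \<psi> ` ?S)"
    using cE S(1) by (intro compact_imp_bounded compact_continuous_image) (auto intro: continuous_on_subset)
  then obtain C where C: "\<And>y. y \<in> ?S ==> norm (euler_dual \<psi> y) \<le> C" unfolding bounded_iff by auto
  \<comment> \<open>Any interval around t with endpoints in the positive reals would serve.\<close>
  define a b where "a = t / 2" and "b = 2 * t"
  have ab: "0 < a" "a < t" "t < b" using t by (auto simp: a_def b_def)
  \<comment> \<open>On the support \<open>r0 \<le> |y| \<le> R\<close>, so \<open>s x\<close> in the
    support forces \<open>r0 / b \<le> |x| \<le> R / a\<close>.\<close>
  define K where "K = cball (0::real^'n) (R / a) - ball 0 (r0 / b)"
  have K: "compact K" "K \<subseteq> - {0}"
  proof -
    show "compact K" unfolding K_def by (intro compact_diff compact_cball open_ball)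
    have "0 \<in> ball (0::real^'n) (r0 / b)" using r0 ab by simp
    then show "K \<subseteq> - {0}" unfolding K_def by blast
  qed
  have inK: "x \<in> K" if "s \<in> {a<..<b}" "s *\<^sub>R x \<in> ?S" for s x
  proof -
    have s: "a < s" "s < b" "0 < s" using that ab by auto
    have "s * norm x \<le> R" "r0 \<le> s * norm x" using R[OF that(2)] r0'[OF that(2)] s by auto
    moreover have "a * norm x \<le> s * norm x" "s * norm x \<le> b * norm x"
      using s by (auto intro: mult_right_mono)
    ultimately have "a * norm x \<le> R" "r0 \<le> b * norm x" by linarith+
    then show ?thesis using ab s by (simp add: K_def field_simps not_less)
  qed
  have hK: "integrable lebesgue (\<lambda>x. indicator K x *\<^sub>R h x)"
    using h K unfolding loc_integrable_on_def set_integrable_def by simp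
  have hm: "h \<in> borel_measurable lebesgue" by (rule loc_integrable_measurable[OF h])
  show ?thesis
  proof (rule has_vector_derivative_lebesgue_integral[where a=a and b=b
        and B="\<lambda>x. (b ^ (CARD('n) - 1) * \<bar>C\<bar>) * norm (indicator K x *\<^sub>R h x)"])
    show "t \<in> {a<..<b}" using ab by simp
    show "integrable lebesgue (\<lambda>x. h x * dilate \<psi> s x)" if "s \<in> {a<..<b}" for s
      using that ab by (intro integrable_mult_test[OF h] test_mult test_scaled \<psi> smooth_const) auto
    show "((\<lambda>s. h x * dilate \<psi> s x) has_vector_derivative
        h x * dilate' \<psi> s x) (at s)" if "s \<in> {a<..<b}" for s x
    proof -
      have "((\<lambda>s. s *\<^sub>R x) has_derivative (\<lambda>h. h *\<^sub>R x)) (at s)" by (auto intro!: derivative_eq_intros)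
      from has_derivative_compose[where g=\<psi>, OF this d[unfolded frechet_derivative_works]]
      have 1: "((\<lambda>s. \<psi> (s *\<^sub>R x)) has_vector_derivative frechet_derivative \<psi> (at (s *\<^sub>R x)) x) (at s)"
        unfolding has_vector_derivative_def using linear_cmul[OF linear_frechet_derivative[OF d]] by simp
      have 2: "((\<lambda>s. complex_of_real (s ^ CARD('n))) has_vector_derivative complex_of_real (CARD('n) * s ^ (CARD('n) - 1))) (at s)"
        using DERIV_pow[of "CARD('n)" s]
        by (intro bounded_linear.has_vector_derivative[OF bounded_linear_of_real])
          (simp add: has_real_derivative_iff_has_vector_derivative)
      have sn: "s ^ CARD('n) = s ^ (CARD('n) - 1) * s"
        by (rule power_minus_mult[symmetric]) simp
      have "frechet_derivative \<psi> (at (s *\<^sub>R x)) (s *\<^sub>R x) = complex_of_real s * frechet_derivative \<psi> (at (s *\<^sub>R x)) x"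
        using linear_cmul[OF linear_frechet_derivative[OF d]] by (simp add: scaleR_conv_of_real)
      then have e: "h x * (complex_of_real (s ^ CARD('n)) * frechet_derivative \<psi> (at (s *\<^sub>R x)) x
            + complex_of_real (CARD('n) * s ^ (CARD('n) - 1)) * \<psi> (s *\<^sub>R x))
          = h x * dilate' \<psi> s x"
        unfolding sn euler_dual_def by (simp add: algebra_simps)
      show ?thesis
        using has_vector_derivative_mult_right[OF has_vector_derivative_mult[OF 2 1], of "h x"] unfolding e .
    qed
    show "(\<lambda>x. h x * dilate' \<psi> t x) \<in> borel_measurable lebesgue"
    proof -
      have "euler_dual \<psi> \<in> borel_measurable lebesgue" using cE by (simp add: borel_measurable_continuous_onI measurable_completion)
      from measurable_compose[OF lebesgue_measurable_scaling this]
      show ?thesis by (intro borel_measurable_times hm borel_measurable_const)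
    qed
    show "integrable lebesgue (\<lambda>x. (b ^ (CARD('n) - 1) * \<bar>C\<bar>) * norm (indicator K x *\<^sub>R h x))"
      using integrable_norm[OF hK] by (rule integrable_mult_right)
    show "norm (h x * dilate' \<psi> s x)
       \<le> (b ^ (CARD('n) - 1) * \<bar>C\<bar>) * norm (indicator K x *\<^sub>R h x)" if s: "s \<in> {a<..<b}" for s x
    proof (cases "s *\<^sub>R x \<in> ?S")
      case True
      have "norm (dilate' \<psi> s x) \<le> b ^ (CARD('n) - 1) * \<bar>C\<bar>"
        unfolding norm_mult using s ab C[OF True] by (intro mult_mono) (auto simp: norm_power intro!: power_mono)
      then have "norm (h x) * norm (dilate' \<psi> s x) \<le> norm (h x) * (b ^ (CARD('n) - 1) * \<bar>C\<bar>)"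
        by (rule mult_left_mono) simp
      then show ?thesis using inK[OF s True] by (simp add: norm_mult mult_ac)
    next
      case False
      then show ?thesis using E0 ab by simp
    qed
  qed
qed

lemma loc_integrable_scaled:
  fixes h :: "real^'n \<Rightarrow> complex"
  assumes h: "loc_integrable_on (- {0}) h" and t: "t > 0"
  shows "loc_integrable_on (- {0}) (\<lambda>x. h (t *\<^sub>R x))"
  unfolding loc_integrable_on_def
proof (intro allI impI)
  fix K :: "(real^'n) set" assume K: "compact K \<and> K \<subseteq> - {0}"
  let ?K = "(*\<^sub>R) t ` K"
  have "compact ?K" "?K \<subseteq> - {0}" using K t by (auto intro: compact_scaling)
  then have "integrable lebesgue (\<lambda>x. indicator ?K x *\<^sub>R h x)"
    using h unfolding loc_integrable_on_def set_integrable_def by simp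
  from integrable_lebesgue_scale[OF t this]
  have "integrable lebesgue (\<lambda>x. indicator ?K (t *\<^sub>R x) *\<^sub>R h (t *\<^sub>R x))" .
  moreover have "indicator ?K (t *\<^sub>R x) = (indicator K x :: real)" for x
    using t by (auto simp: indicator_def)
  ultimately show "set_integrable lebesgue K (\<lambda>x. h (t *\<^sub>R x))" unfolding set_integrable_def by simp
qed

lemma scaled_pairing:
  fixes h \<psi> :: "real^'n \<Rightarrow> complex"
  assumes h: "loc_integrable_on (- {0}) h" and \<psi>: "\<psi> \<in> test_functions (- {0})" and s: "s > 0"
  shows "(LINT x|lebesgue. h x * dilate \<psi> s x) = (LINT x|lebesgue. h ((1 / s) *\<^sub>R x) * \<psi> x)"
proof -
  have "\<psi> \<in> borel_measurable lebesgue" using test_borel[OF \<psi>] by (simp add: measurable_completion)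
  then have "(\<lambda>x. h ((1 / s) *\<^sub>R x) * \<psi> x) \<in> borel_measurable lebesgue"
    by (intro borel_measurable_times measurable_compose[OF lebesgue_measurable_scaling loc_integrable_measurable[OF h]])
  from integral_lebesgue_scale[OF s this]
  have "(LINT x|lebesgue. h ((1 / s) *\<^sub>R x) * \<psi> x) = s ^ CARD('n) *\<^sub>R (LINT x|lebesgue. h x * \<psi> (s *\<^sub>R x))"
    using s by simp
  also have "\<dots> = (LINT x|lebesgue. s ^ CARD('n) *\<^sub>R (h x * \<psi> (s *\<^sub>R x)))" by simp
  finally show ?thesis by (simp add: scaleR_conv_of_real mult_ac)
qed

lemma homogeneous_iff_euler_dual:
  fixes h :: "real^'n \<Rightarrow> complex"
  assumes h: "loc_integrable_on (- {0}) h"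
  shows "(\<forall>\<psi>\<in>test_functions (- {0}). (LINT x|lebesgue. h x * euler_dual \<psi> x) = 0)
    \<longleftrightarrow> (\<forall>t>0. AE x in lebesgue. h (t *\<^sub>R x) = h x)"
proof
  assume L: "\<forall>\<psi>\<in>test_functions (- {0}). (LINT x|lebesgue. h x * euler_dual \<psi> x) = 0"
  show "\<forall>t>0. AE x in lebesgue. h (t *\<^sub>R x) = h x"
  proof (intro allI impI)
    fix t :: real assume t: "t > 0"
    have "AE x in lebesgue. x \<in> - {0} \<longrightarrow> h (t *\<^sub>R x) - h x = 0"
    proof (rule fundamental_lemma)
      show "loc_integrable_on (- {0}) (\<lambda>x. h (t *\<^sub>R x) - h x)"
        by (intro loc_integrable_diff loc_integrable_scaled h t)
      fix \<psi> :: "real^'n \<Rightarrow> complex" assume \<psi>: "\<psi> \<in> test_functions (- {0})"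
      define J where "J s = (LINT x|lebesgue. h x * dilate \<psi> s x)" for s
      have "(J has_vector_derivative 0) (at s within {0<..})" if s: "s \<in> {0<..}" for s
      proof -
        have s0: "s > 0" using s by simp
        \<comment> \<open>The dual Euler operator commutes with dilations, so the hypothesis can be
          used for the test function \<open>\<psi> (s x)\<close> at every s.\<close>
        have e: "euler_dual \<psi> (s *\<^sub>R x) = euler_dual (\<lambda>x. \<psi> (s *\<^sub>R x)) x" for x
          unfolding euler_dual_def frechet_derivative_scaled[OF smooth_differentiable[OF test_smooth[OF \<psi>]]]
          using linear_cmul[OF linear_frechet_derivative[OF smooth_differentiable[OF test_smooth[OF \<psi>]]], of "s *\<^sub>R x" s x]
          by (simp add: scaleR_conv_of_real)
        have "(LINT x|lebesgue. h x * dilate' \<psi> s x)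
           = complex_of_real (s ^ (CARD('n) - 1)) * (LINT x|lebesgue. h x * euler_dual (\<lambda>x. \<psi> (s *\<^sub>R x)) x)"
          unfolding e by (subst integral_mult_right_zero[symmetric]) (simp add: mult_ac)
        also have "\<dots> = 0" using L test_scaled[OF \<psi>, of s] s0 by simp
        finally show ?thesis
          using scaled_pairing_derivative[OF h \<psi> s0] unfolding J_def
          by (simp add: has_vector_derivative_at_within)
      qed
      then obtain c where c: "\<And>s. s \<in> {0<..} ==> J s = c"
        using has_vector_derivative_zero_constant[of "{0<..}" J] by (metis convex_real_interval(3))
      \<comment> \<open>The parameter is 1 / t because dilating \<psi> by s evaluates h at
        \<open>x / s\<close>.\<close>
      have "J (1 / t) = J 1" using c[of "1 / t"] c[of 1] t by simp
      then have eq: "(LINT x|lebesgue. h (t *\<^sub>R x) * \<psi> x) = (LINT x|lebesgue. h x * \<psi> x)"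
        unfolding J_def using scaled_pairing[OF h \<psi>, of "1 / t"] t by simp
      then show "(LINT x|lebesgue. (h (t *\<^sub>R x) - h x) * \<psi> x) = 0"
        using integrable_mult_test[OF loc_integrable_scaled[OF h t] \<psi>] integrable_mult_test[OF h \<psi>]
        by (simp add: left_diff_distrib)
    qed (simp add: open_Compl)
    then show "AE x in lebesgue. h (t *\<^sub>R x) = h x"
      using AE_nonzero by eventually_elim simp
  qed
next
  assume R: "\<forall>t>0. AE x in lebesgue. h (t *\<^sub>R x) = h x"
  show "\<forall>\<psi>\<in>test_functions (- {0}). (LINT x|lebesgue. h x * euler_dual \<psi> x) = 0"
  proof
    fix \<psi> :: "real^'n \<Rightarrow> complex" assume \<psi>: "\<psi> \<in> test_functions (- {0})"
    define J where "J s = (LINT x|lebesgue. h x * dilate \<psi> s x)" for s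
    have hm: "h \<in> borel_measurable lebesgue" by (rule loc_integrable_measurable[OF h])
    have \<psi>m: "\<psi> \<in> borel_measurable lebesgue" using test_borel[OF \<psi>] by (simp add: measurable_completion)
    have J: "J s = (LINT x|lebesgue. h x * \<psi> x)" if s: "s > 0" for s
    proof -
      have "J s = (LINT x|lebesgue. h ((1 / s) *\<^sub>R x) * \<psi> x)" unfolding J_def by (rule scaled_pairing[OF h \<psi> s])
      also have "\<dots> = (LINT x|lebesgue. h x * \<psi> x)"
      proof (rule integral_cong_AE)
        have "AE x in lebesgue. h ((1 / s) *\<^sub>R x) = h x" using R s by simp
        then show "AE x in lebesgue. h ((1 / s) *\<^sub>R x) * \<psi> x = h x * \<psi> x" by eventually_elim simp
      qed (intro borel_measurable_times measurable_compose[OF lebesgue_measurable_scaling hm] hm \<psi>m)+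
      finally show ?thesis .
    qed
    \<comment> \<open>J is constant on the positive reals, so its derivative at 1, the pairing with
      \<open>euler_dual \<psi>\<close>, vanishes.\<close>
    have "((\<lambda>s::real. LINT x|lebesgue. h x * \<psi> x) has_vector_derivative 0) (at 1)" by simp
    then have "(J has_vector_derivative 0) (at 1)"
      by (rule has_vector_derivative_transform_within_open[of _ _ _ "{0<..}"]) (auto simp: J)
    moreover have "(J has_vector_derivative (LINT x|lebesgue. h x * euler_dual \<psi> x)) (at 1)"
      using scaled_pairing_derivative[OF h \<psi> zero_less_one] unfolding J_def by simp
    ultimately show "(LINT x|lebesgue. h x * euler_dual \<psi> x) = 0" by (metis vector_derivative_unique_at)
  qed
qed

section \<open>Functions annihilated by the remainder\<close>

text \<open>By the fundamental lemma the pointwise equation is the same as vanishing of all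
  pairings, and duality moves the operator onto the test function, where the dilation argument
  applies.\<close>

lemma euler_zero_iff_homogeneous:
  fixes h :: "real^'n \<Rightarrow> complex"
  assumes h: "weakly_differentiable h"
  shows "(AE x in lebesgue. euler h x = 0) \<longleftrightarrow> (\<forall>t>0. AE x in lebesgue. h (t *\<^sub>R x) = h x)"
proof -
  note l = weakly_differentiable_loc_integrable(1)[OF h] and le = euler_loc_integrable[OF h]
  have dual: "(LINT x|lebesgue. h x * euler_dual \<psi> x) = - (LINT x|lebesgue. euler h x * \<psi> x)"
    if "\<psi> \<in> test_functions (- {0})" for \<psi>
    using integral_euler[OF h that] by (simp add: euler_dual_def)
  have "(AE x in lebesgue. euler h x = 0) \<longleftrightarrow> (\<forall>\<psi>\<in>test_functions (- {0}). (LINT x|lebesgue. euler h x * \<psi> x) = 0)"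
  proof
    assume z: "AE x in lebesgue. euler h x = 0"
    have "(LINT x|lebesgue. euler h x * \<psi> x) = 0" for \<psi>
    proof (rule integral_eq_zero_AE)
      show "AE x in lebesgue. euler h x * \<psi> x = 0" using z by eventually_elim simp
    qed
    then show "\<forall>\<psi>\<in>test_functions (- {0}). (LINT x|lebesgue. euler h x * \<psi> x) = 0" by blast
  next
    assume z: "\<forall>\<psi>\<in>test_functions (- {0}). (LINT x|lebesgue. euler h x * \<psi> x) = 0"
    have "AE x in lebesgue. x \<in> - {0} \<longrightarrow> euler h x = 0"
      by (rule fundamental_lemma[OF _ le]) (use z in "simp_all add: open_Compl")
    then show "AE x in lebesgue. euler h x = 0"
      using AE_nonzero by eventually_elim simp
  qed
  also have "\<dots> \<longleftrightarrow> (\<forall>\<psi>\<in>test_functions (- {0}). (LINT x|lebesgue. h x * euler_dual \<psi> x) = 0)"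
    by (intro ball_cong refl) (simp add: dual)
  also have "\<dots> \<longleftrightarrow> (\<forall>t>0. AE x in lebesgue. h (t *\<^sub>R x) = h x)"
    by (rule homogeneous_iff_euler_dual[OF l])
  finally show ?thesis .
qed

text \<open>Supplies the measurable representatives needed for Fubini's theorem and for the
  completed surface measure; the real-valued result is applied to real and imaginary parts.\<close>

lemma lebesgue_ex_borel:
  fixes h :: "'a \<Rightarrow> complex"
  assumes "h \<in> borel_measurable (completion M)"
  obtains h' where "h' \<in> borel_measurable M" "AE x in M. h x = h' x"
proof -
  have "(\<lambda>x. Re (h x)) \<in> borel_measurable (completion M)" "(\<lambda>x. Im (h x)) \<in> borel_measurable (completion M)"
    using assms by (auto simp: borel_measurable_complex_iff)
  from this[THEN completion_ex_borel_measurable_real]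
  obtain p q where p: "p \<in> borel_measurable M" "AE x in M. Re (h x) = p x"
    and q: "q \<in> borel_measurable M" "AE x in M. Im (h x) = q x" by blast
  have "(\<lambda>x. Complex (p x) (q x)) \<in> borel_measurable M"
    using p(1) q(1) by (simp add: borel_measurable_complex_iff)
  moreover have "AE x in M. h x = Complex (p x) (q x)"
    using p(2) q(2) by eventually_elim (simp add: complex_eq_iff)
  ultimately show thesis by (rule that)
qed

lemma homogeneous_ex_profile:
  fixes h :: "real^'n \<Rightarrow> complex"
  assumes hm: "h \<in> borel_measurable lebesgue"
    and hom: "\<And>t. t > 0 ==> AE x in lebesgue. h (t *\<^sub>R x) = h x"
  obtains \<phi> where "\<phi> \<in> borel_measurable borel" "AE x in lebesgue. h x = \<phi> (x /\<^sub>R norm x)"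
proof -
  obtain h' where h': "h' \<in> borel_measurable lborel" and e: "AE x in lborel. h x = h' x"
    using lebesgue_ex_borel[OF hm] by metis
  have [measurable]: "h' \<in> borel_measurable borel" using h' by simp
  have e': "AE x in lebesgue. h x = h' x" using e by (rule AE_completion)
  \<comment> \<open>The guard \<open>t > 0\<close> lets t range over the whole line with Lebesgue
    measure.\<close>
  have "AE x in lborel. t > 0 \<longrightarrow> h' (t *\<^sub>R x) = h' x" for t
  proof (cases "t > 0")
    case True
    have "AE x in lebesgue. h' (t *\<^sub>R x) = h' x"
      using hom[OF True] e' AE_lebesgue_scale[OF True e'] by eventually_elim simp
    then show ?thesis by (simp add: AE_completion_iff True)
  qed simp
  then have "AE t in lborel. AE x in lborel. t > 0 \<longrightarrow> h' (t *\<^sub>R x) = h' x" by simp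
  \<comment> \<open>The null set in x depends on t. Fubini exchanges the two quantifiers: for almost
    every x, h' equals \<open>h' x\<close> at almost every point of the ray through x.\<close>
  then have ae: "AE x in lborel. AE t in lborel. t > 0 \<longrightarrow> h' (t *\<^sub>R x) = h' x"
  proof (subst (asm) pair_sigma_finite.AE_commute)
    show "pair_sigma_finite (lborel :: real measure) (lborel :: (real^'n) measure)" ..
    show "{x \<in> space (lborel \<Otimes>\<^sub>M lborel). fst x > 0 \<longrightarrow> h' (fst x *\<^sub>R snd x) = h' (snd x)} \<in> sets ((lborel :: real measure) \<Otimes>\<^sub>M (lborel :: (real^'n) measure))"
      by measurable
  qed
  \<comment> \<open>The average of h' along a ray. The interval has length 1, so an almost
    everywhere constant function is reproduced; on exceptional rays the value does not
    matter.\<close>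
  define \<phi> where "\<phi> \<omega> = (LINT s|lborel. indicator {0<..1::real} s *\<^sub>R h' (s *\<^sub>R \<omega>))" for \<omega>
  have \<phi>m: "\<phi> \<in> borel_measurable borel"
    unfolding \<phi>_def by measurable
  have "AE x in lborel. h' x = \<phi> (x /\<^sub>R norm x)"
    using ae AE_lborel_singleton[of "0::real^'n"]
  proof eventually_elim
    case (elim x)
    \<comment> \<open>The substitution \<open>t = s / |x|\<close> turns constancy along x into
      constancy along its direction.\<close>
    define r where "r = 1 / norm x"
    have r: "r > 0" using elim(2) by (simp add: r_def)
    have "AE t in lebesgue. t > 0 \<longrightarrow> h' (t *\<^sub>R x) = h' x" using elim(1) by (rule AE_completion)
    from AE_lebesgue_scale[OF r this]
    have "AE s in lebesgue. s > 0 \<longrightarrow> h' (s *\<^sub>R (x /\<^sub>R norm x)) = h' x"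
    proof eventually_elim
      case (elim s)
      have "s *\<^sub>R (x /\<^sub>R norm x) = (r *\<^sub>R s) *\<^sub>R x" by (simp add: r_def divide_inverse mult.commute)
      moreover have "s > 0 ==> r *\<^sub>R s > 0" using r by simp
      ultimately show ?case using elim by metis
    qed
    then have *: "AE s in lborel. s > 0 \<longrightarrow> h' (s *\<^sub>R (x /\<^sub>R norm x)) = h' x" by (simp only: AE_completion_iff)
    have "\<phi> (x /\<^sub>R norm x) = (LINT s|lborel. indicator {0<..1::real} s *\<^sub>R h' x)"
      unfolding \<phi>_def
    proof (rule integral_cong_AE)
      show "AE s in lborel. indicator {0<..1::real} s *\<^sub>R h' (s *\<^sub>R (x /\<^sub>R norm x)) = indicator {0<..1} s *\<^sub>R h' x"
        using * by eventually_elim (simp add: indicator_def)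
    qed measurable
    then show ?case by simp
  qed
  from AE_completion[OF this] e' have "AE x in lebesgue. h x = \<phi> (x /\<^sub>R norm x)"
    by eventually_elim simp
  with \<phi>m show thesis by (rule that)
qed

lemma direction_scale:
  assumes "t > 0"
  shows "(t *\<^sub>R x) /\<^sub>R norm (t *\<^sub>R x) = x /\<^sub>R norm x"
proof -
  have "inverse (norm (t *\<^sub>R x)) * t = inverse (norm x)"
    using assms by (cases "x = 0") (auto simp: field_simps)
  then show ?thesis by (simp only: scaleR_scaleR)
qed

lemma profile_homogeneous:
  fixes h :: "real^'n \<Rightarrow> complex"
  assumes e: "AE x in lebesgue. h x = \<phi> (x /\<^sub>R norm x)" and t: "t > 0"
  shows "AE x in lebesgue. h (t *\<^sub>R x) = h x"
  using e AE_lebesgue_scale[OF t e]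
proof eventually_elim
  case (elim x)
  then show ?case by (simp only: direction_scale[OF t])
qed

lemma borel_measurable_surface:
  fixes \<phi> :: "real^'b \<Rightarrow> complex"
  shows "\<phi> \<in> borel_measurable borel ==> \<phi> \<in> borel_measurable surface_measure"
  unfolding surface_measure_def
proof (intro measurable_completion)
  assume "\<phi> \<in> borel_measurable borel"
  then have "\<phi> \<in> borel_measurable (restrict_space borel (sphere 0 1))" by (rule measurable_restrict_space1)
  then show "\<phi> \<in> borel_measurable (scale_measure (of_nat CARD('b))
     (distr (restrict_space lborel (ball 0 1 - {0})) (restrict_space borel (sphere 0 1)) (\<lambda>x. x /\<^sub>R norm x)))"
    by (subst measurable_cong_sets[OF sets_scale_measure refl], subst measurable_cong_sets[OF sets_distr refl])
qed

text \<open>Multiplication by \<open>|x|^c\<close>, invertible off the origin, turns the profile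
  condition into dependence on the direction alone.\<close>

lemma has_angular_profile_iff:
  "has_angular_profile f \<phi> \<longleftrightarrow> \<phi> \<in> borel_measurable surface_measure \<and>
    (AE x in lebesgue. complex_of_real (norm x powr ((real CARD('n) - 2) / 2)) * f x = \<phi> (x /\<^sub>R norm x))"
  for f :: "real^'n \<Rightarrow> complex"
proof -
  let ?a = "(real CARD('n) - 2) / 2"
  have "(f x = npow x (- ?a) * w) \<longleftrightarrow> (npow x ?a * f x = w)" if "x \<noteq> 0" for x w
  proof -
    have 1: "npow x ?a * npow x (- ?a) = 1"
      using that by (simp flip: of_real_mult powr_add)
    have "(z = B * w) = (A * z = w)" if "A * B = 1" for A B z :: complex
      using that by (auto simp: mult.assoc[symmetric] mult.commute[of B A])
    from this[OF 1] show ?thesis .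
  qed
  note e = this
  have "(AE x in lebesgue. f x = npow x (- ?a) * \<phi> (x /\<^sub>R norm x)) \<longleftrightarrow>
    (AE x in lebesgue. npow x ?a * f x = \<phi> (x /\<^sub>R norm x))"
  proof
    assume "AE x in lebesgue. f x = npow x (- ?a) * \<phi> (x /\<^sub>R norm x)"
    then show "AE x in lebesgue. npow x ?a * f x = \<phi> (x /\<^sub>R norm x)"
      using AE_nonzero
    proof eventually_elim
      case (elim x) then show ?case by (intro e[THEN iffD1])
    qed
  next
    assume "AE x in lebesgue. npow x ?a * f x = \<phi> (x /\<^sub>R norm x)"
    then show "AE x in lebesgue. f x = npow x (- ?a) * \<phi> (x /\<^sub>R norm x)"
      using AE_nonzero
    proof eventually_elim
      case (elim x) then show ?case by (intro e[THEN iffD2])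
    qed
  qed
  then show ?thesis unfolding has_angular_profile_def by simp
qed

lemma ex_angular_profile_iff:
  fixes f :: "real^'n \<Rightarrow> complex"
  assumes f: "weakly_differentiable f"
  defines "h \<equiv> \<lambda>x. complex_of_real (norm x powr ((real CARD('n) - 2) / 2)) * f x"
  shows "(\<exists>\<phi>. has_angular_profile f \<phi>) \<longleftrightarrow> (AE x in lebesgue. euler h x = 0)"
proof -
  have h: "weakly_differentiable h" unfolding h_def by (rule weakly_differentiable_powr_mult[OF f])
  have hm: "h \<in> borel_measurable lebesgue"
    by (rule loc_integrable_measurable[OF weakly_differentiable_loc_integrable(1)[OF h]])
  show ?thesis unfolding euler_zero_iff_homogeneous[OF h]
  proof
    assume "\<exists>\<phi>. has_angular_profile f \<phi>"
    then obtain \<phi> where "AE x in lebesgue. h x = \<phi> (x /\<^sub>R norm x)"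
      unfolding has_angular_profile_iff h_def by blast
    then show "\<forall>t>0. AE x in lebesgue. h (t *\<^sub>R x) = h x"
      using profile_homogeneous by blast
  next
    assume "\<forall>t>0. AE x in lebesgue. h (t *\<^sub>R x) = h x"
    then obtain \<phi> where "\<phi> \<in> borel_measurable borel" "AE x in lebesgue. h x = \<phi> (x /\<^sub>R norm x)"
      using homogeneous_ex_profile[OF hm] by blast
    then show "\<exists>\<phi>. has_angular_profile f \<phi>"
      unfolding has_angular_profile_iff h_def using borel_measurable_surface by blast
  qed
qed

lemma L2norm_cong_AE:
  assumes "AE x in lebesgue. f x = g x"
  shows "L2norm f = L2norm g"
proof -
  have "(nn_sq lebesgue (\<lambda>x. f x)) = (nn_sq lebesgue (\<lambda>x. g x))"
  proof (rule nn_integral_cong_AE)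
    show "AE x in lebesgue. ennreal ((norm (f x))^2) = ennreal ((norm (g x))^2)"
      using assms by eventually_elim simp
  qed
  then show ?thesis by (simp only: L2norm_def)
qed

lemma L2norm_eq_0_iff:
  fixes g :: "real^'n \<Rightarrow> complex"
  assumes "g \<in> borel_measurable lebesgue"
  shows "L2norm g = 0 \<longleftrightarrow> (AE x in lebesgue. g x = 0)"
proof -
  define I where "I = (nn_sq lebesgue (\<lambda>x. g x))"
  have "L2norm g = 0 \<longleftrightarrow> I = 0"
    unfolding L2norm_def I_def[symmetric] Let_def by (auto simp: enn2real_eq_0_iff)
  also have "\<dots> \<longleftrightarrow> (AE x in lebesgue. ennreal ((norm (g x))^2) = 0)"
    unfolding I_def using assms by (intro nn_integral_0_iff_AE) measurable
  finally show ?thesis by simp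
qed

text \<open>\<open>remainder2\<close> is the Euler derivative of \<open>|x|^c f\<close> times a
  power of |x| that does not vanish off the origin; \<open>remainder1\<close> agrees with it almost
  everywhere.\<close>

lemma remainder_zero_iff:
  fixes f :: "real^'n \<Rightarrow> complex"
  assumes f: "weakly_differentiable f"
  shows "L2norm (remainder1 f) = 0 \<longleftrightarrow> (\<exists>\<phi>. has_angular_profile f \<phi>)"
    "L2norm (remainder2 f) = 0 \<longleftrightarrow> (\<exists>\<phi>. has_angular_profile f \<phi>)"
proof -
  let ?a = "(real CARD('n) - 2) / 2"
  define h where "h = (\<lambda>x. npow x ?a * f x)"
  have h: "weakly_differentiable h" unfolding h_def by (rule weakly_differentiable_powr_mult[OF f])
  have em: "euler h \<in> borel_measurable lebesgue" by (rule loc_integrable_measurable[OF euler_loc_integrable[OF h]])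
  have r2: "remainder2 f x = npow x (- ?a) * (euler h x / cnorm x)" for x
    by (simp add: remainder2_def radial_deriv_euler h_def)
  have m: "(\<lambda>x::real^'n. npow x (- ?a)) \<in> borel_measurable lebesgue" "(\<lambda>x::real^'n. cnorm x) \<in> borel_measurable lebesgue"
    by (intro measurable_completion; measurable)+
  have "remainder2 f \<in> borel_measurable lebesgue"
    unfolding r2[abs_def] by (intro borel_measurable_times borel_measurable_divide m em)
  then have "L2norm (remainder2 f) = 0 \<longleftrightarrow> (AE x in lebesgue. remainder2 f x = 0)" by (rule L2norm_eq_0_iff)
  also have "\<dots> \<longleftrightarrow> (AE x in lebesgue. euler h x = 0)"
  proof
    assume "AE x in lebesgue. remainder2 f x = 0"
    then show "AE x in lebesgue. euler h x = 0" unfolding r2 using AE_nonzero by eventually_elim simp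
  next
    assume "AE x in lebesgue. euler h x = 0"
    then show "AE x in lebesgue. remainder2 f x = 0" unfolding r2 by eventually_elim simp
  qed
  also have "\<dots> \<longleftrightarrow> (\<exists>\<phi>. has_angular_profile f \<phi>)"
    unfolding ex_angular_profile_iff[OF f] h_def ..
  finally show 2: "L2norm (remainder2 f) = 0 \<longleftrightarrow> (\<exists>\<phi>. has_angular_profile f \<phi>)" .
  show "L2norm (remainder1 f) = 0 \<longleftrightarrow> (\<exists>\<phi>. has_angular_profile f \<phi>)"
    unfolding 2[symmetric] L2norm_cong_AE[OF remainder2_eq_remainder1[OF f]] ..
qed

lemma homogeneous_not_integrable:
  fixes P :: "real^'n \<Rightarrow> real"
  assumes Pm: "P \<in> borel_measurable borel" and P0: "\<And>x. P x \<ge> 0"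
    and hom: "\<And>t x. t > 0 ==> P (t *\<^sub>R x) = P x"
    and fin: "(\<integral>\<^sup>+x. ennreal (P x / norm x ^ CARD('n)) \<partial>lebesgue) < \<infinity>"
  shows "AE x in lebesgue. x \<in> ball 0 1 \<longrightarrow> P x = 0"
proof -
  define g where "g x = ennreal (P x / norm x ^ CARD('n))" for x
  have gm0: "g \<in> borel_measurable borel" unfolding g_def using Pm by measurable
  have gm: "(\<lambda>x. g x * indicator (ball 0 R) x) \<in> borel_measurable lebesgue" for R
    by (intro measurable_completion borel_measurable_times_ennreal borel_measurable_indicator) (use gm0 in auto)
  have scale: "(\<integral>\<^sup>+x. g x * indicator (ball 0 R) x \<partial>lebesgue) = (\<integral>\<^sup>+x. g x * indicator (ball 0 1) x \<partial>lebesgue)" if R: "R > 0" for R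
  proof -
    have "(\<integral>\<^sup>+x. g x * indicator (ball 0 R) x \<partial>lebesgue)
      = ennreal (R ^ CARD('n)) * (\<integral>\<^sup>+x. g (R *\<^sub>R x) * indicator (ball 0 R) (R *\<^sub>R x) \<partial>lebesgue)"
      using nn_integral_lebesgue_scale[OF R gm] by simp
    also have "\<dots> = (\<integral>\<^sup>+x. ennreal (R ^ CARD('n)) * (g (R *\<^sub>R x) * indicator (ball 0 R) (R *\<^sub>R x)) \<partial>lebesgue)"
      by (intro nn_integral_cmult[symmetric] measurable_compose[OF lebesgue_measurable_scaling gm])
    also have "\<dots> = (\<integral>\<^sup>+x. g x * indicator (ball 0 1) x \<partial>lebesgue)"
    proof (intro nn_integral_cong)
      fix x :: "real^'n"
      \<comment> \<open>The density is homogeneous of degree -n and cancels the Jacobian.\<close>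
      have "ennreal (R ^ CARD('n)) * g (R *\<^sub>R x) = g x"
        unfolding g_def hom[OF R] using R P0[of x]
        by (subst ennreal_mult[symmetric]) (auto simp: power_mult_distrib)
      moreover have "indicator (ball 0 R) (R *\<^sub>R x) = (indicator (ball 0 1) x :: ennreal)"
        using R by (simp add: indicator_def)
      ultimately show "ennreal (R ^ CARD('n)) * (g (R *\<^sub>R x) * indicator (ball 0 R) (R *\<^sub>R x)) = g x * indicator (ball 0 1) x"
        by (simp add: mult.assoc[symmetric])
    qed
    finally show ?thesis .
  qed
  have inverse_Suc_pos: "inverse (real (Suc k)) > 0" for k by simp
  \<comment> \<open>Over shrinking balls the integrals tend to 0, with g itself as majorant of
    finite integral, yet all of them equal the integral over the unit ball.\<close>
  have "(\<lambda>k. \<integral>\<^sup>+x. g x * indicator (ball 0 (inverse (real (Suc k)))) x \<partial>lebesgue) \<longlonglongrightarrow> (\<integral>\<^sup>+x. 0 \<partial>(lebesgue :: (real^'n) measure))"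
  proof (rule nn_integral_dominated_convergence[where w=g])
    show "AE x in lebesgue. (\<lambda>k. g x * indicator (ball 0 (inverse (real (Suc k)))) x) \<longlonglongrightarrow> 0"
      using AE_nonzero
    proof eventually_elim
      case (elim x)
      have "\<forall>\<^sub>F k in sequentially. inverse (real (Suc k)) < norm x"
        using order_tendstoD(2)[OF LIMSEQ_inverse_real_of_nat, of "norm x"] elim by simp
      then have "\<forall>\<^sub>F k in sequentially. g x * indicator (ball 0 (inverse (real (Suc k)))) x = 0"
        by eventually_elim simp
      then show ?case by (rule tendsto_eventually)
    qed
    show "g \<in> borel_measurable lebesgue" using gm0 by (intro measurable_completion) simp
    show "(\<integral>\<^sup>+x. g x \<partial>lebesgue) < \<infinity>" using fin unfolding g_def .
    show "AE x in lebesgue. g x * indicator (ball 0 (inverse (real (Suc k)))) x \<le> g x" for k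
      by (intro AE_I2) (simp add: indicator_def)
  qed (use gm in auto)
  then have "(\<integral>\<^sup>+x. g x * indicator (ball 0 1) x \<partial>lebesgue) = 0"
    unfolding scale[OF inverse_Suc_pos] by (simp only: LIMSEQ_const_iff nn_integral_const mult_zero_left)
  then have "AE x in lebesgue. g x * indicator (ball 0 1) x = 0"
    using nn_integral_0_iff_AE[OF gm] by simp
  then show ?thesis
    using AE_nonzero
  proof eventually_elim
    case (elim x)
    show ?case
    proof
      assume "x \<in> ball 0 1"
      then have "P x / norm x ^ CARD('n) \<le> 0" using elim(1) by (simp add: g_def ennreal_eq_0_iff)
      then show "P x = 0" using elim(2) P0[of x] zero_less_power[of "norm x" "CARD('n)"]
        by (auto simp: divide_le_0_iff simp del: zero_less_power)
    qed
  qed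
qed

section \<open>Cones over the sphere\<close>

lemma AE_scale_measureD:
  assumes "AE x in scale_measure r M. P x" "r \<noteq> 0"
  shows "AE x in M. P x"
proof -
  obtain N where N: "N \<in> null_sets (scale_measure r M)" "{x \<in> space M. \<not> P x} \<subseteq> N"
    using assms(1) by (auto simp: eventually_ae_filter space_scale_measure)
  then have "N \<in> null_sets M" using assms(2) by (auto simp: null_sets_def)
  with N(2) show ?thesis by (rule AE_I'[rotated])
qed

lemma direction_measurable:
  "(\<lambda>x::real^'n. x /\<^sub>R norm x) \<in> measurable (restrict_space lborel (ball 0 1 - {0})) (restrict_space borel (sphere 0 1))"
proof (rule measurable_restrict_space2)
  have "(\<lambda>x::real^'n. x /\<^sub>R norm x) \<in> borel_measurable lborel" by measurable
  then show "(\<lambda>x::real^'n. x /\<^sub>R norm x) \<in> borel_measurable (restrict_space lborel (ball 0 1 - {0}))"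
    by (rule measurable_restrict_space1)
qed (auto simp: space_restrict_space)

lemma ball_diff_sets: "(ball 0 1 - {0::real^'n}) \<inter> space lborel \<in> sets lborel" by simp

text \<open>\<open>surface_measure\<close> is n times the image of Lebesgue measure on the punctured
  unit ball under the direction map, which accounts for the factor and the domain.\<close>

lemma nn_integral_surface:
  fixes F :: "real^'n \<Rightarrow> ennreal"
  assumes "F \<in> borel_measurable borel"
  shows "(\<integral>\<^sup>+\<omega>. F \<omega> \<partial>surface_measure)
    = of_nat CARD('n) * (\<integral>\<^sup>+x. F (x /\<^sub>R norm x) * indicator (ball 0 1 - {0}) x \<partial>lebesgue)"
proof -
  have m: "F \<in> borel_measurable (restrict_space borel (sphere 0 1))" using assms by (rule measurable_restrict_space1)
  then have m': "F \<in> borel_measurable (distr (restrict_space lborel (ball 0 1 - {0})) (restrict_space borel (sphere 0 1)) (\<lambda>x. x /\<^sub>R norm x))"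
    by (subst measurable_cong_sets[OF sets_distr refl])
  show ?thesis
    unfolding surface_measure_def nn_integral_completion nn_integral_scale_measure[OF m']
      nn_integral_distr[OF direction_measurable m'] nn_integral_restrict_space[OF ball_diff_sets] ..
qed

text \<open>A null set of directions has a null cone in the unit ball, by the definition of the
  image measure. Dilations carry this to balls of every integer radius, and these exhaust the
  space.\<close>

lemma AE_surface_cone:
  assumes "AE \<omega> in (surface_measure :: (real^'n) measure). Q \<omega>"
  shows "AE x in lebesgue. Q (x /\<^sub>R norm x)"
proof -
  have "AE \<omega> in scale_measure (of_nat CARD('n)) (distr (restrict_space lborel (ball 0 1 - {0}))
     (restrict_space borel (sphere 0 1)) (\<lambda>x::real^'n. x /\<^sub>R norm x)). Q \<omega>"
    using assms unfolding surface_measure_def AE_completion_iff .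
  then have "AE \<omega> in distr (restrict_space lborel (ball 0 1 - {0}))
     (restrict_space borel (sphere 0 1)) (\<lambda>x::real^'n. x /\<^sub>R norm x). Q \<omega>"
    by (rule AE_scale_measureD) simp
  then have "AE x in restrict_space lborel (ball 0 1 - {0::real^'n}). Q (x /\<^sub>R norm x)"
    by (rule AE_distrD[OF direction_measurable])
  then have "AE x in lborel. x \<in> ball 0 1 - {0::real^'n} \<longrightarrow> Q (x /\<^sub>R norm x)"
    by (subst (asm) AE_restrict_space_iff[OF ball_diff_sets])
  then have B: "AE x in lebesgue. x \<in> ball 0 1 - {0::real^'n} \<longrightarrow> Q (x /\<^sub>R norm x)" by (rule AE_completion)
  have "AE x in lebesgue. \<forall>k. x \<in> ball 0 (real (Suc k)) - {0} \<longrightarrow> Q (x /\<^sub>R norm x)"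
  proof (subst AE_all_countable, rule allI)
    fix k
    have t: "1 / real (Suc k) > 0" by simp
    show "AE x in lebesgue. x \<in> ball 0 (real (Suc k)) - {0} \<longrightarrow> Q (x /\<^sub>R norm x)"
      using AE_lebesgue_scale[OF t B]
    proof eventually_elim
      case (elim x)
      define s where "s = 1 / real (Suc k)"
      have s: "s > 0" "s * real (Suc k) = 1" by (auto simp: s_def)
      show ?case
      proof
        assume x: "x \<in> ball 0 (real (Suc k)) - {0}"
        then have "s * norm x < s * real (Suc k)" using s(1) by (intro mult_strict_left_mono) auto
        then have "norm (s *\<^sub>R x) < 1" using s(1) by (simp only: s(2) norm_scaleR abs_of_pos)
        then have "s *\<^sub>R x \<in> ball 0 1 - {0}" using x s(1) by simp
        then have "Q ((s *\<^sub>R x) /\<^sub>R norm (s *\<^sub>R x))" using elim unfolding s_def by blast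
        then show "Q (x /\<^sub>R norm x)" unfolding direction_scale[OF s(1)] .
      qed
    qed
  qed
  then show ?thesis
    using AE_nonzero
  proof eventually_elim
    case (elim x)
    obtain k where "norm x < real k" using reals_Archimedean2 by blast
    then have "x \<in> ball 0 (real (Suc k)) - {0}" using elim(2) by simp
    then show ?case using elim(1) by blast
  qed
qed

text \<open>The representative on the sphere is extended by 0, since
  \<open>homogeneous_not_integrable\<close> works with functions that are Borel on the whole
  space.\<close>

lemma surface_ex_borel:
  fixes \<phi> :: "real^'n \<Rightarrow> complex"
  assumes "\<phi> \<in> borel_measurable surface_measure"
  obtains \<phi>' where "\<phi>' \<in> borel_measurable borel" "AE \<omega> in surface_measure. \<phi> \<omega> = \<phi>' \<omega>"
proof -
  let ?D = "distr (restrict_space lborel (ball 0 1 - {0})) (restrict_space borel (sphere 0 1)) (\<lambda>x::real^'n. x /\<^sub>R norm x)"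
  let ?S = "scale_measure (of_nat CARD('n)) ?D"
  obtain p where p: "p \<in> borel_measurable ?S" "AE \<omega> in ?S. \<phi> \<omega> = p \<omega>"
    using lebesgue_ex_borel[OF assms[unfolded surface_measure_def]] .
  have "p \<in> borel_measurable (restrict_space borel (sphere 0 1))"
    using p(1) by (subst (asm) measurable_cong_sets[OF sets_scale_measure refl], subst (asm) measurable_cong_sets[OF sets_distr refl])
  then have m: "(\<lambda>\<omega>. indicator (sphere 0 1) \<omega> *\<^sub>R p \<omega>) \<in> borel_measurable borel"
    by (subst (asm) borel_measurable_restrict_space_iff) auto
  have "AE \<omega> in surface_measure. \<phi> \<omega> = p \<omega>"
    unfolding surface_measure_def using p(2) by (rule AE_completion)
  moreover have "AE \<omega> in surface_measure. \<omega> \<in> sphere 0 (1::real)"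
    by (rule AE_I2) (simp add: surface_measure_def space_scale_measure space_restrict_space)
  ultimately have "AE \<omega> in surface_measure. \<phi> \<omega> = indicator (sphere 0 1) \<omega> *\<^sub>R p \<omega>"
    by eventually_elim simp
  with m show thesis by (rule that)
qed

lemma angular_profile_square:
  fixes f :: "real^'n \<Rightarrow> complex"
  assumes n: "CARD('n) \<ge> 3" and f: "has_angular_profile f \<phi>"
  shows "AE x in lebesgue. (cmod (f x))^2 / (norm x)^2 = (cmod (\<phi> (x /\<^sub>R norm x)))^2 / norm x ^ CARD('n)"
proof -
  let ?a = "(real CARD('n) - 2) / 2"
  have "AE x in lebesgue. f x = npow x (- ?a) * \<phi> (x /\<^sub>R norm x)"
    using f by (simp add: has_angular_profile_def)
  then show ?thesis using AE_nonzero
  proof eventually_elim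
    case (elim x)
    have p: "norm x > 0" using elim(2) by simp
    have "(norm x powr (- ?a))^2 * norm x ^ CARD('n) = (norm x)^2"
    proof -
      have "(norm x powr (- ?a))^2 * norm x ^ CARD('n) = norm x powr (2 * (- ?a)) * norm x powr real CARD('n)"
      proof -
        have "(norm x powr (- ?a))^2 = norm x powr (2 * (- ?a))"
          unfolding power2_eq_square powr_add[symmetric] by (simp only: mult_2)
        then show ?thesis using p by (simp only: powr_realpow)
      qed
      also have "\<dots> = norm x powr (2 * (- ?a) + real CARD('n))" by (rule powr_add[symmetric])
      also have "2 * (- ?a) + real CARD('n) = 2" by (simp add: field_simps)
      finally show ?thesis using p by simp
    qed
    then have "(norm x powr (- ?a))^2 / (norm x)^2 = 1 / norm x ^ CARD('n)"
      using p by (simp add: field_simps)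
    moreover have "(cmod (f x))^2 / (norm x)^2 = (norm x powr (- ?a))^2 / (norm x)^2 * (cmod (\<phi> (x /\<^sub>R norm x)))^2"
      unfolding elim(1) by (simp add: norm_mult power_mult_distrib)
    ultimately show ?case by simp
  qed
qed

lemma angular_profile_infinite:
  fixes \<phi> :: "real^'n \<Rightarrow> complex"
  assumes \<phi>: "\<phi> \<in> borel_measurable surface_measure"
    and nz: "(\<integral>\<^sup>+\<omega>. ennreal ((cmod (\<phi> \<omega>))^2) \<partial>surface_measure) \<noteq> 0"
  shows "(\<integral>\<^sup>+x. ennreal ((cmod (\<phi> (x /\<^sub>R norm x)))^2 / norm x ^ CARD('n)) \<partial>lebesgue) = \<infinity>"
proof (rule ccontr)
  assume "\<not> ?thesis"
  then have fin: "(\<integral>\<^sup>+x. ennreal ((cmod (\<phi> (x /\<^sub>R norm x)))^2 / norm x ^ CARD('n)) \<partial>lebesgue) < \<infinity>"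
    by (simp add: less_top)
  obtain \<phi>' where \<phi>': "\<phi>' \<in> borel_measurable borel" and e: "AE \<omega> in surface_measure. \<phi> \<omega> = \<phi>' \<omega>"
    by (rule surface_ex_borel[OF \<phi>])
  define P where "P x = (cmod (\<phi>' (x /\<^sub>R norm x)))^2" for x :: "real^'n"
  have Pm: "P \<in> borel_measurable borel" unfolding P_def using \<phi>' by measurable
  have hom: "P (t *\<^sub>R x) = P x" if "t > 0" for t x
    by (simp only: P_def direction_scale[OF that])
  have "(\<integral>\<^sup>+x. ennreal (P x / norm x ^ CARD('n)) \<partial>lebesgue) = (\<integral>\<^sup>+x. ennreal ((cmod (\<phi> (x /\<^sub>R norm x)))^2 / norm x ^ CARD('n)) \<partial>lebesgue)"
  proof (rule nn_integral_cong_AE)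
    show "AE x in lebesgue. ennreal (P x / norm x ^ CARD('n)) = ennreal ((cmod (\<phi> (x /\<^sub>R norm x)))^2 / norm x ^ CARD('n))"
      using AE_surface_cone[OF e] by eventually_elim (simp add: P_def)
  qed
  then have "(\<integral>\<^sup>+x. ennreal (P x / norm x ^ CARD('n)) \<partial>lebesgue) < \<infinity>" using fin by simp
  then have z: "AE x in lebesgue. x \<in> ball 0 1 \<longrightarrow> P x = 0"
    by (rule homogeneous_not_integrable[OF Pm _ hom, rotated -1]) (simp_all add: P_def)
  have "(\<integral>\<^sup>+\<omega>. ennreal ((cmod (\<phi> \<omega>))^2) \<partial>surface_measure) = (\<integral>\<^sup>+\<omega>. ennreal ((cmod (\<phi>' \<omega>))^2) \<partial>surface_measure)"
  proof (rule nn_integral_cong_AE)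
    show "AE \<omega> in surface_measure. ennreal ((cmod (\<phi> \<omega>))^2) = ennreal ((cmod (\<phi>' \<omega>))^2)"
      using e by eventually_elim simp
  qed
  \<comment> \<open>The sphere integral is n times the integral over the unit ball of the extension
    P, which is constant on rays and has just been shown to vanish there.\<close>
  also have "\<dots> = of_nat CARD('n) * (\<integral>\<^sup>+x. ennreal (P x) * indicator (ball 0 1 - {0}) x \<partial>lebesgue)"
    unfolding P_def using \<phi>' by (intro nn_integral_surface) measurable
  also have "(\<integral>\<^sup>+x. ennreal (P x) * indicator (ball 0 1 - {0}) x \<partial>lebesgue) = (\<integral>\<^sup>+x. 0 \<partial>(lebesgue :: (real^'n) measure))"
  proof (rule nn_integral_cong_AE)
    show "AE x in lebesgue. ennreal (P x) * indicator (ball 0 1 - {0}) x = 0"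
      using z by eventually_elim (simp add: indicator_def)
  qed
  finally show False using nz by simp
qed

text \<open>\<open>enn2real\<close> sends infinity to 0, so the four finiteness claims are what
  makes the identities speak of actual norms. The equality case also covers weakly differentiable f,
  because a function in \<open>D12\<close> with an angular profile vanishes almost everywhere:
  \<open>f / |x|\<close> is then square integrable, and the last part forces the profile to be
  0.\<close>

theorem theorem1:
  assumes "CARD('n::finite) \<ge> 3"
  shows
    "(\<forall>f :: real^'n \<Rightarrow> complex. f \<in> D12 \<longrightarrow>
        L2norm (\<lambda>x. f x / complex_of_real (norm x)) < \<infinity> \<and>
        L2norm (radial_deriv f) < \<infinity> \<and>
        L2norm (remainder1 f) < \<infinity> \<and>
        L2norm (remainder2 f) < \<infinity> \<and>
        ((real CARD('n) - 2) / 2)\<^sup>2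
            * (enn2real (L2norm (\<lambda>x. f x / complex_of_real (norm x))))\<^sup>2
          = (enn2real (L2norm (radial_deriv f)))\<^sup>2 - (enn2real (L2norm (remainder1 f)))\<^sup>2 \<and>
        (enn2real (L2norm (radial_deriv f)))\<^sup>2 - (enn2real (L2norm (remainder1 f)))\<^sup>2
          = (enn2real (L2norm (radial_deriv f)))\<^sup>2 - (enn2real (L2norm (remainder2 f)))\<^sup>2)
   \<and> (\<forall>f :: real^'n \<Rightarrow> complex. f \<in> D12 \<or> weakly_differentiable f \<longrightarrow>
        (L2norm (remainder1 f) = 0 \<longleftrightarrow> (\<exists>\<phi>. has_angular_profile f \<phi>)) \<and>
        (L2norm (remainder2 f) = 0 \<longleftrightarrow> (\<exists>\<phi>. has_angular_profile f \<phi>)))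
   \<and> (\<forall>(f :: real^'n \<Rightarrow> complex) \<phi>. has_angular_profile f \<phi> \<longrightarrow>
        (AE x in lebesgue.
           (cmod (f x))\<^sup>2 / (norm x)\<^sup>2 = (cmod (\<phi> (x /\<^sub>R norm x)))\<^sup>2 / norm x ^ CARD('n)) \<and>
        ((\<integral>\<^sup>+\<omega>. ennreal ((cmod (\<phi> \<omega>))\<^sup>2) \<partial>surface_measure) \<noteq> 0 \<longrightarrow>
           L2norm (\<lambda>x. f x / complex_of_real (norm x)) = \<infinity> \<and>
           \<not> integrable lebesgue (\<lambda>x. (cmod (f x))\<^sup>2 / (norm x)\<^sup>2) \<and>
           \<not> integrable lebesgue (\<lambda>x. (cmod (\<phi> (x /\<^sub>R norm x)))\<^sup>2 / norm x ^ CARD('n))))"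
proof (intro conjI allI impI)
  fix f :: "real^'n \<Rightarrow> complex" assume f: "f \<in> D12"
  note D = D12_hardy[OF assms f]
  note r = L2norm_cong_AE[OF remainder2_eq_remainder1[OF D(1)]]
  show "L2norm (\<lambda>x. f x / cnorm x) < \<infinity>" by (rule L2norm_integrable[OF D(2)])
  show "L2norm (radial_deriv f) < \<infinity>" by (rule L2norm_integrable[OF D(3)])
  show "L2norm (remainder1 f) < \<infinity>" by (rule L2norm_integrable[OF D(4)])
  then show "L2norm (remainder2 f) < \<infinity>" unfolding r .
  show "((real CARD('n) - 2) / 2)^2 * (enn2real (L2norm (\<lambda>x. f x / cnorm x)))^2
      = (enn2real (L2norm (radial_deriv f)))^2 - (enn2real (L2norm (remainder1 f)))^2"
    unfolding L2norm_integrable(2)[OF D(2)] L2norm_integrable(2)[OF D(3)] L2norm_integrable(2)[OF D(4)]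
    by (rule D(5))
  show "(enn2real (L2norm (radial_deriv f)))^2 - (enn2real (L2norm (remainder1 f)))^2
      = (enn2real (L2norm (radial_deriv f)))^2 - (enn2real (L2norm (remainder2 f)))^2"
    unfolding r ..
next
  fix f :: "real^'n \<Rightarrow> complex" assume "f \<in> D12 \<or> weakly_differentiable f"
  \<comment> \<open>Both alternatives give weak differentiability, and that alone decides when the
    remainder vanishes.\<close>
  then have f: "weakly_differentiable f" using D12_hardy(1)[OF assms] by blast
  show "L2norm (remainder1 f) = 0 \<longleftrightarrow> (\<exists>\<phi>. has_angular_profile f \<phi>)"
    "L2norm (remainder2 f) = 0 \<longleftrightarrow> (\<exists>\<phi>. has_angular_profile f \<phi>)"
    by (rule remainder_zero_iff[OF f])+
next
  fix f \<phi> :: "real^'n \<Rightarrow> complex" assume f: "has_angular_profile f \<phi>"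
  show e: "AE x in lebesgue. (cmod (f x))^2 / (norm x)^2 = (cmod (\<phi> (x /\<^sub>R norm x)))^2 / norm x ^ CARD('n)"
    by (rule angular_profile_square[OF assms f])
  assume nz: "(\<integral>\<^sup>+\<omega>. ennreal ((cmod (\<phi> \<omega>))^2) \<partial>surface_measure) \<noteq> 0"
  have I2: "(\<integral>\<^sup>+x. ennreal ((cmod (\<phi> (x /\<^sub>R norm x)))^2 / norm x ^ CARD('n)) \<partial>lebesgue) = \<infinity>"
    using f by (intro angular_profile_infinite nz) (simp add: has_angular_profile_def)
  have I1: "(\<integral>\<^sup>+x. ennreal ((cmod (f x))^2 / (norm x)^2) \<partial>lebesgue) = \<infinity>"
    unfolding I2[symmetric]
  proof (rule nn_integral_cong_AE)
    show "AE x in lebesgue. ennreal ((cmod (f x))^2 / (norm x)^2) = ennreal ((cmod (\<phi> (x /\<^sub>R norm x)))^2 / norm x ^ CARD('n))"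
      using e by eventually_elim simp
  qed
  have ni: "\<not> integrable lebesgue g" if "(\<integral>\<^sup>+x. ennreal (g x) \<partial>lebesgue) = \<infinity>" "\<And>x. g x \<ge> 0" for g :: "real^'n \<Rightarrow> real"
    using that by (auto simp: integrable_iff_bounded)
  show "\<not> integrable lebesgue (\<lambda>x. (cmod (f x))^2 / (norm x)^2)" by (rule ni[OF I1]) simp
  show "\<not> integrable lebesgue (\<lambda>x. (cmod (\<phi> (x /\<^sub>R norm x)))^2 / norm x ^ CARD('n))" by (rule ni[OF I2]) simp
  have "(nn_sq lebesgue (\<lambda>x. f x / cnorm x)) = \<infinity>"
    using I1 by (simp add: norm_divide power_divide)
  then show "L2norm (\<lambda>x. f x / cnorm x) = \<infinity>" by (simp add: L2norm_def)
qed

end
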